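(* Let $0<\alpha<1$, let $A$ be a selfadjoint operator in a separable Hilbert space $H$, and let $F$ be a nonlinearity satisfying the Lipschitz assumption (A) and the growth assumption (B) described in the context, with associated norms $\rho(\cdot)$ and $\varrho(\cdot)$. If $x\in D(A)$ satisfies $|x|_2:=\max\{\|x\|_{D(A)},\rho(x),\varrho(x)\}<\infty$, then the problem $$iD_t^\alpha u+Au+F(u)=0\quad(t>0),\qquad u(0)=x,$$ admits a unique strict solution $u$ on $[0,\infty)$, in the class $$u\in C([0,\infty);D(A)),\qquad \mathbf{D}_t^\alpha(u-x)\in C([0,\infty);H).$$
   Context: $D(A)$ carries the graph norm $\|x\|_{D(A)}=\|x\|_H+\|Ax\|_H$. For $\beta>0$ let $g_\beta(t)=t^{\beta-1}/\Gamma(\beta)$ for $t>0$ and $g_\beta(t)=0$ for $t\le 0$, and $(f*h)(t)=\int_0^t f(t-\tau)h(\tau)\,d\tau$. The Riemann--Liouville derivative is $\mathbf{D}_t^\alpha u=\frac{d}{dt}(g_{1-\alpha}*u)$ and the Caputo derivative is $D_t^\alpha u=\mathbf{D}_t^\alpha(u-u(0))$. The nonlinearity is a map $F:D(A)\to D(A)$, and for a $D(A)$-valued function $u$ of $t$, $F(u)$ denotes $t\mapsto F(u(t))$. Assumption (A): $F(0)=0$; and, for a fixed norm $\rho(\cdot)$ on initial data, whenever $u,v$ are $D(A)$-valued functions such that $\|u(t)\|_{D(A)}$ and $\|v(t)\|_{D(A)}$ are bounded a.e. on an interval $I\subset[0,\infty)$, then $\|F(u)-F(v)\|_{D(A)}\le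 C\|u(t)-v(t)\|_{D(A)}$ for a.e. $t\in I$, where $C$ depends on $\rho(u(0)),\rho(v(0))$ and on the essential upper bounds of $\|u(t)\|_{D(A)}$ and $\|v(t)\|_{D(A)}$ on $I$. The class $C_\infty[0,\infty)$ consists of the continuous, nondecreasing functions $w:[0,\infty)\to[0,\infty)$ with $w(0)=0$, $w(\sigma)\ne0$ for $\sigma\neq0$, for which there exists $\varepsilon>0$ such that $$\int_1^\infty\frac{\sigma^{\frac1\alpha+\varepsilon-1}}{w(\sigma)^{\frac1\alpha+\varepsilon}}\,d\sigma=\infty.$$ Assumption (B): there exist $w\in C_\infty[0,\infty)$ and a positive constant $C$, depending on the initial data $u(0)$ through a fixed norm $\varrho(u(0))$, such that $\|F(u)\|_{D(A)}\le C\,w(\|u(t)\|_{D(A)})$ pointwise in $t$. (The norms $\rho,\varrho$ are allowed to be infinite for some elements.) A strict solution on $[0,\infty)$ with initial value $x$ is a function $u\in C([0,\infty);D(A))$ with $\mathbf{D}_t^\alpha(u-u(0))\in C([0,\infty);H)$, $u(0)=x$, satisfying the equation. *)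

theory Defs
  imports "HOL-Analysis.Analysis"
begin

text \<open>
  Complex inner product spaces, built on top of the real normed structure. The inner product is
  conjugate-linear in the first and linear in the second argument; positive definiteness is
  contained in \<open>cinner_self\<close>.
\<close>

class complex_inner = real_normed_vector +
  fixes scaleC :: "complex \<Rightarrow> 'a \<Rightarrow> 'a" (infixr "*\<^sub>C" 75)
    and cinner :: "'a \<Rightarrow> 'a \<Rightarrow> complex"
  assumes scaleC_add_right: "c *\<^sub>C (x + y) = c *\<^sub>C x + c *\<^sub>C y"
    and scaleC_add_left: "(c + d) *\<^sub>C x = c *\<^sub>C x + d *\<^sub>C x"
    and scaleC_scaleC: "c *\<^sub>C d *\<^sub>C x = (c * d) *\<^sub>C x"
    and scaleC_of_real: "complex_of_real r *\<^sub>C x = r *\<^sub>R x"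
    and cinner_commute: "cinner x y = cnj (cinner y x)"
    and cinner_add_right: "cinner x (y + z) = cinner x y + cinner x z"
    and cinner_scaleC_right: "cinner x (c *\<^sub>C y) = c * cinner x y"
    and cinner_self: "cinner x x = complex_of_real ((norm x)\<^sup>2)"

class complex_hilbert = complex_inner + banach

instantiation complex :: complex_hilbert
begin

definition scaleC_complex_def: "scaleC c x = c * (x :: complex)"
definition cinner_complex_def: "cinner x y = cnj x * (y :: complex)"

instance
proof
  show "cinner x x = complex_of_real ((norm x)\<^sup>2)" for x :: complex
    unfolding cinner_complex_def by (metis complex_norm_square mult.commute)
qed (auto simp: scaleC_complex_def cinner_complex_def algebra_simps scaleR_conv_of_real)

end

text \<open>
  An unbounded operator is a pair of a domain \<open>D\<close> and a function \<open>A\<close>; the values of \<open>A\<close> outside \<open>D\<close>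
  are irrelevant.
\<close>

definition densely_defined_operator :: "'a::complex_hilbert set \<Rightarrow> ('a \<Rightarrow> 'a) \<Rightarrow> bool" where
  "densely_defined_operator D A \<longleftrightarrow>
     0 \<in> D \<and> (\<forall>x\<in>D. \<forall>y\<in>D. x + y \<in> D) \<and> (\<forall>c. \<forall>x\<in>D. c *\<^sub>C x \<in> D) \<and>
     (\<forall>x\<in>D. \<forall>y\<in>D. A (x + y) = A x + A y) \<and> (\<forall>c. \<forall>x\<in>D. A (c *\<^sub>C x) = c *\<^sub>C A x) \<and>
     closure D = UNIV"

definition operator_graph :: "'a set \<Rightarrow> ('a \<Rightarrow> 'a) \<Rightarrow> ('a \<times> 'a) set" where
  "operator_graph D A = {(x, A x) | x. x \<in> D}"

text \<open>The graph of the adjoint: \<open>y\<close> is in the domain of \<open>A\<^sup>*\<close> and \<open>A\<^sup>* y = z\<close>.\<close>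

definition adjoint_graph :: "'a::complex_hilbert set \<Rightarrow> ('a \<Rightarrow> 'a) \<Rightarrow> ('a \<times> 'a) set" where
  "adjoint_graph D A = {(y, z). \<forall>x\<in>D. cinner (A x) y = cinner x z}"

definition selfadjoint_operator :: "'a::complex_hilbert set \<Rightarrow> ('a \<Rightarrow> 'a) \<Rightarrow> bool" where
  "selfadjoint_operator D A \<longleftrightarrow>
     densely_defined_operator D A \<and> adjoint_graph D A = operator_graph D A"

definition graph_norm :: "('a::real_normed_vector \<Rightarrow> 'a) \<Rightarrow> 'a \<Rightarrow> real" where
  "graph_norm A x = norm x + norm (A x)"

text \<open>A norm on the subspace \<open>D\<close> that may take the value \<open>\<infinity>\<close>.\<close>

definition extended_norm_on :: "'a::complex_hilbert set \<Rightarrow> ('a \<Rightarrow> ennreal) \<Rightarrow> bool" where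
  "extended_norm_on D \<rho> \<longleftrightarrow>
     (\<forall>x\<in>D. \<rho> x = 0 \<longleftrightarrow> x = 0) \<and>
     (\<forall>c. \<forall>x\<in>D. \<rho> (c *\<^sub>C x) = ennreal (cmod c) * \<rho> x) \<and>
     (\<forall>x\<in>D. \<forall>y\<in>D. \<rho> (x + y) \<le> \<rho> x + \<rho> y)"

definition g_kernel :: "real \<Rightarrow> real \<Rightarrow> real" where
  "g_kernel \<beta> t = (if t > 0 then t powr (\<beta> - 1) / Gamma \<beta> else 0)"

definition convolution ::
    "(real \<Rightarrow> real) \<Rightarrow> (real \<Rightarrow> 'a::{banach, second_countable_topology}) \<Rightarrow> real \<Rightarrow> 'a" where
  "convolution f h t = (LINT \<tau>:{0..t}|lborel. f (t - \<tau>) *\<^sub>R h \<tau>)"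

text \<open>
  Derivatives are taken relative to \<open>[0,\<infinity>)\<close>, hence one-sided at \<open>0\<close> and ordinary at \<open>t > 0\<close>.
  Since \<^const>\<open>vector_derivative\<close> is total, differentiability is tracked separately by
  \<open>RL_differentiable\<close>.
\<close>

definition RL_differentiable ::
    "real \<Rightarrow> (real \<Rightarrow> 'a::{banach, second_countable_topology}) \<Rightarrow> real \<Rightarrow> bool" where
  "RL_differentiable \<alpha> u t \<longleftrightarrow>
     convolution (g_kernel (1 - \<alpha>)) u differentiable (at t within {0..})"

definition RL_deriv ::
    "real \<Rightarrow> (real \<Rightarrow> 'a::{banach, second_countable_topology}) \<Rightarrow> real \<Rightarrow> 'a" where
  "RL_deriv \<alpha> u t = vector_derivative (convolution (g_kernel (1 - \<alpha>)) u) (at t within {0..})"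

definition caputo_deriv ::
    "real \<Rightarrow> (real \<Rightarrow> 'a::{banach, second_countable_topology}) \<Rightarrow> real \<Rightarrow> 'a" where
  "caputo_deriv \<alpha> u = RL_deriv \<alpha> (\<lambda>t. u t - u 0)"

text \<open>
  In both assumptions below the constant is a function of the (finite) norms of the initial values;
  nothing is required of functions whose initial value has infinite norm. The functions \<open>u\<close>, \<open>v\<close> are
  only considered on \<open>[0,\<infinity>)\<close>; \<open>M\<close> and \<open>N\<close> are essential upper bounds on the interval \<open>I\<close>.
\<close>

definition assumption_A ::
    "'a::complex_hilbert set \<Rightarrow> ('a \<Rightarrow> 'a) \<Rightarrow> ('a \<Rightarrow> 'a) \<Rightarrow> ('a \<Rightarrow> ennreal) \<Rightarrow> bool" where
  "assumption_A D A F \<rho> \<longleftrightarrow>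
     F 0 = 0 \<and>
     (\<exists>C :: ennreal \<Rightarrow> ennreal \<Rightarrow> real \<Rightarrow> real \<Rightarrow> real.
        \<forall>(I :: real set) u v M N.
          is_interval I \<and> I \<subseteq> {0..} \<and> (\<forall>t\<ge>0. u t \<in> D) \<and> (\<forall>t\<ge>0. v t \<in> D) \<and>
          \<rho> (u 0) < \<infinity> \<and> \<rho> (v 0) < \<infinity> \<and>
          (AE t in lborel. t \<in> I \<longrightarrow> graph_norm A (u t) \<le> M) \<and>
          (AE t in lborel. t \<in> I \<longrightarrow> graph_norm A (v t) \<le> N) \<longrightarrow>
          (AE t in lborel. t \<in> I \<longrightarrow>
             graph_norm A (F (u t) - F (v t))
               \<le> C (\<rho> (u 0)) (\<rho> (v 0)) M N * graph_norm A (u t - v t)))"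

definition C_infty :: "real \<Rightarrow> (real \<Rightarrow> real) set" where
  "C_infty \<alpha> = {w.
     continuous_on {0..} w \<and> mono_on {0..} w \<and> (\<forall>\<sigma>\<ge>0. w \<sigma> \<ge> 0) \<and>
     w 0 = 0 \<and> (\<forall>\<sigma>\<ge>0. \<sigma> \<noteq> 0 \<longrightarrow> w \<sigma> \<noteq> 0) \<and>
     (\<exists>\<epsilon>>0. (\<integral>\<^sup>+\<sigma>\<in>{1..}.
        ennreal (\<sigma> powr (1 / \<alpha> + \<epsilon> - 1) / w \<sigma> powr (1 / \<alpha> + \<epsilon>)) \<partial>lborel) = \<infinity>)}"

definition assumption_B ::
    "real \<Rightarrow> 'a::complex_hilbert set \<Rightarrow> ('a \<Rightarrow> 'a) \<Rightarrow> ('a \<Rightarrow> 'a) \<Rightarrow> ('a \<Rightarrow> ennreal) \<Rightarrow> bool" where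
  "assumption_B \<alpha> D A F \<rho> \<longleftrightarrow>
     (\<exists>w\<in>C_infty \<alpha>. \<exists>C :: ennreal \<Rightarrow> real. (\<forall>r. C r > 0) \<and>
        (\<forall>u. (\<forall>t\<ge>0. u t \<in> D) \<and> \<rho> (u 0) < \<infinity> \<longrightarrow>
           (\<forall>t\<ge>(0::real). graph_norm A (F (u t)) \<le> C (\<rho> (u 0)) * w (graph_norm A (u t)))))"

text \<open>Membership in \<open>C([0,\<infinity>); D(A))\<close>, with \<open>D(A)\<close> carrying the graph norm.\<close>

definition continuous_into_domain ::
    "'a::real_normed_vector set \<Rightarrow> ('a \<Rightarrow> 'a) \<Rightarrow> (real \<Rightarrow> 'a) \<Rightarrow> bool" where
  "continuous_into_domain D A u \<longleftrightarrow>
     (\<forall>t\<ge>0. u t \<in> D \<and> ((\<lambda>s. graph_norm A (u s - u t)) \<longlongrightarrow> 0) (at t within {0..}))"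

definition strict_solution ::
    "real \<Rightarrow> 'a::{complex_hilbert, second_countable_topology} set \<Rightarrow> ('a \<Rightarrow> 'a) \<Rightarrow> ('a \<Rightarrow> 'a) \<Rightarrow>
     'a \<Rightarrow> (real \<Rightarrow> 'a) \<Rightarrow> bool" where
  "strict_solution \<alpha> D A F x u \<longleftrightarrow>
     continuous_into_domain D A u \<and>
     (\<forall>t\<ge>0. RL_differentiable \<alpha> (\<lambda>s. u s - u 0) t) \<and>
     continuous_on {0..} (RL_deriv \<alpha> (\<lambda>s. u s - u 0)) \<and>
     u 0 = x \<and>
     (\<forall>t>0. \<i> *\<^sub>C caputo_deriv \<alpha> u t + A (u t) + F (u t) = 0)"

end

theory Submission
  imports Defs
begin

text \<open>
  Multiplication by \<open>-\<i>\<close> turns the problem into \<open>D\<^sub>t\<^sup>\<alpha> u = B u + G(u)\<close> with \<open>B = \<i> A\<close>, which is m-dissipative,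
  and \<open>G = \<i> F\<close>; in integrated form it reads \<open>u = x + g\<^sub>\<alpha> * (B u + G(u))\<close>. The assumptions force \<open>F\<close> to be
  Lipschitz on bounded sets of \<open>D(A)\<close>, whatever the norms \<open>\<rho>\<close>, \<open>\<rho>'\<close> are.

  Everything rests on the estimate \<open>|u(t)| \<le> |x| + (g\<^sub>\<alpha> * |f|)(t)\<close> for \<open>u = x + g\<^sub>\<alpha> * (B u + f)\<close>. It is a
  maximum principle: if \<open>\<psi> = |u| - |x| - g\<^sub>\<alpha> * |f|\<close> had a positive maximum at \<open>t\<^sub>0\<close>, one replaces the kernel
  \<open>t\<^sup>-\<^sup>\<alpha>\<close> of the fractional derivative by \<open>(t + \<epsilon>)\<^sup>-\<^sup>\<alpha>\<close>, for which the derivative at \<open>t\<^sub>0\<close> is \<open>\<epsilon>\<^sup>-\<^sup>\<alpha> u(t\<^sub>0)\<close> minus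
  an average of earlier values with nonnegative weights, uses \<open>\<kappa> |u| \<le> |\<kappa> u - B u|\<close> with \<open>\<kappa>\<close> proportional to
  \<open>\<epsilon>\<^sup>-\<^sup>\<alpha>\<close>, and lets \<open>\<epsilon> \<rightarrow> 0\<close>. The estimate gives uniqueness, and it makes the solutions of the linear
  problem with \<open>B\<close> replaced by its Yosida approximations converge.

  The nonlinear problem is first solved with \<open>G\<close> truncated outside the ball of radius \<open>M(t)\<close> in \<open>D(A)\<close>, by
  Picard iteration in a weighted norm. By Hoelder's inequality with exponent \<open>1/\<alpha> + \<epsilon>\<close> and Osgood's argument, the growth
  assumption bounds \<open>\<parallel>u(t)\<parallel>\<^bsub>D(A)\<^esub>\<close> independently of the truncation, so that \<open>M\<close> can be chosen beforehand to make
  the truncation inactive.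
\<close>

section \<open>Convolution\<close>

text \<open>The memory of the fractional derivative shapes the argument: a solution on [0,T] cannot
  simply be restarted at T, so local solutions are not continued. Every construction works on
  [0,\<infinity>) at once, with constants that depend only on the horizon T; this is why the
  truncation radius is a function M of time. Since \<open>F\<close> acts in D(A), the working norm
  is the graph norm, and the linear estimate is wanted for u and for B u. But B u need not take
  values in D(A), where dissipativity is available; the estimate for B u therefore passes through
  bounded operators that commute with B. The exponent q = 1/\<alpha> + \<epsilon> is dictated by the
  kernel: its conjugate exponent p satisfies (1 - \<alpha>) p < 1, which is exactly what puts
  g_\<alpha> into L^p near 0. At q = 1/\<alpha> this integrability fails.\<close>

lemma lborel_set_integral_of_has_integral:
  fixes f :: "real \<Rightarrow> real"
  assumes f: "f \<in> borel_measurable borel" and S: "S \<in> sets borel"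
    and I: "(f has_integral I) S" and nonneg: "\<And>x. x \<in> S \<Longrightarrow> 0 \<le> f x"
  shows "set_integrable lborel S f" and "(LINT x:S|lborel. f x) = I"
proof -
  \<comment> \<open>Nonnegativity makes the gauge integral absolutely convergent, so that the closed
    forms known for \<open>has_integral\<close> (powers, Beta) become Lebesgue integrals even when
    the integrand is singular at an endpoint.\<close>
  have "f absolutely_integrable_on S"
    using I nonneg by (intro nonnegative_absolutely_integrable_1) (auto simp: integrable_on_def)
  moreover have "(\<lambda>x. indicator S x *\<^sub>R f x) \<in> borel_measurable lborel"
    using f S by measurable
  ultimately show si: "set_integrable lborel S f"
    unfolding set_integrable_def by (simp add: integrable_completion)
  show "(LINT x:S|lborel. f x) = I"
    using set_borel_integral_eq_integral(2)[OF si] I by (simp add: integral_unique)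
qed

lemma continuous_on_interval_bound:
  fixes h :: "real \<Rightarrow> 'a::real_normed_vector"
  assumes "continuous_on {a..b} h"
  obtains M where "0 \<le> M" "\<And>s. a \<le> s \<Longrightarrow> s \<le> b \<Longrightarrow> norm (h s) \<le> M"
proof -
  have "bounded (h ` {a..b})"
    by (intro compact_imp_bounded compact_continuous_image assms) auto
  then obtain M where "\<forall>x\<in>h ` {a..b}. norm x \<le> M"
    unfolding bounded_iff by blast
  then have "\<And>s. a \<le> s \<Longrightarrow> s \<le> b \<Longrightarrow> norm (h s) \<le> max 0 M"
    by (auto intro: order.trans[OF _ max.cobounded2])
  then show thesis by (intro that[of "max 0 M"]) auto
qed

text \<open>Measurability is asked on the whole line because the kernel occurs reflected and
  shifted, as p(t - s). Integrability is asked on \<open>{0..t}\<close> only: values at negative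
  arguments never enter a convolution.\<close>

definition loc_integrable :: "(real \<Rightarrow> real) \<Rightarrow> bool" where
  "loc_integrable p \<longleftrightarrow> p \<in> borel_measurable borel \<and> (\<forall>t. set_integrable lborel {0..t} p)"

lemma loc_integrableD:
  assumes "loc_integrable p"
  shows "p \<in> borel_measurable borel" "set_integrable lborel {0..t} p"
  using assms by (auto simp: loc_integrable_def)

lemma set_integrable_continuous_mult:
  fixes h :: "real \<Rightarrow> 'a::{banach, second_countable_topology}"
  assumes p: "p \<in> borel_measurable borel" "set_integrable lborel {a..b} p"
    and h: "continuous_on {a..b} h"
  shows "set_integrable lborel {a..b} (\<lambda>s. p s *\<^sub>R h s)"
proof -
  obtain M where M: "\<And>s. a \<le> s \<Longrightarrow> s \<le> b \<Longrightarrow> norm (h s) \<le> M"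
    using continuous_on_interval_bound[OF h] by blast
  have hm: "(\<lambda>s. indicator {a..b} s *\<^sub>R h s) \<in> borel_measurable borel"
    using h by (intro borel_measurable_continuous_on_indicator) auto
  have "(\<lambda>s. p s *\<^sub>R (indicator {a..b} s *\<^sub>R h s)) \<in> borel_measurable borel"
    by (intro borel_measurable_scaleR p hm)
  then have "(\<lambda>s. indicator {a..b} s *\<^sub>R (p s *\<^sub>R h s)) \<in> borel_measurable lborel"
    by (simp add: mult.commute)
  moreover have "set_integrable lborel {a..b} (\<lambda>s. \<bar>p s\<bar> * M)"
    using p(2) by (intro set_integrable_mult_left set_integrable_abs)
  ultimately show ?thesis
    by (rule_tac set_integrable_bound[where f = "\<lambda>s. \<bar>p s\<bar> * M"])
       (auto simp: set_borel_measurable_def abs_mult intro!: AE_I2 mult_left_mono order.trans[OF M abs_ge_self])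
qed

lemma convolution_alt:
  "convolution p h t = (LINT s:{0..t}|lborel. p s *\<^sub>R h (t - s))"
proof -
  have "convolution p h t = (LINT s|lborel. indicator {0..t} (t - s) *\<^sub>R (p (t - (t - s)) *\<^sub>R h (t - s)))"
    unfolding convolution_def set_lebesgue_integral_def
    by (subst lborel_integral_real_affine[where c = "-1" and t = t]) auto
  also have "\<dots> = (LINT s:{0..t}|lborel. p s *\<^sub>R h (t - s))"
    unfolding set_lebesgue_integral_def by (intro Bochner_Integration.integral_cong) (auto simp: indicator_def)
  finally show ?thesis .
qed

lemma set_integrable_reflect:
  fixes p :: "real \<Rightarrow> 'a::{banach, second_countable_topology}"
  assumes "set_integrable lborel {0..t} p"
  shows "set_integrable lborel {0..t} (\<lambda>s. p (t - s))"
proof -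
  have "integrable lborel (\<lambda>s. indicator {0..t} (t + (-1) * s) *\<^sub>R p (t + (-1) * s))"
    using assms unfolding set_integrable_def by (intro lborel_integrable_real_affine) auto
  then show ?thesis
    unfolding set_integrable_def
    by (rule Bochner_Integration.integrable_cong[THEN iffD1, rotated -1]) (auto simp: indicator_def)
qed

lemma convolution_integrable:
  fixes h :: "real \<Rightarrow> 'a::{banach, second_countable_topology}"
  assumes "loc_integrable p" "continuous_on {0..} h"
  shows "set_integrable lborel {0..t} (\<lambda>s. p (t - s) *\<^sub>R h s)"
proof (rule set_integrable_continuous_mult)
  show "(\<lambda>s. p (t - s)) \<in> borel_measurable borel"
    using loc_integrableD(1)[OF assms(1)] by measurable
  show "set_integrable lborel {0..t} (\<lambda>s. p (t - s))"
    by (intro set_integrable_reflect loc_integrableD assms)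
  show "continuous_on {0..t} h" using assms(2) by (rule continuous_on_subset) auto
qed

lemma convolution_cong:
  assumes "\<And>s. 0 \<le> s \<Longrightarrow> s \<le> t \<Longrightarrow> h s = h' s"
  shows "convolution p h t = convolution p h' t"
  unfolding convolution_def by (intro set_lebesgue_integral_cong) (auto simp: assms)

lemma convolution_add:
  fixes h g :: "real \<Rightarrow> 'a::{banach, second_countable_topology}"
  assumes "loc_integrable p" "continuous_on {0..} h" "continuous_on {0..} g"
  shows "convolution p (\<lambda>s. h s + g s) t = convolution p h t + convolution p g t"
  unfolding convolution_def scaleR_right_distrib
  by (intro set_integral_add convolution_integrable assms)

lemma convolution_diff:
  fixes h g :: "real \<Rightarrow> 'a::{banach, second_countable_topology}"
  assumes "loc_integrable p" "continuous_on {0..} h" "continuous_on {0..} g"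
  shows "convolution p (\<lambda>s. h s - g s) t = convolution p h t - convolution p g t"
  unfolding convolution_def scaleR_right_diff_distrib
  by (intro set_integral_diff convolution_integrable assms)

lemma convolution_bounded_linear:
  fixes h :: "real \<Rightarrow> 'a::{banach, second_countable_topology}"
    and L :: "'a \<Rightarrow> 'b::{banach, second_countable_topology}"
  assumes "bounded_linear L" "loc_integrable p" "continuous_on {0..} h"
  shows "L (convolution p h t) = convolution p (\<lambda>s. L (h s)) t"
proof -
  interpret bounded_linear L by fact
  have "L (convolution p h t) = (LINT s|lborel. L (indicator {0..t} s *\<^sub>R (p (t - s) *\<^sub>R h s)))"
    unfolding convolution_def set_lebesgue_integral_def
    using convolution_integrable[OF assms(2,3), of t] unfolding set_integrable_def
    by (intro integral_bounded_linear[OF assms(1), symmetric])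
  then show ?thesis by (simp add: convolution_def set_lebesgue_integral_def scaleR)
qed

lemma convolution_scaleR:
  fixes c :: real
  shows "convolution p (\<lambda>s. c *\<^sub>R h s) t = c *\<^sub>R convolution p h t"
proof -
  have "(\<lambda>s. p (t - s) *\<^sub>R c *\<^sub>R h s) = (\<lambda>s. c *\<^sub>R (p (t - s) *\<^sub>R h s))"
    by (simp add: algebra_simps)
  then show ?thesis by (simp only: convolution_def set_integral_scaleR_right)
qed

lemma convolution_mono:
  fixes f g :: "real \<Rightarrow> real"
  assumes "loc_integrable p" "continuous_on {0..} f" "continuous_on {0..} g"
    and "\<And>s. 0 \<le> s \<Longrightarrow> 0 \<le> p s" "\<And>s. 0 \<le> s \<Longrightarrow> s \<le> t \<Longrightarrow> f s \<le> g s"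
  shows "convolution p f t \<le> convolution p g t"
  unfolding convolution_def
  by (intro set_integral_mono convolution_integrable assms) (auto intro!: mult_left_mono assms)

lemma norm_convolution_le:
  fixes h :: "real \<Rightarrow> 'a::{banach, second_countable_topology}"
  assumes "\<And>s. 0 \<le> s \<Longrightarrow> 0 \<le> p s"
  shows "norm (convolution p h t) \<le> convolution p (\<lambda>s. norm (h s)) t"
proof -
  have "norm (convolution p h t) \<le> (LINT s|lborel. norm (indicator {0..t} s *\<^sub>R (p (t - s) *\<^sub>R h s)))"
    unfolding convolution_def set_lebesgue_integral_def by (rule integral_norm_bound)
  also have "\<dots> = convolution p (\<lambda>s. norm (h s)) t"
    unfolding convolution_def set_lebesgue_integral_def
    by (intro Bochner_Integration.integral_cong) (auto simp: indicator_def assms)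
  finally show ?thesis .
qed

lemma convolution_const:
  assumes "loc_integrable p"
  shows "convolution p (\<lambda>_. c) t = (LINT s:{0..t}|lborel. p s) *\<^sub>R c"
  unfolding convolution_alt set_lebesgue_integral_def
  using loc_integrableD(2)[OF assms, of t]
  by (subst integral_scaleR_left[symmetric]) (simp_all add: set_integrable_def)

text \<open>With the kernel in the integration variable, the integrands converge for all but one \<open>s\<close>.\<close>

lemma convolution_continuous:
  fixes h :: "real \<Rightarrow> 'a::{banach, second_countable_topology}"
  assumes p: "loc_integrable p" and h: "continuous_on {0..} h"
  shows "continuous_on {0..} (convolution p h)"
proof (rule continuous_on_sequentiallyI)
  fix u :: "nat \<Rightarrow> real" and a
  assume u: "\<forall>n. u n \<in> {0..}" and a: "a \<in> {0..}" and ua: "u \<longlonglongrightarrow> a"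
  obtain T where T: "\<And>n. u n \<le> T"
    using ua by (metis convergentI convergent_imp_Bseq BseqE abs_le_D1 real_norm_def)
  have aT: "a \<le> T" using ua T by (intro LIMSEQ_le_const2[OF ua]) auto
  have "continuous_on {0..T} h" using h by (rule continuous_on_subset) auto
  then obtain M where M0: "0 \<le> M" and M: "\<And>s. 0 \<le> s \<Longrightarrow> s \<le> T \<Longrightarrow> norm (h s) \<le> M"
    using continuous_on_interval_bound by blast
  let ?f = "\<lambda>t s. indicator {0..t} s *\<^sub>R (p s *\<^sub>R h (t - s))"
  have meas: "?f t \<in> borel_measurable lborel" for t
  proof -
    have "(\<lambda>s. indicator {0..t} s *\<^sub>R h (t - s)) \<in> borel_measurable borel"
      by (intro borel_measurable_continuous_on_indicator continuous_on_compose2[OF h] continuous_intros) auto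
    then have "(\<lambda>s. p s *\<^sub>R (indicator {0..t} s *\<^sub>R h (t - s))) \<in> borel_measurable borel"
      by (intro borel_measurable_scaleR[OF loc_integrableD(1)[OF p]])
    then show ?thesis by (simp add: mult.commute)
  qed
  have "(\<lambda>n. LINT s|lborel. ?f (u n) s) \<longlonglongrightarrow> (LINT s|lborel. ?f a s)"
  proof (rule integral_dominated_convergence[where w = "\<lambda>s. indicator {0..T} s *\<^sub>R (\<bar>p s\<bar> * M)"])
    show "integrable lborel (\<lambda>s. indicator {0..T} s *\<^sub>R (\<bar>p s\<bar> * M))"
      using loc_integrableD(2)[OF p, of T, THEN set_integrable_abs, THEN set_integrable_mult_left, of M]
      by (simp add: set_integrable_def)
    show "AE s in lborel. norm (?f (u n) s) \<le> indicator {0..T} s *\<^sub>R (\<bar>p s\<bar> * M)" for n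
    proof (rule AE_I2)
      fix s show "norm (?f (u n) s) \<le> indicator {0..T} s *\<^sub>R (\<bar>p s\<bar> * M)"
        using T[of n] M[of "u n - s"] M0 by (auto simp: indicator_def intro!: mult_left_mono)
    qed
    have "AE s in lborel. s \<noteq> a" by (rule AE_lborel_singleton)
    then show "AE s in lborel. (\<lambda>n. ?f (u n) s) \<longlonglongrightarrow> ?f a s"
    proof eventually_elim
      case (elim s)
      show ?case
      proof (cases "0 \<le> s \<and> s < a")
        case True
        then have ev: "eventually (\<lambda>n. s < u n) sequentially"
          using ua by (auto intro: order_tendstoD)
        have "(\<lambda>n. h (u n - s)) \<longlonglongrightarrow> h (a - s)"
        proof (rule continuous_on_tendsto_compose[OF h])
          show "(\<lambda>n. u n - s) \<longlonglongrightarrow> a - s" by (intro tendsto_intros ua)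
          show "\<forall>\<^sub>F n in sequentially. u n - s \<in> {0..}" using ev by eventually_elim auto
        qed (use True in auto)
        then have "(\<lambda>n. p s *\<^sub>R h (u n - s)) \<longlonglongrightarrow> p s *\<^sub>R h (a - s)" by (intro tendsto_intros)
        moreover have "eventually (\<lambda>n. p s *\<^sub>R h (u n - s) = ?f (u n) s) sequentially"
          using ev by eventually_elim (use True in auto)
        ultimately have "(\<lambda>n. ?f (u n) s) \<longlonglongrightarrow> p s *\<^sub>R h (a - s)"
          by (rule Lim_transform_eventually)
        then show ?thesis using True by simp
      next
        case False
        have "eventually (\<lambda>n. s < 0 \<or> u n < s) sequentially"
          using False elim ua by (auto intro: order_tendstoD)
        then have "eventually (\<lambda>n. ?f a s = ?f (u n) s) sequentially"
          by eventually_elim (use False elim in \<open>auto simp: indicator_def\<close>)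
        then show ?thesis by (rule Lim_transform_eventually[OF tendsto_const])
      qed
    qed
  qed (use meas in auto)
  then show "(\<lambda>n. convolution p h (u n)) \<longlonglongrightarrow> convolution p h a"
    by (simp add: convolution_alt set_lebesgue_integral_def)
qed

lemma convolution_tendsto:
  fixes h :: "real \<Rightarrow> 'a::{banach, second_countable_topology}" and H :: "nat \<Rightarrow> real \<Rightarrow> 'a"
  assumes p: "loc_integrable p" and h: "continuous_on {0..} h" and hn: "\<And>n. continuous_on {0..} (H n)"
    and M: "\<And>n s. 0 \<le> s \<Longrightarrow> s \<le> t \<Longrightarrow> norm (H n s) \<le> M"
    and lim: "\<And>s. 0 \<le> s \<Longrightarrow> s \<le> t \<Longrightarrow> (\<lambda>n. H n s) \<longlonglongrightarrow> h s"
  shows "(\<lambda>n. convolution p (H n) t) \<longlonglongrightarrow> convolution p h t"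
  unfolding convolution_def set_lebesgue_integral_def
proof (rule integral_dominated_convergence[where w = "\<lambda>s. indicator {0..t} s *\<^sub>R (\<bar>p (t - s)\<bar> * M)"])
  show "integrable lborel (\<lambda>s. indicator {0..t} s *\<^sub>R (\<bar>p (t - s)\<bar> * M))"
    using loc_integrableD(2)[OF p, of t, THEN set_integrable_reflect, THEN set_integrable_abs, THEN set_integrable_mult_left, of M]
    by (simp add: set_integrable_def)
  show "AE s in lborel. (\<lambda>n. indicator {0..t} s *\<^sub>R p (t - s) *\<^sub>R H n s) \<longlonglongrightarrow> indicator {0..t} s *\<^sub>R p (t - s) *\<^sub>R h s"
    by (rule AE_I2) (auto simp: indicator_def intro!: tendsto_intros lim)
  show "AE s in lborel. norm (indicator {0..t} s *\<^sub>R p (t - s) *\<^sub>R H n s) \<le> indicator {0..t} s *\<^sub>R (\<bar>p (t - s)\<bar> * M)" for n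
    by (rule AE_I2) (auto simp: indicator_def intro!: mult_left_mono M)
qed (use convolution_integrable[OF p h, of t] convolution_integrable[OF p hn, where t = t] in
      \<open>auto simp: set_integrable_def\<close>)

text \<open>The point is the case without integrability: for nonzero \<open>c\<close> both
  integrands fail to be integrable together, and both sides take the default value 0. In
  \<open>convolution_assoc\<close> this covers the exceptional parameters at which an inner integral
  diverges.\<close>

lemma integral_scaleR_left_borel:
  fixes c :: "'a::{banach, second_countable_topology}" and f :: "'b \<Rightarrow> real"
  assumes [measurable]: "f \<in> borel_measurable M"
  shows "(LINT x|M. f x *\<^sub>R c) = (LINT x|M. f x) *\<^sub>R c"
proof (cases "c = 0 \<or> integrable M f")
  case False
  have "\<not> integrable M (\<lambda>x. f x *\<^sub>R c)"
  proof
    assume "integrable M (\<lambda>x. f x *\<^sub>R c)"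
    then have "integrable M (\<lambda>x. norm (f x *\<^sub>R c) / norm c)"
      by (intro integrable_divide integrable_norm)
    then have "integrable M f"
      by (rule Bochner_Integration.integrable_bound) (use False in auto)
    then show False using False by simp
  qed
  then show ?thesis using False by (simp add: not_integrable_integral_eq)
qed auto

text \<open>The hypothesis on \<open>r\<close> excludes \<open>0\<close>, where every convolution has the value \<open>0\<close>.\<close>

lemma convolution_assoc:
  fixes h :: "real \<Rightarrow> 'a::{banach, second_countable_topology}"
  assumes p: "loc_integrable p" and q: "loc_integrable q" and h: "continuous_on {0..} h"
    and r: "\<And>s. 0 < s \<Longrightarrow> s \<le> t \<Longrightarrow> convolution p q s = r s"
    and rm: "r \<in> borel_measurable borel"
  shows "convolution p (convolution q h) t = convolution r h t"
proof -
  \<comment> \<open>Cut off to \<open>{0..t}\<close>, the three factors are defined and integrable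
    on the whole line, and the supports of \<open>P (t - s)\<close>, \<open>Q (s - u)\<close> and
    \<open>H u\<close> encode the triangle 0 \<le> u \<le> s \<le> t.\<close>
  define P where "P s = indicator {0..t} s * p s" for s
  define Q where "Q s = indicator {0..t} s * q s" for s
  define H where "H s = indicator {0..t} s *\<^sub>R h s" for s
  define \<Phi> where "\<Phi> s u = (P (t - s) * Q (s - u)) *\<^sub>R H u" for s u
  have ht: "continuous_on {0..t} h" using h by (rule continuous_on_subset) auto
  obtain M where M0: "0 \<le> M" and M: "\<And>s. 0 \<le> s \<Longrightarrow> s \<le> t \<Longrightarrow> norm (h s) \<le> M"
    using continuous_on_interval_bound[OF ht] by blast
  have HM: "norm (H s) \<le> M" for s using M0 M[of s] by (auto simp: H_def indicator_def)
  have Pi: "integrable lborel P" and Qi: "integrable lborel Q"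
    using loc_integrableD(2)[OF p, of t] loc_integrableD(2)[OF q, of t]
    by (auto simp: P_def[abs_def] Q_def[abs_def] set_integrable_def)
  have [measurable]: "P \<in> borel_measurable borel" "Q \<in> borel_measurable borel"
    using Pi Qi by auto
  have [measurable]: "H \<in> borel_measurable borel"
    unfolding H_def[abs_def] by (intro borel_measurable_continuous_on_indicator ht) auto
  have Pt: "integrable lborel (\<lambda>s. P (t - s))"
    using lborel_integrable_real_affine[OF Pi, of "-1" t] by simp
  have Qs: "integrable lborel (\<lambda>u. Q (s - u))" for s
    using lborel_integrable_real_affine[OF Qi, of "-1" s] by simp
  have \<Phi>m[measurable]: "case_prod \<Phi> \<in> borel_measurable (lborel \<Otimes>\<^sub>M lborel)"
    unfolding \<Phi>_def by measurable
  have \<Phi>s: "integrable lborel (\<Phi> s)" for s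
  proof (rule Bochner_Integration.integrable_bound)
    show "integrable lborel (\<lambda>u. \<bar>P (t - s)\<bar> * \<bar>Q (s - u)\<bar> * M)"
      using Qs[of s] by auto
    show "\<Phi> s \<in> borel_measurable lborel" unfolding \<Phi>_def[abs_def] by measurable
    show "AE u in lborel. norm (\<Phi> s u) \<le> norm (\<bar>P (t - s)\<bar> * \<bar>Q (s - u)\<bar> * M)"
      using M0 by (intro AE_I2) (auto simp: \<Phi>_def abs_mult intro!: mult_left_mono HM)
  qed
  \<comment> \<open>Integrating first in u bounds the double integral of the norm by
    \<open>M\<close> times the product of the L1 norms of \<open>P\<close> and
    \<open>Q\<close>.\<close>
  have int: "integrable (lborel \<Otimes>\<^sub>M lborel) (case_prod \<Phi>)"
  proof (rule lborel_pair.Fubini_integrable)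
    show "integrable lborel (\<lambda>s. LINT u|lborel. norm (case_prod \<Phi> (s, u)))"
    proof (rule Bochner_Integration.integrable_bound)
      show "integrable lborel (\<lambda>s. \<bar>P (t - s)\<bar> * ((LINT u|lborel. \<bar>Q u\<bar>) * M))"
        using Pt by auto
      have "(LINT u|lborel. norm (\<Phi> s u)) \<le> \<bar>P (t - s)\<bar> * ((LINT u|lborel. \<bar>Q u\<bar>) * M)" for s
      proof -
        have "(LINT u|lborel. norm (\<Phi> s u)) \<le> (LINT u|lborel. \<bar>P (t - s)\<bar> * (\<bar>Q (s - u)\<bar> * M))"
          by (intro integral_mono integrable_norm \<Phi>s integrable_mult_right integrable_mult_left integrable_abs Qs)
             (auto simp: \<Phi>_def abs_mult mult.assoc intro!: mult_left_mono HM)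
        also have "\<dots> = \<bar>P (t - s)\<bar> * ((LINT u|lborel. \<bar>Q (s - u)\<bar>) * M)" by simp
        also have "(LINT u|lborel. \<bar>Q (s - u)\<bar>) = (LINT u|lborel. \<bar>Q u\<bar>)"
          by (subst (2) lborel_integral_real_affine[where c = "-1" and t = s]) auto
        finally show ?thesis .
      qed
      then show "AE s in lborel. norm (LINT u|lborel. norm (case_prod \<Phi> (s, u)))
          \<le> norm (\<bar>P (t - s)\<bar> * ((LINT u|lborel. \<bar>Q u\<bar>) * M))"
        using M0 by (intro AE_I2) (auto simp: abs_mult)
    qed measurable
  qed (use \<Phi>s in \<open>auto intro!: AE_I2\<close>)
  have "convolution p (convolution q h) t = (LINT s|lborel. LINT u|lborel. \<Phi> s u)"
    unfolding convolution_def[of p] set_lebesgue_integral_def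
  proof (intro Bochner_Integration.integral_cong refl)
    fix s
    show "indicator {0..t} s *\<^sub>R p (t - s) *\<^sub>R convolution q h s = (LINT u|lborel. \<Phi> s u)"
    proof (cases "s \<in> {0..t}")
      case True
      have "(LINT u|lborel. \<Phi> s u) = (LINT u|lborel. P (t - s) *\<^sub>R (indicator {0..s} u *\<^sub>R (q (s - u) *\<^sub>R h u)))"
        using True by (intro Bochner_Integration.integral_cong) (auto simp: \<Phi>_def Q_def H_def indicator_def)
      also have "\<dots> = P (t - s) *\<^sub>R convolution q h s"
        unfolding convolution_def set_lebesgue_integral_def by (rule integral_scaleR_right)
      finally show ?thesis using True by (auto simp: P_def indicator_def)
    next
      case False
      then have "\<Phi> s = (\<lambda>_. 0)" by (auto simp: \<Phi>_def P_def indicator_def)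
      then show ?thesis using False by simp
    qed
  qed
  also have "\<dots> = (LINT u|lborel. LINT s|lborel. \<Phi> s u)"
    by (rule lborel_pair.Fubini_integral[symmetric, OF int])
  also have "\<dots> = convolution r h t"
    unfolding convolution_def[of r] set_lebesgue_integral_def
  proof (intro integral_cong_AE)
    show "(\<lambda>u. LINT s|lborel. \<Phi> s u) \<in> borel_measurable lborel"
      using \<Phi>m by (intro lborel.borel_measurable_lebesgue_integral) (simp add: case_prod_beta')
    have "(\<lambda>u. r (t - u) *\<^sub>R H u) \<in> borel_measurable lborel" using rm by measurable
    then show "(\<lambda>x. indicator {0..t} x *\<^sub>R r (t - x) *\<^sub>R h x) \<in> borel_measurable lborel"
      by (simp add: H_def mult.commute)
    have "AE u in lborel. u \<noteq> t" by (rule AE_lborel_singleton)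
    then show "AE u in lborel. (LINT s|lborel. \<Phi> s u) = indicator {0..t} u *\<^sub>R r (t - u) *\<^sub>R h u"
    proof eventually_elim
      case (elim u)
      show ?case
      proof (cases "u \<in> {0..t}")
        case True
        then have u: "0 \<le> u" "u < t" using elim by auto
        have "(LINT s|lborel. \<Phi> s u) = (LINT s|lborel. P (t - s) * Q (s - u)) *\<^sub>R h u"
          using True by (simp add: \<Phi>_def H_def integral_scaleR_left_borel)
        also have "(LINT s|lborel. P (t - s) * Q (s - u)) = (LINT s|lborel. P (t - (u + s)) * Q s)"
          by (subst lborel_integral_real_affine[where c = 1 and t = u]) auto
        also have "\<dots> = convolution p q (t - u)"
          unfolding convolution_def set_lebesgue_integral_def
          using u by (intro Bochner_Integration.integral_cong)
            (auto simp: P_def Q_def indicator_def algebra_simps)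
        also have "\<dots> = r (t - u)" using u by (intro r) auto
        finally show ?thesis using True by simp
      next
        case False
        then have "\<Phi> s u = 0" for s by (simp add: \<Phi>_def H_def)
        then show ?thesis using False by simp
      qed
    qed
  qed
  finally show ?thesis .
qed

text \<open>This is the fundamental theorem of calculus, relative to the half-line so that t = 0 is
  included: over a short interval the mean of \<open>h\<close> differs from \<open>h t\<close> by at
  most the oscillation of \<open>h\<close>.\<close>

lemma convolution_one_has_vector_derivative:
  fixes h :: "real \<Rightarrow> 'a::{banach, second_countable_topology}"
  assumes h: "continuous_on {0..} h" and t: "0 \<le> t"
  shows "(convolution (\<lambda>_. 1) h has_vector_derivative h t) (at t within {0..})"
proof -
  have int: "set_integrable lborel {a..b} h" if "0 \<le> a" for a b
    using that by (intro borel_integrable_atLeastAtMost' continuous_on_subset[OF h]) auto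
  \<comment> \<open>The comparison value \<open>c\<close> is free, so that one bound serves with t
    as the left and as the right endpoint.\<close>
  have est: "norm (convolution (\<lambda>_. 1) h b - convolution (\<lambda>_. 1) h a - (b - a) *\<^sub>R c) \<le> (b - a) * e"
    if ab: "0 \<le> a" "a \<le> b" and e: "\<And>s. a \<le> s \<Longrightarrow> s \<le> b \<Longrightarrow> norm (h s - c) \<le> e" for a b c e
  proof -
    have hm: "set_integrable lborel {a<..b} h"
      by (rule set_integrable_subset[OF int[of a b]]) (use ab in auto)
    have cm: "set_integrable lborel {a<..b} (\<lambda>_. c)"
      by (rule set_integrable_subset[where A = "{a..b}"]) (auto intro!: borel_integrable_atLeastAtMost' continuous_intros)
    have *: "{0..b} = {0..a} \<union> {a<..b}" using ab by auto
    have "convolution (\<lambda>_. 1) h b = convolution (\<lambda>_. 1) h a + (LINT s:{a<..b}|lborel. h s)"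
      unfolding convolution_def scaleR_one *
      by (rule set_integral_Un) (auto intro!: int hm)
    moreover have "(LINT s:{a<..b}|lborel. c) = (b - a) *\<^sub>R c"
      using ab by (subst set_integral_const) auto
    ultimately have "convolution (\<lambda>_. 1) h b - convolution (\<lambda>_. 1) h a - (b - a) *\<^sub>R c
        = (LINT s:{a<..b}|lborel. h s - c)"
      using set_integral_diff(2)[OF hm cm] by simp
    also have "norm \<dots> \<le> (LINT s:{a<..b}|lborel. norm (h s - c))"
      using set_integral_diff(1)[OF hm cm] by (rule set_integral_norm_bound)
    also have "\<dots> \<le> (LINT s:{a<..b}|lborel. e)"
    proof (rule set_integral_mono)
      show "set_integrable lborel {a<..b} (\<lambda>s. norm (h s - c))"
        by (rule set_integrable_norm, rule set_integral_diff(1)[OF hm cm])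
      show "set_integrable lborel {a<..b} (\<lambda>_. e)"
        by (rule set_integrable_subset[where A = "{a..b}"]) (auto intro!: borel_integrable_atLeastAtMost' continuous_intros)
    qed (auto intro: e)
    also have "\<dots> = (b - a) * e" using ab by (subst set_integral_const) auto
    finally show ?thesis .
  qed
  show ?thesis
    unfolding has_vector_derivative_def has_derivative_within_alt2
  proof (intro conjI allI impI bounded_linear_scaleR_left)
    fix e :: real assume "0 < e"
    then have "\<forall>\<^sub>F s in at t within {0..}. dist (h s) (h t) < e"
      using h t by (auto simp: continuous_on tendsto_iff)
    then obtain d where "0 < d" and d: "\<And>s. s \<in> {0..} \<Longrightarrow> s \<noteq> t \<Longrightarrow> dist s t < d \<Longrightarrow> dist (h s) (h t) < e"
      unfolding eventually_at by blast
    have d': "norm (h s - h t) \<le> e" if "0 \<le> s" "dist s t < d" for s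
      using d[of s] that \<open>0 < e\<close> by (cases "s = t") (auto simp: dist_norm)
    have "norm (convolution (\<lambda>_. 1) h s - convolution (\<lambda>_. 1) h t - (s - t) *\<^sub>R h t) \<le> e * norm (s - t)"
      if s: "0 \<le> s" "dist s t < d" for s
    proof (cases "t \<le> s")
      case True
      have "norm (convolution (\<lambda>_. 1) h s - convolution (\<lambda>_. 1) h t - (s - t) *\<^sub>R h t) \<le> (s - t) * e"
        using s t True by (intro est d') (auto simp: dist_real_def)
      then show ?thesis using True by (simp add: mult.commute)
    next
      case False
      have "norm (convolution (\<lambda>_. 1) h t - convolution (\<lambda>_. 1) h s - (t - s) *\<^sub>R h t) \<le> (t - s) * e"
        using s t False by (intro est d') (auto simp: dist_real_def)
      moreover have "norm (convolution (\<lambda>_. 1) h s - convolution (\<lambda>_. 1) h t - (s - t) *\<^sub>R h t)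
          = norm (convolution (\<lambda>_. 1) h t - convolution (\<lambda>_. 1) h s - (t - s) *\<^sub>R h t)"
        by (subst norm_minus_cancel[symmetric]) (simp add: algebra_simps)
      ultimately show ?thesis using False by (simp add: mult.commute)
    qed
    then show "\<forall>\<^sub>F s in at t within {0..}.
        norm (convolution (\<lambda>_. 1) h s - convolution (\<lambda>_. 1) h t - (s - t) *\<^sub>R h t) \<le> e * norm (s - t)"
      unfolding eventually_at using \<open>0 < d\<close> by auto
  qed
qed

lemma convolution_0 [simp]: "convolution p h 0 = 0"
proof -
  have "AE s in lborel. s \<noteq> (0::real)" by (rule AE_lborel_singleton)
  then have "AE s in lborel. indicator {0..0} s *\<^sub>R (p (0 - s) *\<^sub>R h s) = 0"
    by eventually_elim auto
  then show ?thesis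
    unfolding convolution_def set_lebesgue_integral_def by (rule integral_eq_zero_AE)
qed

lemma at_within_atLeast_0_neq_bot:
  assumes "(0::real) \<le> t" shows "at t within {0..} \<noteq> bot"
proof -
  have "at_right t \<le> at t within {0..}" using assms by (intro at_le) auto
  then show ?thesis using trivial_limit_at_right_real[of t] by (auto simp: bot_unique)
qed

lemma antiderivative_unique:
  fixes f g :: "real \<Rightarrow> 'a::real_normed_vector"
  assumes "\<And>s. 0 \<le> s \<Longrightarrow> (f has_vector_derivative h s) (at s within {0..})"
    and "\<And>s. 0 \<le> s \<Longrightarrow> (g has_vector_derivative h s) (at s within {0..})"
    and "f 0 = g 0" and "0 \<le> t"
  shows "f t = g t"
proof -
  have "((\<lambda>s. f s - g s) has_vector_derivative 0) (at s within {0..})" if "s \<in> {0..}" for s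
    using has_vector_derivative_diff[OF assms(1,2)[of s]] that by simp
  then obtain c where "\<And>s. s \<in> {0..} \<Longrightarrow> f s - g s = c"
    using has_vector_derivative_zero_constant[of "{0::real..}" "\<lambda>s. f s - g s"] by auto
  from this[of 0] this[of t] show ?thesis using assms(3,4) by simp
qed

lemma continuous_on_atLeast_0I:
  fixes f :: "real \<Rightarrow> 'a::topological_space"
  assumes "\<And>T. continuous_on {0..T} f"
  shows "continuous_on {0..} f"
  unfolding continuous_on_eq_continuous_within
proof
  fix t :: real assume t: "t \<in> {0..}"
  have "continuous (at t within {0..t + 1}) f"
    using assms[of "t + 1"] t by (auto simp: continuous_on_eq_continuous_within)
  moreover have "at t within {0..t + 1} = at t within {0..}"
    by (rule at_within_nhd[where S = "{..<t + 1}"]) auto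
  ultimately show "continuous (at t within {0..}) f" by simp
qed

lemma convolution_commute:
  "convolution p q t = convolution q (p :: real \<Rightarrow> real) t"
  unfolding convolution_alt[of p] convolution_def[of q] by (simp add: mult.commute)

lemma borel_measurable_convolution:
  fixes q :: "real \<Rightarrow> real"
  assumes [measurable]: "p \<in> borel_measurable borel" "q \<in> borel_measurable borel"
  shows "convolution p q \<in> borel_measurable borel"
proof -
  have *: "indicator {0..t} s = (if 0 \<le> s \<and> s \<le> t then 1 else 0 :: real)" for s t :: real
    by (simp add: indicator_def)
  have "(\<lambda>t. LINT s|lborel. (if 0 \<le> s \<and> s \<le> t then 1 else 0) *\<^sub>R (p (t - s) *\<^sub>R q s)) \<in> borel_measurable borel"
    by measurable
  then show ?thesis
    unfolding convolution_def[abs_def] set_lebesgue_integral_def * .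
qed

lemma loc_integrable_continuous:
  assumes "p \<in> borel_measurable borel" "continuous_on {0..} p"
  shows "loc_integrable p"
  unfolding loc_integrable_def
  using assms by (auto intro!: borel_integrable_atLeastAtMost' continuous_on_subset[OF assms(2)])

lemma loc_integrable_one: "loc_integrable (\<lambda>_. 1)"
  by (intro loc_integrable_continuous) auto

section \<open>The kernels g_\<beta>, and the passage between the fractional differential equation
  and its integrated form\<close>

lemma g_kernel_nonneg: "0 < \<beta> \<Longrightarrow> 0 \<le> g_kernel \<beta> t"
  by (auto simp: g_kernel_def intro!: divide_nonneg_pos Gamma_real_pos)

lemma borel_measurable_g_kernel [measurable]: "g_kernel \<beta> \<in> borel_measurable borel"
  unfolding g_kernel_def[abs_def] by measurable

lemma loc_integrable_g_kernel:
  assumes "0 < \<beta>" shows "loc_integrable (g_kernel \<beta>)"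
  unfolding loc_integrable_def
proof (intro conjI allI borel_measurable_g_kernel)
  fix t :: real
  show "set_integrable lborel {0..t} (g_kernel \<beta>)"
  proof (cases "0 \<le> t")
    case True
    have "set_integrable lborel {0..t} (\<lambda>s. s powr (\<beta> - 1))"
      using assms True by (intro lborel_set_integral_of_has_integral(1)[OF _ _ has_integral_powr_from_0]) auto
    then have "set_integrable lborel {0..t} (\<lambda>s. s powr (\<beta> - 1) / Gamma \<beta>)"
      by (rule set_integrable_divide)
    moreover have "set_integrable lborel {0..t} (\<lambda>s. s powr (\<beta> - 1) / Gamma \<beta>) = set_integrable lborel {0..t} (g_kernel \<beta>)"
      by (rule set_integrable_cong) (auto simp: g_kernel_def)
    ultimately show ?thesis by blast
  qed (simp add: set_integrable_def)
qed

text \<open>After the substitution \<tau> = t s the powers of t combine to 1/t and cancel the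
  Jacobian. What remains is the Beta integral B(\<alpha>, 1 - \<alpha>) = Gamma(\<alpha>) Gamma(1 -
  \<alpha>), the product of the two normalising factors.\<close>

lemma convolution_g_kernel:
  assumes a: "0 < \<alpha>" "\<alpha> < 1" and t: "0 < t"
  shows "convolution (g_kernel (1 - \<alpha>)) (g_kernel \<alpha>) t = 1"
proof -
  let ?G = "Gamma \<alpha> * Gamma (1 - \<alpha>)"
  have G: "Gamma \<alpha> > 0" "Gamma (1 - \<alpha>) > 0" using a by (auto intro: Gamma_real_pos)
  have "((\<lambda>s. s powr (\<alpha> - 1) * (1 - s) powr ((1 - \<alpha>) - 1)) has_integral Beta \<alpha> (1 - \<alpha>)) {0..1}"
    using a by (intro has_integral_Beta_real) auto
  moreover have "Beta \<alpha> (1 - \<alpha>) = ?G" by (simp add: Beta_def)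
  ultimately have B: "(LINT s:{0..1}|lborel. s powr (\<alpha> - 1) * (1 - s) powr ((1 - \<alpha>) - 1)) = ?G"
    by (intro lborel_set_integral_of_has_integral(2)) auto
  have "convolution (g_kernel (1 - \<alpha>)) (g_kernel \<alpha>) t
      = t * (LINT s|lborel. indicator {0..t} (0 + t * s) *\<^sub>R (g_kernel (1 - \<alpha>) (t - (0 + t * s)) * g_kernel \<alpha> (0 + t * s)))"
    unfolding convolution_def set_lebesgue_integral_def
    using t by (subst lborel_integral_real_affine[where c = t and t = 0]) auto
  also have "(LINT s|lborel. indicator {0..t} (0 + t * s) *\<^sub>R (g_kernel (1 - \<alpha>) (t - (0 + t * s)) * g_kernel \<alpha> (0 + t * s)))
     = (LINT s|lborel. (inverse t / ?G) * (indicator {0..1} s *\<^sub>R (s powr (\<alpha> - 1) * (1 - s) powr ((1 - \<alpha>) - 1))))"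
  proof (intro Bochner_Integration.integral_cong refl)
    fix s
    show "indicator {0..t} (0 + t * s) *\<^sub>R (g_kernel (1 - \<alpha>) (t - (0 + t * s)) * g_kernel \<alpha> (0 + t * s))
      = (inverse t / ?G) * (indicator {0..1} s *\<^sub>R (s powr (\<alpha> - 1) * (1 - s) powr ((1 - \<alpha>) - 1)))"
    proof (cases "0 < s \<and> s < 1")
      case True
      have pos: "0 < t * s" "0 < t * (1 - s)" using True t by auto
      have *: "(t * s) powr a * (t * (1 - s)) powr b = t powr (a + b) * (s powr a * (1 - s) powr b)" for a b
        using True t by (simp add: powr_mult powr_add)
      have "(t * s) powr (\<alpha> - 1) * (t * (1 - s)) powr (- \<alpha>) = t powr ((\<alpha> - 1) + - \<alpha>) * (s powr (\<alpha> - 1) * (1 - s) powr (- \<alpha>))"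
        by (rule *)
      also have "t powr ((\<alpha> - 1) + - \<alpha>) = inverse t" using t by (simp add: powr_minus)
      finally have "(t * s) powr (\<alpha> - 1) * (t * (1 - s)) powr (- \<alpha>) = inverse t * (s powr (\<alpha> - 1) * (1 - s) powr (- \<alpha>))" .
      moreover have "g_kernel (1 - \<alpha>) (t - (0 + t * s)) = (t * (1 - s)) powr (- \<alpha>) / Gamma (1 - \<alpha>)"
        using pos by (simp add: g_kernel_def right_diff_distrib)
      moreover have "g_kernel \<alpha> (0 + t * s) = (t * s) powr (\<alpha> - 1) / Gamma \<alpha>"
        using pos by (simp add: g_kernel_def)
      moreover have "indicator {0..t} (0 + t * s) = (1 :: real)" "indicator {0..1} s = (1 :: real)"
        using pos True t by (auto simp: indicator_def right_diff_distrib)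
      moreover have "(1 - \<alpha>) - 1 = - \<alpha>" by simp
      moreover have "b / Gamma (1 - \<alpha>) * (a / Gamma \<alpha>) = a * b / ?G" for a b by (simp add: mult.commute)
      moreover have "inverse t * c / ?G = inverse t / ?G * c" for c by simp
      ultimately show ?thesis by (simp only: scaleR_one)
    next
      \<comment> \<open>At s = 0 and s = 1 both sides vanish, since \<open>g_kernel\<close> is 0 at
        0 and so is any power of 0 in the sense of \<open>powr\<close>.\<close>
      case False
      then show ?thesis using t
        by (cases "s = 0 \<or> s = 1") (auto simp: g_kernel_def indicator_def zero_le_mult_iff mult_le_cancel_left1)
    qed
  qed
  also have "\<dots> = inverse t / ?G * ?G"
    using B unfolding set_lebesgue_integral_def by (simp del: times_divide_eq_left)
  finally show ?thesis using t G by simp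
qed

lemma convolution_g_kernel_iterate:
  fixes h :: "real \<Rightarrow> 'a::{banach, second_countable_topology}"
  assumes a: "0 < \<alpha>" "\<alpha> < 1" and h: "continuous_on {0..} h"
  shows "convolution (g_kernel (1 - \<alpha>)) (convolution (g_kernel \<alpha>) h) t = convolution (\<lambda>_. 1) h t"
  using a by (intro convolution_assoc loc_integrable_g_kernel h convolution_g_kernel) auto

text \<open>Because g_(1-\<alpha>) * g_\<alpha> = 1, convolving w = g_\<alpha> * h with
  g_(1-\<alpha>) gives the plain primitive of h.\<close>

lemma RL_of_integral_equation:
  fixes h :: "real \<Rightarrow> 'a::{banach, second_countable_topology}"
  assumes a: "0 < \<alpha>" "\<alpha> < 1" and h: "continuous_on {0..} h" and t: "0 \<le> t"
    and w: "\<And>s. 0 \<le> s \<Longrightarrow> w s = convolution (g_kernel \<alpha>) h s"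
  shows "(convolution (g_kernel (1 - \<alpha>)) w has_vector_derivative h t) (at t within {0..})"
proof -
  have "convolution (g_kernel (1 - \<alpha>)) w s = convolution (\<lambda>_. 1) h s" for s
    using convolution_g_kernel_iterate[OF a h, of s] w
    by (subst convolution_cong[where h' = "convolution (g_kernel \<alpha>) h"]) auto
  then have "convolution (g_kernel (1 - \<alpha>)) w = convolution (\<lambda>_. 1) h" by (rule ext)
  then show ?thesis using convolution_one_has_vector_derivative[OF h t] by simp
qed

text \<open>Both g_(1-\<alpha>) * w and 1 * h vanish at 0 and have derivative h, hence agree.
  Convolving with g_\<alpha> turns this into 1 * w = 1 * (g_\<alpha> * h), and differentiation
  removes the primitives. Continuity of \<open>w\<close> enters in the last step.\<close>

lemma integral_equation_of_RL:
  fixes h :: "real \<Rightarrow> 'a::{banach, second_countable_topology}"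
  assumes a: "0 < \<alpha>" "\<alpha> < 1" and h: "continuous_on {0..} h" and w: "continuous_on {0..} w"
    and d: "\<And>s. 0 \<le> s \<Longrightarrow> (convolution (g_kernel (1 - \<alpha>)) w has_vector_derivative h s) (at s within {0..})"
    and t: "0 \<le> t"
  shows "w t = convolution (g_kernel \<alpha>) h t"
proof -
  note k = loc_integrable_g_kernel[of \<alpha>] loc_integrable_g_kernel[of "1 - \<alpha>"] loc_integrable_one
  have ah: "continuous_on {0..} (convolution (g_kernel \<alpha>) h)"
    using a by (intro convolution_continuous k h)
  have 1: "convolution (g_kernel (1 - \<alpha>)) w s = convolution (\<lambda>_. 1) h s" if "0 \<le> s" for s
    by (rule antiderivative_unique[OF d convolution_one_has_vector_derivative[OF h]]) (use that in auto)
  have 2: "convolution (\<lambda>_. 1) w s = convolution (\<lambda>_. 1) (convolution (g_kernel \<alpha>) h) s" for s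
  proof -
    have "convolution (\<lambda>_. 1) w s = convolution (g_kernel \<alpha>) (convolution (g_kernel (1 - \<alpha>)) w) s"
      using convolution_g_kernel_iterate[of "1 - \<alpha>", OF _ _ w, of s] a by simp
    also have "\<dots> = convolution (g_kernel \<alpha>) (convolution (\<lambda>_. 1) h) s"
      by (intro convolution_cong 1)
    also have "\<dots> = convolution (convolution (\<lambda>_. 1) (g_kernel \<alpha>)) h s"
      using a by (intro convolution_assoc k h convolution_commute borel_measurable_convolution) auto
    also have "\<dots> = convolution (\<lambda>_. 1) (convolution (g_kernel \<alpha>) h) s"
      using a by (intro convolution_assoc[symmetric] k h refl borel_measurable_convolution) auto
    finally show ?thesis .
  qed
  have "(convolution (\<lambda>_. 1) w has_vector_derivative convolution (g_kernel \<alpha>) h t) (at t within {0..})"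
    using convolution_one_has_vector_derivative[OF ah t] 2
    by (metis (no_types, lifting) ext)
  moreover have "(convolution (\<lambda>_. 1) w has_vector_derivative w t) (at t within {0..})"
    by (rule convolution_one_has_vector_derivative[OF w t])
  moreover have "at t within {0..} \<noteq> bot"
    using t by (rule at_within_atLeast_0_neq_bot)
  ultimately show ?thesis by (metis vector_derivative_within)
qed

section \<open>Weakly singular Volterra equations\<close>

text \<open>In the norm weighted by exp(-\<mu> t), the operator L g_\<alpha> * has norm at most this
  quantity on [0,T]. A large \<mu> makes it a contraction on the whole interval at once; dominated
  convergence asks no more of the singular kernel than integrability.\<close>

lemma g_kernel_weight_small:
  fixes L :: real
  assumes a: "0 < \<alpha>" and L: "0 \<le> L"
  obtains \<mu> :: real where "0 < \<mu>" "L * (LINT s:{0..T}|lborel. g_kernel \<alpha> s * exp (- \<mu> * s)) \<le> 1/2"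
proof -
  have "(\<lambda>n. LINT s|lborel. indicator {0..T} s *\<^sub>R (g_kernel \<alpha> s * exp (- real n * s))) \<longlonglongrightarrow> (LINT s|(lborel :: real measure). (0::real))"
  proof (rule integral_dominated_convergence[where w = "\<lambda>s. indicator {0..T} s *\<^sub>R g_kernel \<alpha> s"])
    show "integrable lborel (\<lambda>s. indicator {0..T} s *\<^sub>R g_kernel \<alpha> s)"
      using loc_integrableD(2)[OF loc_integrable_g_kernel[OF a], of T] by (simp add: set_integrable_def)
    show "AE s in lborel. norm (indicator {0..T} s *\<^sub>R (g_kernel \<alpha> s * exp (- real n * s)))
        \<le> indicator {0..T} s *\<^sub>R g_kernel \<alpha> s" for n
      using g_kernel_nonneg[OF a]
      by (intro AE_I2) (auto simp: indicator_def abs_mult intro!: mult_left_le)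
    have "AE s in lborel. s \<noteq> (0::real)" by (rule AE_lborel_singleton)
    then show "AE s in lborel. (\<lambda>n. indicator {0..T} s *\<^sub>R (g_kernel \<alpha> s * exp (- real n * s))) \<longlonglongrightarrow> 0"
    proof eventually_elim
      case (elim s)
      show ?case
      proof (cases "0 < s")
        case True
        have "(\<lambda>n. exp (- s) ^ n) \<longlonglongrightarrow> 0" using True by (intro LIMSEQ_power_zero) auto
        then have "(\<lambda>n. exp (- real n * s)) \<longlonglongrightarrow> 0"
          by (simp add: exp_of_nat_mult[symmetric])
        then have "(\<lambda>n. indicator {0..T} s *\<^sub>R (g_kernel \<alpha> s * exp (- real n * s))) \<longlonglongrightarrow> indicator {0..T} s *\<^sub>R (g_kernel \<alpha> s * 0)"
          by (intro tendsto_intros)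
        then show ?thesis by simp
      qed (use elim in \<open>simp add: indicator_def\<close>)
    qed
  qed auto
  then have "(\<lambda>n. L * (LINT s:{0..T}|lborel. g_kernel \<alpha> s * exp (- real n * s))) \<longlonglongrightarrow> L * 0"
    unfolding set_lebesgue_integral_def by (intro tendsto_intros) simp
  then have "\<forall>\<^sub>F n in sequentially. L * (LINT s:{0..T}|lborel. g_kernel \<alpha> s * exp (- real n * s)) < 1/2"
    by (intro order_tendstoD) auto
  then obtain n where "\<And>m. m \<ge> n \<Longrightarrow> L * (LINT s:{0..T}|lborel. g_kernel \<alpha> s * exp (- real m * s)) < 1/2"
    by (auto simp: eventually_sequentially)
  \<comment> \<open>Taking \<open>Suc n\<close> makes the weight positive even when n = 0.\<close>
  from this[of "Suc n"] show thesis by (intro that[of "real (Suc n)"]) auto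
qed

text \<open>Factoring exp(\<mu> t) out of the convolution leaves the mass of the damped kernel on
  [0,t], which is at most its mass on [0,T].\<close>

lemma convolution_g_kernel_exp_le:
  fixes L :: real
  assumes a: "0 < \<alpha>" and L: "0 \<le> L" and t: "t \<le> T"
    and \<mu>: "L * (LINT s:{0..T}|lborel. g_kernel \<alpha> s * exp (- \<mu> * s)) \<le> 1/2"
  shows "L * convolution (g_kernel \<alpha>) (\<lambda>s. exp (\<mu> * s)) t \<le> exp (\<mu> * t) / 2"
proof -
  have int: "set_integrable lborel {0..t} (\<lambda>s. g_kernel \<alpha> s * exp (- \<mu> * s))" for t
  proof -
    have "continuous_on {0..t} (\<lambda>s. exp (- \<mu> * s))" by (intro continuous_intros)
    from set_integrable_continuous_mult[OF loc_integrableD[OF loc_integrable_g_kernel[OF a]] this]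
    show ?thesis by simp
  qed
  have "(LINT s:{0..t}|lborel. g_kernel \<alpha> s * exp (- \<mu> * s)) \<le> (LINT s:{0..T}|lborel. g_kernel \<alpha> s * exp (- \<mu> * s))"
    unfolding set_lebesgue_integral_def
    using int[of t] int[of T] t g_kernel_nonneg[OF a]
    by (intro integral_mono) (auto simp: set_integrable_def indicator_def)
  then have "L * (LINT s:{0..t}|lborel. g_kernel \<alpha> s * exp (- \<mu> * s)) \<le> 1/2"
    using mult_left_mono[OF _ L] \<mu> by fastforce
  moreover have "convolution (g_kernel \<alpha>) (\<lambda>s. exp (\<mu> * s)) t
      = exp (\<mu> * t) * (LINT s:{0..t}|lborel. g_kernel \<alpha> s * exp (- \<mu> * s))"
    unfolding convolution_alt set_integral_mult_right[symmetric]
    by (intro set_lebesgue_integral_cong) (auto simp: exp_diff exp_minus right_diff_distrib field_simps)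
  ultimately show ?thesis
    using mult_left_mono[of "L * (LINT s:{0..t}|lborel. g_kernel \<alpha> s * exp (- \<mu> * s))" "1/2" "exp (\<mu> * t)"]
    by (simp add: mult_ac)
qed

text \<open>Let m be the maximum of exp(-\<mu> t) \<phi>(t) on [0,T]. If m were positive, the
  hypothesis at the point where it is attained would give m \<le> m/2.\<close>

lemma weakly_singular_gronwall:
  fixes L :: real
  assumes a: "0 < \<alpha>" and L: "0 \<le> L" and c: "continuous_on {0..} \<phi>"
    and le: "\<And>t. 0 \<le> t \<Longrightarrow> t \<le> T \<Longrightarrow> \<phi> t \<le> L * convolution (g_kernel \<alpha>) \<phi> t"
    and t: "0 \<le> t" "t \<le> T"
  shows "\<phi> t \<le> 0"
proof -
  obtain \<mu> where \<mu>: "0 < \<mu>" "L * (LINT s:{0..T}|lborel. g_kernel \<alpha> s * exp (- \<mu> * s)) \<le> 1/2"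
    using g_kernel_weight_small[OF a L] by blast
  have "continuous_on {0..T} (\<lambda>t. exp (- \<mu> * t) * \<phi> t)"
    by (intro continuous_intros continuous_on_subset[OF c]) auto
  then obtain t0 where t0: "t0 \<in> {0..T}" and max: "\<And>s. s \<in> {0..T} \<Longrightarrow> exp (- \<mu> * s) * \<phi> s \<le> exp (- \<mu> * t0) * \<phi> t0"
    using t continuous_attains_sup[of "{0..T}" "\<lambda>t. exp (- \<mu> * t) * \<phi> t"] by fastforce
  define m where "m = exp (- \<mu> * t0) * \<phi> t0"
  have m: "\<phi> s \<le> m * exp (\<mu> * s)" if "s \<in> {0..T}" for s
    using max[OF that] by (simp add: m_def exp_minus field_simps)
  have "m \<le> 0"
  proof (rule ccontr)
    assume "\<not> m \<le> 0"
    then have m0: "0 < m" by simp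
    have "m * exp (\<mu> * t0) = \<phi> t0" by (simp add: m_def exp_minus)
    also have "\<dots> \<le> L * convolution (g_kernel \<alpha>) \<phi> t0" using t0 by (intro le) auto
    also have "\<dots> \<le> L * convolution (g_kernel \<alpha>) (\<lambda>s. m *\<^sub>R exp (\<mu> * s)) t0"
      using t0 m by (intro mult_left_mono L convolution_mono loc_integrable_g_kernel a c g_kernel_nonneg continuous_intros) auto
    also have "\<dots> = m * (L * convolution (g_kernel \<alpha>) (\<lambda>s. exp (\<mu> * s)) t0)"
      unfolding convolution_scaleR by simp
    also have "\<dots> \<le> m * (exp (\<mu> * t0) / 2)"
      using t0 \<mu> m0 by (intro mult_left_mono convolution_g_kernel_exp_le a L) auto
    finally show False using m0 by simp
  qed
  then have "m * exp (\<mu> * t) \<le> 0" by (intro mult_nonpos_nonneg) auto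
  then show ?thesis using m[of t] t by auto
qed

text \<open>The iterates do not depend on T; only the weight used to measure them on [0,T] does.
  Locally uniform convergence on every [0,T] therefore yields one fixed point on the half-line, with
  nothing to be glued. The closed set \<open>K\<close> serves for iterating inside the graph of an
  unbounded operator.\<close>

lemma causal_picard:
  fixes \<Phi> :: "(real \<Rightarrow> 'b::banach) \<Rightarrow> real \<Rightarrow> 'b"
  assumes a: "0 < \<alpha>" and K: "closed K" "y0 \<in> K"
    and cont: "\<And>u. continuous_on {0..} u \<Longrightarrow> (\<And>t. 0 \<le> t \<Longrightarrow> u t \<in> K) \<Longrightarrow> continuous_on {0..} (\<Phi> u)"
    and maps: "\<And>u t. continuous_on {0..} u \<Longrightarrow> (\<And>t. 0 \<le> t \<Longrightarrow> u t \<in> K) \<Longrightarrow> 0 \<le> t \<Longrightarrow> \<Phi> u t \<in> K"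
    and L: "\<And>T. 0 \<le> L T"
    and lip: "\<And>T u v t. continuous_on {0..} u \<Longrightarrow> (\<And>t. 0 \<le> t \<Longrightarrow> u t \<in> K) \<Longrightarrow>
        continuous_on {0..} v \<Longrightarrow> (\<And>t. 0 \<le> t \<Longrightarrow> v t \<in> K) \<Longrightarrow> 0 \<le> t \<Longrightarrow> t \<le> T \<Longrightarrow>
        norm (\<Phi> u t - \<Phi> v t) \<le> L T * convolution (g_kernel \<alpha>) (\<lambda>s. norm (u s - v s)) t"
  obtains u where "continuous_on {0..} u" "\<And>t. 0 \<le> t \<Longrightarrow> u t \<in> K" "\<And>t. 0 \<le> t \<Longrightarrow> \<Phi> u t = u t"
proof -
  define U where "U n = (\<Phi> ^^ n) (\<lambda>_. y0)" for n
  have U_Suc: "U (Suc n) = \<Phi> (U n)" for n by (simp add: U_def)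
  have U: "continuous_on {0..} (U n) \<and> (\<forall>t\<ge>0. U n t \<in> K)" for n
    by (induction n) (auto simp: U_def K intro!: cont maps)
  have Uc: "continuous_on {0..} (U n)" and UK: "0 \<le> t \<Longrightarrow> U n t \<in> K" for n t
    using U by auto
  note kk = loc_integrable_g_kernel[OF a] g_kernel_nonneg[OF a]
  have contract: "norm (\<Phi> u t - \<Phi> v t) \<le> c / 2 * exp (\<mu> * t)"
    if u: "continuous_on {0..} u" "\<And>t. 0 \<le> t \<Longrightarrow> u t \<in> K" and v: "continuous_on {0..} v" "\<And>t. 0 \<le> t \<Longrightarrow> v t \<in> K"
      and \<mu>: "L T * (LINT s:{0..T}|lborel. g_kernel \<alpha> s * exp (- \<mu> * s)) \<le> 1/2" and c: "0 \<le> c"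
      and le: "\<And>s. 0 \<le> s \<Longrightarrow> s \<le> T \<Longrightarrow> norm (u s - v s) \<le> c * exp (\<mu> * s)" and t: "0 \<le> t" "t \<le> T"
    for u v T \<mu> c t
  proof -
    have "norm (\<Phi> u t - \<Phi> v t) \<le> L T * convolution (g_kernel \<alpha>) (\<lambda>s. norm (u s - v s)) t"
      by (intro lip u v t)
    also have "\<dots> \<le> L T * convolution (g_kernel \<alpha>) (\<lambda>s. c *\<^sub>R exp (\<mu> * s)) t"
      using t by (intro mult_left_mono convolution_mono kk L continuous_intros u v) (auto intro!: le)
    also have "\<dots> = c * (L T * convolution (g_kernel \<alpha>) (\<lambda>s. exp (\<mu> * s)) t)"
      unfolding convolution_scaleR by simp
    also have "\<dots> \<le> c * (exp (\<mu> * t) / 2)"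
      using t \<mu> c by (intro mult_left_mono convolution_g_kernel_exp_le a L) auto
    finally show ?thesis by simp
  qed
  have step: "\<exists>C\<ge>0. \<forall>n t. 0 \<le> t \<and> t \<le> T \<longrightarrow> norm (U (Suc n) t - U n t) \<le> C * (1/2) ^ n" for T
  proof -
    obtain \<mu> where \<mu>: "0 < \<mu>" "L T * (LINT s:{0..T}|lborel. g_kernel \<alpha> s * exp (- \<mu> * s)) \<le> 1/2"
      using g_kernel_weight_small[OF a L] by blast
    have "continuous_on {0..T} (\<lambda>t. U 1 t - U 0 t)"
      by (intro continuous_intros continuous_on_subset[OF Uc]) auto
    then obtain C where C: "0 \<le> C" "\<And>t. 0 \<le> t \<Longrightarrow> t \<le> T \<Longrightarrow> norm (U 1 t - U 0 t) \<le> C"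
      using continuous_on_interval_bound by blast
    have *: "norm (U (Suc n) t - U n t) \<le> C * (1/2) ^ n * exp (\<mu> * t)" if "0 \<le> t" "t \<le> T" for n t
      using that
    proof (induction n arbitrary: t)
      case 0
      then have "C * 1 \<le> C * exp (\<mu> * t)" using C(1) \<mu>(1) by (intro mult_left_mono) auto
      then show ?case using C(2)[of t] 0 by simp
    next
      case (Suc n)
      have "norm (\<Phi> (U (Suc n)) t - \<Phi> (U n) t) \<le> (C * (1/2) ^ n) / 2 * exp (\<mu> * t)"
        by (rule contract[OF Uc UK Uc UK \<mu>(2)]) (use C Suc in auto)
      then show ?case by (simp add: U_Suc)
    qed
    show ?thesis
    proof (intro exI[of _ "C * exp (\<mu> * T)"] conjI allI impI)
      fix n t assume t: "0 \<le> t \<and> t \<le> T"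
      have "C * (1/2) ^ n * exp (\<mu> * t) \<le> C * (1/2) ^ n * exp (\<mu> * T)"
        using t C \<mu>(1) by (intro mult_left_mono) auto
      then show "norm (U (Suc n) t - U n t) \<le> C * exp (\<mu> * T) * (1/2) ^ n"
        using *[of t n] t by (simp add: mult_ac)
    qed (use C in auto)
  qed
  have unif: "uniformly_convergent_on {0..T} U" for T
  proof -
    obtain C where C: "0 \<le> C" "\<And>n t. 0 \<le> t \<and> t \<le> T \<Longrightarrow> norm (U (Suc n) t - U n t) \<le> C * (1/2) ^ n"
      using step[of T] by blast
    have "uniformly_convergent_on {0..T} (\<lambda>n t. \<Sum>k<n. U (Suc k) t - U k t)"
      by (rule Weierstrass_m_test'[where M = "\<lambda>n. C * (1/2) ^ n"])
         (auto intro!: C summable_mult summable_geometric)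
    then obtain l where "uniform_limit {0..T} (\<lambda>n t. \<Sum>k<n. U (Suc k) t - U k t) l sequentially"
      unfolding uniformly_convergent_on_def by blast
    from uniform_limit_add[OF uniform_limit_const this, of "U 0"]
    have "uniformly_convergent_on {0..T} (\<lambda>n t. U 0 t + (\<Sum>k<n. U (Suc k) t - U k t))"
      unfolding uniformly_convergent_on_def by blast
    moreover have "U 0 t + (\<Sum>k<n. U (Suc k) t - U k t) = U n t" for n t
      by (induction n) (auto simp: algebra_simps)
    ultimately show ?thesis by simp
  qed
  define u where "u t = lim (\<lambda>n. U n t)" for t
  have ul: "uniform_limit {0..T} U u sequentially" for T
    using unif[of T] unfolding u_def[abs_def] uniformly_convergent_uniform_limit_iff by simp
  have uc: "continuous_on {0..} u"
    by (rule continuous_on_atLeast_0I, rule uniform_limit_theorem[OF _ ul])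
       (auto intro!: always_eventually continuous_on_subset[OF Uc])
  have lim: "(\<lambda>n. U n t) \<longlonglongrightarrow> u t" if "0 \<le> t" for t
    using tendsto_uniform_limitI[OF ul[of t], of t] that by simp
  have uK: "u t \<in> K" if "0 \<le> t" for t
    by (rule closed_sequentially[OF K(1) _ lim[OF that]]) (use UK that in auto)
  have "\<Phi> u t = u t" if t: "0 \<le> t" for t
  proof -
    obtain \<mu> where \<mu>: "0 < \<mu>" "L t * (LINT s:{0..t}|lborel. g_kernel \<alpha> s * exp (- \<mu> * s)) \<le> 1/2"
      using g_kernel_weight_small[OF a L] by blast
    have "(\<lambda>n. U (Suc n) t) \<longlonglongrightarrow> \<Phi> u t"
    proof (rule LIMSEQ_I)
      fix r :: real assume r: "0 < r"
      \<comment> \<open>With this choice the contraction bound c/2 exp(\<mu> t) at the given time t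
        equals r/2.\<close>
      define c where "c = r / exp (\<mu> * t)"
      have c: "0 < c" using r by (simp add: c_def)
      have "\<forall>\<^sub>F n in sequentially. \<forall>s\<in>{0..t}. dist (U n s) (u s) < c"
        using uniform_limitD[OF ul c] .
      then obtain N where N: "\<And>n s. n \<ge> N \<Longrightarrow> s \<in> {0..t} \<Longrightarrow> dist (U n s) (u s) < c"
        unfolding eventually_sequentially by blast
      have "norm (U (Suc n) t - \<Phi> u t) < r" if n: "n \<ge> N" for n
      proof -
        have "norm (\<Phi> (U n) t - \<Phi> u t) \<le> c / 2 * exp (\<mu> * t)"
        proof (rule contract[OF Uc UK uc uK \<mu>(2)])
          fix s assume s: "0 \<le> s" "s \<le> t"
          have "c * 1 \<le> c * exp (\<mu> * s)" using c s \<mu>(1) by (intro mult_left_mono) auto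
          then show "norm (U n s - u s) \<le> c * exp (\<mu> * s)" using N[OF n, of s] s by (simp add: dist_norm)
        qed (use c t in auto)
        then show ?thesis using r by (simp add: U_Suc c_def)
      qed
      then show "\<exists>N. \<forall>n\<ge>N. norm (U (Suc n) t - \<Phi> u t) < r" by blast
    qed
    then show ?thesis using LIMSEQ_Suc[OF lim[OF t]] by (rule LIMSEQ_unique)
  qed
  then show thesis using uc uK by (intro that) auto
qed

section \<open>The maximum principle for dissipative equations\<close>

text \<open>
  For \<open>k\<^sub>\<epsilon>(s) = (s + \<epsilon>)\<^sup>-\<^sup>\<alpha>\<close> the derivative of \<open>k\<^sub>\<epsilon> * (g\<^sub>\<alpha> * h)\<close> is \<open>\<rho>\<^sub>\<epsilon> * h\<close> with
  \<open>\<rho>\<^sub>\<epsilon>(s) = \<rho>(s/\<epsilon>)/\<epsilon>\<close>, where \<open>\<rho>\<close> is the following density. Its integral is a constant that the maximum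
  principle does not need to know. The function \<open>shifted_kernel\<close> below is \<open>- k\<^sub>\<epsilon>'/\<alpha>\<close>.
\<close>

definition marchaud_density :: "real \<Rightarrow> real \<Rightarrow> real" where
  "marchaud_density \<alpha> s = s powr (\<alpha> - 1) / ((1 + s) * Gamma \<alpha>)"

definition marchaud_const :: "real \<Rightarrow> real" where
  "marchaud_const \<alpha> = (LINT s:{0..}|lborel. marchaud_density \<alpha> s)"

text \<open>The density is of order s^(\<alpha>-1) at 0 and at most of order s^(\<alpha>-2) at
  infinity, and both powers are integrable there for 0 < \<alpha> < 1. Positivity is read off on
  [0,1], where 1 + s \<le> 2. By the Beta integral the constant is Gamma(1 - \<alpha>).\<close>

lemma
  assumes a: "0 < \<alpha>" "\<alpha> < 1"
  shows marchaud_density_integrable: "set_integrable lborel {0..} (marchaud_density \<alpha>)"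
    and marchaud_const_pos: "0 < marchaud_const \<alpha>"
proof -
  have G: "Gamma \<alpha> > 0" using a by (auto intro: Gamma_real_pos)
  have m: "marchaud_density \<alpha> \<in> borel_measurable borel"
    unfolding marchaud_density_def[abs_def] by measurable
  have i0: "set_integrable lborel {0..1} (\<lambda>s. s powr (\<alpha> - 1))"
    and v0: "(LINT s:{0..1}|lborel. s powr (\<alpha> - 1)) = 1 / \<alpha>"
    using lborel_set_integral_of_has_integral[OF _ _ has_integral_powr_from_0[of "\<alpha> - 1" 1]] a by auto
  have 1: "set_integrable lborel {0..1} (marchaud_density \<alpha>)"
  proof (rule set_integrable_bound[where f = "\<lambda>s. s powr (\<alpha> - 1) / Gamma \<alpha>"])
    show "AE s in lborel. s \<in> {0..1} \<longrightarrow> norm (marchaud_density \<alpha> s) \<le> norm (s powr (\<alpha> - 1) / Gamma \<alpha>)"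
      using G by (intro AE_I2) (auto simp: marchaud_density_def abs_mult intro!: divide_left_mono mult_pos_pos)
  qed (use i0 m in \<open>auto simp: set_borel_measurable_def\<close>)
  have i1: "set_integrable lborel {1..} (\<lambda>s. s powr (\<alpha> - 2))"
    using a by (intro lborel_set_integral_of_has_integral(1)[OF _ _ has_integral_powr_to_inf]) auto
  have 2: "set_integrable lborel {1..} (marchaud_density \<alpha>)"
  proof (rule set_integrable_bound[where f = "\<lambda>s. s powr (\<alpha> - 2) / Gamma \<alpha>"])
    show "AE s in lborel. s \<in> {1..} \<longrightarrow> norm (marchaud_density \<alpha> s) \<le> norm (s powr (\<alpha> - 2) / Gamma \<alpha>)"
    proof (intro AE_I2 impI)
      fix s :: real assume s: "s \<in> {1..}"
      have "s powr (\<alpha> - 1) = s * s powr (\<alpha> - 2)"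
        using s powr_add[of s 1 "\<alpha> - 2"] by simp
      then have "s powr (\<alpha> - 1) / (1 + s) \<le> s powr (\<alpha> - 2)"
        using s by (simp add: field_simps)
      then have "s powr (\<alpha> - 1) / (1 + s) / Gamma \<alpha> \<le> s powr (\<alpha> - 2) / Gamma \<alpha>"
        using G by (intro divide_right_mono) auto
      then show "norm (marchaud_density \<alpha> s) \<le> norm (s powr (\<alpha> - 2) / Gamma \<alpha>)"
        using s G by (simp add: marchaud_density_def abs_mult)
    qed
  qed (use i1 m in \<open>auto simp: set_borel_measurable_def\<close>)
  have "{0..} = {0..1} \<union> {1::real..}" by auto
  then show int: "set_integrable lborel {0..} (marchaud_density \<alpha>)"
    using 1 2 by (simp add: set_integrable_Un)
  have "0 < 1 / \<alpha> / (2 * Gamma \<alpha>)" using a G by simp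
  also have "\<dots> = (LINT s:{0..1}|lborel. s powr (\<alpha> - 1) / (2 * Gamma \<alpha>))"
    using v0 by simp
  also have "\<dots> \<le> marchaud_const \<alpha>"
    unfolding marchaud_const_def set_lebesgue_integral_def
  proof (rule integral_mono)
    show "integrable lborel (\<lambda>s. indicator {0..1} s *\<^sub>R (s powr (\<alpha> - 1) / (2 * Gamma \<alpha>)))"
      using set_integrable_divide[OF i0, of "2 * Gamma \<alpha>"] by (simp add: set_integrable_def)
    show "integrable lborel (\<lambda>s. indicator {0..} s *\<^sub>R marchaud_density \<alpha> s)"
      using int by (simp add: set_integrable_def)
    show "indicator {0..1} s *\<^sub>R (s powr (\<alpha> - 1) / (2 * Gamma \<alpha>)) \<le> indicator {0..} s *\<^sub>R marchaud_density \<alpha> s" for s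
      using G by (auto simp: indicator_def marchaud_density_def intro!: divide_left_mono mult_right_mono mult_pos_pos divide_nonneg_nonneg mult_nonneg_nonneg)
  qed
  finally show "0 < marchaud_const \<alpha>" .
qed

definition shifted_kernel :: "real \<Rightarrow> real \<Rightarrow> real \<Rightarrow> real" where
  "shifted_kernel \<alpha> \<epsilon> s = (s + \<epsilon>) powr (- \<alpha> - 1)"

lemma loc_integrable_shifted_kernel:
  assumes "0 < \<epsilon>" shows "loc_integrable (shifted_kernel \<alpha> \<epsilon>)"
  unfolding shifted_kernel_def[abs_def]
  using assms by (intro loc_integrable_continuous continuous_intros) auto

lemma shifted_kernel_integral:
  assumes a: "0 < \<alpha>" and e: "0 < \<epsilon>" and t: "0 \<le> t"
  shows "\<alpha> * (LINT s:{0..t}|lborel. shifted_kernel \<alpha> \<epsilon> s) = \<epsilon> powr (- \<alpha>) - (t + \<epsilon>) powr (- \<alpha>)"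
proof -
  have "((\<lambda>s. (s + \<epsilon>) powr (- \<alpha> - 1)) has_integral
      (- ((t + \<epsilon>) powr (- \<alpha>) / \<alpha>) - - ((0 + \<epsilon>) powr (- \<alpha>) / \<alpha>))) {0..t}"
    using a e t
    by (intro fundamental_theorem_of_calculus)
       (auto simp flip: has_real_derivative_iff_has_vector_derivative intro!: derivative_eq_intros)
  from lborel_set_integral_of_has_integral(2)[OF _ _ this]
  have "(LINT s:{0..t}|lborel. shifted_kernel \<alpha> \<epsilon> s) = - ((t + \<epsilon>) powr (- \<alpha>) / \<alpha>) - - ((0 + \<epsilon>) powr (- \<alpha>) / \<alpha>)"
    by (simp add: shifted_kernel_def)
  then show ?thesis using a by (simp add: field_simps)
qed

lemma convolution_shifted_g_kernel:
  assumes a: "0 < \<alpha>" "\<alpha> < 1" and e: "0 < \<epsilon>" and s: "0 < s"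
  shows "convolution (shifted_kernel \<alpha> \<epsilon>) (g_kernel \<alpha>) s
      = s powr \<alpha> * \<epsilon> powr (- \<alpha>) / (\<alpha> * (s + \<epsilon>) * Gamma \<alpha>)"
proof -
  define c where "c = s + \<epsilon>"
  have G: "Gamma \<alpha> > 0" using a by (auto intro: Gamma_real_pos)
  \<comment> \<open>This is (\<tau>/(c - \<tau>))^\<alpha> / (\<alpha> c), an antiderivative because
    the derivative of \<tau>/(c - \<tau>) is c/(c - \<tau>)^2. At \<tau> = 0 it is only continuous,
    so the fundamental theorem is applied in its form for the open interval.\<close>
  define F where "F \<tau> = \<tau> powr \<alpha> * (c - \<tau>) powr (- \<alpha>) / (\<alpha> * c)" for \<tau>
  have cont: "continuous_on {0..s} F"
    unfolding F_def using a e s by (intro continuous_intros continuous_on_powr') (auto simp: c_def)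
  have der: "(F has_real_derivative \<tau> powr (\<alpha> - 1) * (c - \<tau>) powr (- \<alpha> - 1)) (at \<tau>)" if "0 < \<tau>" "\<tau> < s" for \<tau>
  proof -
    have "(F has_real_derivative (\<alpha> * \<tau> powr (\<alpha> - 1) * (c - \<tau>) powr (- \<alpha>)
        + \<tau> powr \<alpha> * (\<alpha> * (c - \<tau>) powr (- \<alpha> - 1))) / (\<alpha> * c)) (at \<tau>)"
      unfolding F_def using that e a by (auto intro!: derivative_eq_intros simp: c_def)
    moreover have "(c - \<tau>) powr (- \<alpha>) = (c - \<tau>) * (c - \<tau>) powr (- \<alpha> - 1)"
      using powr_add[of "c - \<tau>" 1 "- \<alpha> - 1"] that e by (simp add: c_def)
    moreover have "\<tau> powr \<alpha> = \<tau> * \<tau> powr (\<alpha> - 1)"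
      using powr_add[of \<tau> 1 "\<alpha> - 1"] that by simp
    moreover have "(\<alpha> * x * ((c - \<tau>) * y) + \<tau> * x * (\<alpha> * y)) / (\<alpha> * c) = x * y" for x y
    proof -
      have "(\<alpha> * x * ((c - \<tau>) * y) + \<tau> * x * (\<alpha> * y)) = (\<alpha> * c) * (x * y)" by (simp add: algebra_simps)
      moreover have "\<alpha> * c \<noteq> 0" using a e s by (simp add: c_def)
      ultimately show ?thesis by simp
    qed
    ultimately show ?thesis by simp
  qed
  have "((\<lambda>\<tau>. \<tau> powr (\<alpha> - 1) * (c - \<tau>) powr (- \<alpha> - 1)) has_integral (F s - F 0)) {0..s}"
    using s der by (intro fundamental_theorem_of_calculus_interior cont)
      (auto simp flip: has_real_derivative_iff_has_vector_derivative)
  from lborel_set_integral_of_has_integral(2)[OF _ _ this]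
  have I: "(LINT \<tau>:{0..s}|lborel. \<tau> powr (\<alpha> - 1) * (c - \<tau>) powr (- \<alpha> - 1)) = F s"
    by (simp add: F_def)
  have "convolution (shifted_kernel \<alpha> \<epsilon>) (g_kernel \<alpha>) s
     = (LINT \<tau>:{0..s}|lborel. \<tau> powr (\<alpha> - 1) * (c - \<tau>) powr (- \<alpha> - 1) / Gamma \<alpha>)"
    unfolding convolution_def
    by (intro set_lebesgue_integral_cong) (auto simp: shifted_kernel_def g_kernel_def c_def algebra_simps)
  also have "\<dots> = F s / Gamma \<alpha>" using I by simp
  finally show ?thesis by (simp add: F_def c_def)
qed

lemma convolution_kernel_diff:
  fixes h :: "real \<Rightarrow> 'a::{banach, second_countable_topology}"
  assumes "loc_integrable p" "loc_integrable q" "continuous_on {0..} h"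
  shows "convolution (\<lambda>s. a * p s - b * q s) h t = a *\<^sub>R convolution p h t - b *\<^sub>R convolution q h t"
proof -
  have "convolution (\<lambda>s. a * p s - b * q s) h t
      = (LINT s:{0..t}|lborel. a *\<^sub>R (p (t - s) *\<^sub>R h s) - b *\<^sub>R (q (t - s) *\<^sub>R h s))"
    unfolding convolution_def by (simp add: scaleR_left_diff_distrib)
  also have "\<dots> = a *\<^sub>R convolution p h t - b *\<^sub>R convolution q h t"
    unfolding convolution_def set_integral_scaleR_right[symmetric]
    using assms by (intro set_integral_diff set_integrable_scaleR_right) (auto intro: convolution_integrable)
  finally show ?thesis .
qed

text \<open>The left-hand side is the derivative of k_\<epsilon> * (g_\<alpha> * h) at t, written
  out: k_\<epsilon>(0) contributes the boundary term and k_\<epsilon>' the convolution. By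
  associativity both terms are convolutions of h with explicit kernels; the right-hand side is their
  difference after the substitution s = \<epsilon> \<sigma>.\<close>

lemma shifted_derivative_eq:
  fixes h :: "real \<Rightarrow> 'a::{banach, second_countable_topology}"
  assumes a: "0 < \<alpha>" "\<alpha> < 1" and e: "0 < \<epsilon>" and h: "continuous_on {0..} h"
  shows "\<epsilon> powr (- \<alpha>) *\<^sub>R convolution (g_kernel \<alpha>) h t
      - \<alpha> *\<^sub>R convolution (shifted_kernel \<alpha> \<epsilon>) (convolution (g_kernel \<alpha>) h) t
    = (LINT \<sigma>|lborel. indicator {0..t} (\<epsilon> * \<sigma>) *\<^sub>R (marchaud_density \<alpha> \<sigma> *\<^sub>R h (t - \<epsilon> * \<sigma>)))"
proof -
  define r where "r s = s powr \<alpha> * \<epsilon> powr (- \<alpha>) / (\<alpha> * (s + \<epsilon>) * Gamma \<alpha>)" for s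
  have G: "Gamma \<alpha> > 0" using a by (auto intro: Gamma_real_pos)
  have rm: "r \<in> borel_measurable borel" unfolding r_def[abs_def] by measurable
  have "continuous_on {0..} (\<lambda>s. s powr \<alpha>)" using a by (intro continuous_on_powr' continuous_intros) auto
  then have "continuous_on {0..} (\<lambda>s. s powr \<alpha> / (s + \<epsilon>) * (\<epsilon> powr (- \<alpha>) / (\<alpha> * Gamma \<alpha>)))"
    using e by (intro continuous_on_mult continuous_on_divide continuous_on_const continuous_on_add continuous_on_id) auto
  then have "continuous_on {0..} r" by (simp add: r_def[abs_def] mult_ac)
  then have r: "loc_integrable r" using rm by (intro loc_integrable_continuous) auto
  \<comment> \<open>The powers of s combine through 1 - s/(s + \<epsilon>) = \<epsilon>/(s +
    \<epsilon>).\<close>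
  have *: "\<epsilon> powr (- \<alpha>) * g_kernel \<alpha> s - \<alpha> * r s = marchaud_density \<alpha> (s / \<epsilon>) / \<epsilon>" if "0 \<le> s" for s
  proof (cases "s = 0")
    case False
    then have s: "0 < s" using that by simp
    have "s powr \<alpha> = s * s powr (\<alpha> - 1)" using powr_add[of s 1 "\<alpha> - 1"] s by simp
    then have "\<epsilon> powr (- \<alpha>) * g_kernel \<alpha> s - \<alpha> * r s = \<epsilon> powr (- \<alpha>) * s powr (\<alpha> - 1) * \<epsilon> / ((s + \<epsilon>) * Gamma \<alpha>)"
      using s e a G by (simp add: g_kernel_def r_def divide_simps) (simp add: algebra_simps)
    also have "\<epsilon> powr (- \<alpha>) * s powr (\<alpha> - 1) * \<epsilon> = (s / \<epsilon>) powr (\<alpha> - 1)"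
    proof -
      have "\<epsilon> powr (\<alpha> - 1) * \<epsilon> powr (- \<alpha>) = inverse \<epsilon>"
        using e powr_add[of \<epsilon> "\<alpha> - 1" "- \<alpha>"] by (simp add: powr_minus powr_one)
      then have "\<epsilon> powr (\<alpha> - 1) * (\<epsilon> powr (- \<alpha>) * \<epsilon>) = 1" using e by (simp add: field_simps)
      then show ?thesis using s e by (simp add: powr_divide field_simps)
    qed
    also have "(s + \<epsilon>) = (1 + s / \<epsilon>) * \<epsilon>" using e by (simp add: field_simps)
    finally show ?thesis by (simp add: marchaud_density_def mult_ac)
  qed (simp add: g_kernel_def r_def marchaud_density_def)
  have "convolution (shifted_kernel \<alpha> \<epsilon>) (convolution (g_kernel \<alpha>) h) t = convolution r h t"
    using a e rm
    by (intro convolution_assoc loc_integrable_shifted_kernel loc_integrable_g_kernel h)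
       (auto simp: convolution_shifted_g_kernel r_def)
  then have "\<epsilon> powr (- \<alpha>) *\<^sub>R convolution (g_kernel \<alpha>) h t
      - \<alpha> *\<^sub>R convolution (shifted_kernel \<alpha> \<epsilon>) (convolution (g_kernel \<alpha>) h) t
    = convolution (\<lambda>s. \<epsilon> powr (- \<alpha>) * g_kernel \<alpha> s - \<alpha> * r s) h t"
    using a by (simp add: convolution_kernel_diff loc_integrable_g_kernel r h)
  also have "\<dots> = (LINT s|lborel. indicator {0..t} s *\<^sub>R ((marchaud_density \<alpha> (s / \<epsilon>) / \<epsilon>) *\<^sub>R h (t - s)))"
    unfolding convolution_alt set_lebesgue_integral_def
    by (intro Bochner_Integration.integral_cong refl) (auto simp: indicator_def *)
  also have "\<dots> = \<epsilon> *\<^sub>R (LINT s|lborel. indicator {0..t} (0 + \<epsilon> * s) *\<^sub>R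
      ((marchaud_density \<alpha> ((0 + \<epsilon> * s) / \<epsilon>) / \<epsilon>) *\<^sub>R h (t - (0 + \<epsilon> * s))))"
    using e by (subst lborel_integral_real_affine[where c = \<epsilon> and t = 0]) auto
  also have "\<dots> = (LINT \<sigma>|lborel. indicator {0..t} (\<epsilon> * \<sigma>) *\<^sub>R (marchaud_density \<alpha> \<sigma> *\<^sub>R h (t - \<epsilon> * \<sigma>)))"
    unfolding integral_scaleR_right[symmetric]
    using e by (intro Bochner_Integration.integral_cong) (auto simp: indicator_def)
  finally show ?thesis .
qed

text \<open>The rescaled densities form an approximate identity of total mass
  \<open>marchaud_const \<alpha>\<close>. Since t > 0, each fixed \<sigma> eventually satisfies
  \<epsilon> \<sigma> \<le> t, so the cutoff disappears in the limit.\<close>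

lemma shifted_derivative_tendsto:
  fixes h :: "real \<Rightarrow> 'a::{banach, second_countable_topology}"
  assumes a: "0 < \<alpha>" "\<alpha> < 1" and h: "continuous_on {0..} h" and t: "0 < t"
    and e: "\<And>n. 0 < e n" "e \<longlonglongrightarrow> 0"
  shows "(\<lambda>n. e n powr (- \<alpha>) *\<^sub>R convolution (g_kernel \<alpha>) h t
      - \<alpha> *\<^sub>R convolution (shifted_kernel \<alpha> (e n)) (convolution (g_kernel \<alpha>) h) t)
     \<longlonglongrightarrow> marchaud_const \<alpha> *\<^sub>R h t"
proof -
  have "continuous_on {0..t} h" using h by (rule continuous_on_subset) auto
  then obtain M where M0: "0 \<le> M" and M: "\<And>s. 0 \<le> s \<Longrightarrow> s \<le> t \<Longrightarrow> norm (h s) \<le> M"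
    using continuous_on_interval_bound by blast
  have dm[measurable]: "marchaud_density \<alpha> \<in> borel_measurable borel"
    unfolding marchaud_density_def[abs_def] by measurable
  have d0: "0 \<le> marchaud_density \<alpha> \<sigma>" if "0 \<le> \<sigma>" for \<sigma>
    using that a by (auto simp: marchaud_density_def intro!: divide_nonneg_nonneg mult_nonneg_nonneg Gamma_real_pos[THEN less_imp_le])
  have [measurable]: "(\<lambda>s. indicator {0..t} s *\<^sub>R h (t - s)) \<in> borel_measurable borel"
    by (intro borel_measurable_continuous_on_indicator continuous_on_compose2[OF h] continuous_intros) auto
  have "(\<lambda>n. LINT \<sigma>|lborel. indicator {0..t} (e n * \<sigma>) *\<^sub>R (marchaud_density \<alpha> \<sigma> *\<^sub>R h (t - e n * \<sigma>)))
    \<longlonglongrightarrow> (LINT \<sigma>|lborel. indicator {0..} \<sigma> *\<^sub>R (marchaud_density \<alpha> \<sigma> *\<^sub>R h t))"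
  proof (rule integral_dominated_convergence[where w = "\<lambda>\<sigma>. indicator {0..} \<sigma> *\<^sub>R (marchaud_density \<alpha> \<sigma> * M)"])
    show "integrable lborel (\<lambda>\<sigma>. indicator {0..} \<sigma> *\<^sub>R (marchaud_density \<alpha> \<sigma> * M))"
      using marchaud_density_integrable[OF a, THEN set_integrable_mult_left, of M] by (simp add: set_integrable_def)
    show "AE \<sigma> in lborel. norm (indicator {0..t} (e n * \<sigma>) *\<^sub>R (marchaud_density \<alpha> \<sigma> *\<^sub>R h (t - e n * \<sigma>)))
        \<le> indicator {0..} \<sigma> *\<^sub>R (marchaud_density \<alpha> \<sigma> * M)" for n
    proof (rule AE_I2)
      fix \<sigma>
      show "norm (indicator {0..t} (e n * \<sigma>) *\<^sub>R (marchaud_density \<alpha> \<sigma> *\<^sub>R h (t - e n * \<sigma>)))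
        \<le> indicator {0..} \<sigma> *\<^sub>R (marchaud_density \<alpha> \<sigma> * M)"
      proof (cases "0 \<le> \<sigma>")
        case True
        then have "0 \<le> e n * \<sigma>" using e(1)[of n] by simp
        then show ?thesis using True d0[OF True] M0 M[of "t - e n * \<sigma>"]
          by (auto simp: indicator_def intro!: mult_left_mono)
      next
        case False
        then have "e n * \<sigma> < 0" using e(1)[of n] by (simp add: mult_pos_neg)
        then show ?thesis using False by (simp add: indicator_def)
      qed
    qed
    have "(\<lambda>n. indicator {0..t} (e n * \<sigma>) *\<^sub>R (marchaud_density \<alpha> \<sigma> *\<^sub>R h (t - e n * \<sigma>)))
        \<longlonglongrightarrow> indicator {0..} \<sigma> *\<^sub>R (marchaud_density \<alpha> \<sigma> *\<^sub>R h t)" for \<sigma>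
    proof (cases "0 \<le> \<sigma>")
      case True
      have lim: "(\<lambda>n. e n * \<sigma>) \<longlonglongrightarrow> 0" using tendsto_mult_left[OF e(2), of \<sigma>] by (simp add: mult.commute)
      have ev: "\<forall>\<^sub>F n in sequentially. e n * \<sigma> < t" using lim t by (rule order_tendstoD)
      have nn: "0 \<le> e n * \<sigma>" for n using True e(1)[of n] by simp
      have "(\<lambda>n. h (t - e n * \<sigma>)) \<longlonglongrightarrow> h t"
      proof (rule continuous_on_tendsto_compose[OF h])
        show "(\<lambda>n. t - e n * \<sigma>) \<longlonglongrightarrow> t" using tendsto_diff[OF tendsto_const lim, of t] by simp
        show "\<forall>\<^sub>F n in sequentially. t - e n * \<sigma> \<in> {0..}" using ev by eventually_elim auto
      qed (use t in auto)
      then have "(\<lambda>n. marchaud_density \<alpha> \<sigma> *\<^sub>R h (t - e n * \<sigma>)) \<longlonglongrightarrow> marchaud_density \<alpha> \<sigma> *\<^sub>R h t"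
        by (intro tendsto_intros)
      moreover have "\<forall>\<^sub>F n in sequentially. marchaud_density \<alpha> \<sigma> *\<^sub>R h (t - e n * \<sigma>)
          = indicator {0..t} (e n * \<sigma>) *\<^sub>R (marchaud_density \<alpha> \<sigma> *\<^sub>R h (t - e n * \<sigma>))"
        using ev by eventually_elim (use nn in \<open>auto simp: indicator_def\<close>)
      ultimately show ?thesis using True by (auto intro: Lim_transform_eventually)
    next
      case False
      then have "\<not> 0 \<le> e n * \<sigma>" for n using e(1)[of n] by (simp add: mult_pos_neg not_le)
      then show ?thesis using False by (simp add: indicator_def)
    qed
    then show "AE \<sigma> in lborel. (\<lambda>n. indicator {0..t} (e n * \<sigma>) *\<^sub>R (marchaud_density \<alpha> \<sigma> *\<^sub>R h (t - e n * \<sigma>)))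
        \<longlonglongrightarrow> indicator {0..} \<sigma> *\<^sub>R (marchaud_density \<alpha> \<sigma> *\<^sub>R h t)"
      by (rule AE_I2)
    show "(\<lambda>\<sigma>. indicator {0..t} (e n * \<sigma>) *\<^sub>R (marchaud_density \<alpha> \<sigma> *\<^sub>R h (t - e n * \<sigma>))) \<in> borel_measurable lborel" for n
    proof -
      have "(\<lambda>\<sigma>. marchaud_density \<alpha> \<sigma> *\<^sub>R (indicator {0..t} (e n * \<sigma>) *\<^sub>R h (t - e n * \<sigma>))) \<in> borel_measurable lborel"
        by measurable
      then show ?thesis by (simp add: mult.commute)
    qed
  qed measurable
  moreover have "(LINT \<sigma>|lborel. indicator {0..} \<sigma> *\<^sub>R (marchaud_density \<alpha> \<sigma> *\<^sub>R h t)) = marchaud_const \<alpha> *\<^sub>R h t"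
    using marchaud_density_integrable[OF a]
    unfolding marchaud_const_def set_lebesgue_integral_def set_integrable_def
    by (subst integral_scaleR_left[symmetric]) auto
  ultimately show ?thesis by (simp add: shifted_derivative_eq[OF a e(1) h])
qed

text \<open>\<open>h\<close> is the whole right-hand side and \<open>h - f\<close> its dissipative
  part. Dissipativity is asked along the trajectory and not of an operator, so that the estimate
  covers B, its Yosida approximations, differences of solutions and images of solutions under
  commuting operators. The kernel is regularised because \<open>u\<close> has only the regularity of
  g_\<alpha> * h, for which the singular integral of (u(t0) - u(s)) (t0 - s)^(-\<alpha>-1) need not
  converge absolutely.\<close>

lemma dissipative_estimate:
  fixes u f h :: "real \<Rightarrow> 'a::{banach, second_countable_topology}"
  assumes a: "0 < \<alpha>" "\<alpha> < 1" and h: "continuous_on {0..} h" and f: "continuous_on {0..} f"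
    and eq: "\<And>t. 0 \<le> t \<Longrightarrow> u t = x + convolution (g_kernel \<alpha>) h t"
    and diss: "\<And>t \<kappa>. 0 \<le> t \<Longrightarrow> 0 < \<kappa> \<Longrightarrow> \<kappa> * norm (u t) \<le> norm (\<kappa> *\<^sub>R u t - (h t - f t))"
    and t: "0 \<le> t"
  shows "norm (u t) \<le> norm x + convolution (g_kernel \<alpha>) (\<lambda>s. norm (f s)) t"
proof (rule ccontr)
  let ?a = "g_kernel \<alpha>"
  define F where "F = convolution ?a (\<lambda>s. norm (f s))"
  define \<psi> where "\<psi> s = norm (u s) - norm x - F s" for s
  define c where "c = marchaud_const \<alpha>"
  have c: "0 < c" using marchaud_const_pos[OF a] by (simp add: c_def)
  note la = loc_integrable_g_kernel[OF a(1)]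
  have nf: "continuous_on {0..} (\<lambda>s. norm (f s))" using f by (intro continuous_intros)
  have Fc: "continuous_on {0..} F" unfolding F_def by (intro convolution_continuous la nf)
  have hc: "continuous_on {0..} (convolution ?a h)" by (intro convolution_continuous la h)
  have "continuous_on {0..} (\<lambda>s. x + convolution ?a h s)" by (intro continuous_intros hc)
  then have uc: "continuous_on {0..} u" by (rule continuous_on_eq) (simp add: eq)
  assume "\<not> ?thesis"
  then have pos: "0 < \<psi> t" by (simp add: \<psi>_def F_def)
  have "continuous_on {0..t} \<psi>"
    unfolding \<psi>_def by (intro continuous_intros continuous_on_subset[OF uc] continuous_on_subset[OF Fc]) auto
  then obtain t0 where t0: "t0 \<in> {0..t}" and max: "\<And>s. s \<in> {0..t} \<Longrightarrow> \<psi> s \<le> \<psi> t0"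
    using t continuous_attains_sup[of "{0..t}" \<psi>] by fastforce
  define m where "m = \<psi> t0"
  have m: "0 < m" using max[of t] pos t by (simp add: m_def)
  have "\<psi> 0 = 0" by (simp add: \<psi>_def F_def eq)
  then have t0': "0 < t0" using m t0 by (cases "t0 = 0") (auto simp: m_def)
  define e where "e n = inverse (real (Suc n))" for n
  have e: "0 < e n" for n by (simp add: e_def)
  have e0: "e \<longlonglongrightarrow> 0" unfolding e_def by (rule LIMSEQ_inverse_real_of_nat)
  define p where "p n = shifted_kernel \<alpha> (e n)" for n
  have p: "loc_integrable (p n)" for n unfolding p_def by (intro loc_integrable_shifted_kernel e)
  have p0: "0 \<le> p n s" for n s by (simp add: p_def shifted_kernel_def)
  define b where "b n = e n powr (- \<alpha>)" for n
  define k where "k n = (t0 + e n) powr (- \<alpha>)" for n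
  \<comment> \<open>The weights \<alpha> p on [0,t0] have total mass b - k. The rest k of the
    coefficient b of u(t0) falls on the initial value x.\<close>
  have pk: "\<alpha> * (LINT s:{0..t0}|lborel. p n s) = b n - k n" for n
    using shifted_kernel_integral[OF a(1) e[of n], of t0] t0' by (simp add: p_def b_def k_def)
  define Dh where "Dh n = b n *\<^sub>R convolution ?a h t0 - \<alpha> *\<^sub>R convolution (p n) (convolution ?a h) t0" for n
  define DF where "DF n = b n *\<^sub>R F t0 - \<alpha> *\<^sub>R convolution (p n) F t0" for n
  have Dh: "Dh \<longlonglongrightarrow> c *\<^sub>R h t0"
    unfolding Dh_def[abs_def] b_def p_def c_def by (rule shifted_derivative_tendsto[OF a h t0' e e0])
  have DF: "DF \<longlonglongrightarrow> c *\<^sub>R norm (f t0)"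
    unfolding DF_def[abs_def] b_def p_def c_def F_def by (rule shifted_derivative_tendsto[OF a nf t0' e e0])
  \<comment> \<open>Dissipativity with \<kappa> = b/c bounds b |u(t0)| by the norm of b u(t0) - c (h
    - f)(t0). There b u(t0) is expanded into the regularised derivative, the weighted history and k
    x. Maximality of \<psi> at t0 bounds the history by |u(s)| \<le> m + |x| + F(s), and the mass
    deficit k leaves the surplus k m on the left.\<close>
  have main: "k n * m + DF n \<le> norm (Dh n - c *\<^sub>R h t0) + c * norm (f t0)" for n
  proof -
    let ?P = "\<alpha> * convolution (p n) (\<lambda>s. norm (u s)) t0"
    have "convolution (p n) u t0 = convolution (p n) (\<lambda>s. x + convolution ?a h s) t0"
      using t0 by (intro convolution_cong eq) auto
    also have "\<dots> = (LINT s:{0..t0}|lborel. p n s) *\<^sub>R x + convolution (p n) (convolution ?a h) t0"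
      by (subst convolution_add[OF p _ hc]) (simp_all add: convolution_const[OF p])
    finally have "\<alpha> *\<^sub>R convolution (p n) u t0
        = (\<alpha> * (LINT s:{0..t0}|lborel. p n s)) *\<^sub>R x + \<alpha> *\<^sub>R convolution (p n) (convolution ?a h) t0"
      by (simp add: scaleR_right_distrib)
    then have cu: "b n *\<^sub>R u t0 - c *\<^sub>R (h t0 - f t0)
        = (Dh n - c *\<^sub>R h t0) + \<alpha> *\<^sub>R convolution (p n) u t0 + k n *\<^sub>R x + c *\<^sub>R f t0"
      unfolding pk using eq[of t0] t0 by (simp add: Dh_def algebra_simps)
    have "0 < b n / c" using e[of n] c by (simp add: b_def)
    from diss[OF _ this, of t0] have "b n / c * norm (u t0) \<le> norm ((b n / c) *\<^sub>R u t0 - (h t0 - f t0))"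
      using t0 by auto
    then have "c * (b n / c * norm (u t0)) \<le> c * norm ((b n / c) *\<^sub>R u t0 - (h t0 - f t0))"
      using c by (intro mult_left_mono) auto
    also have "\<dots> = norm (c *\<^sub>R ((b n / c) *\<^sub>R u t0 - (h t0 - f t0)))" using c by simp
    also have "c *\<^sub>R ((b n / c) *\<^sub>R u t0 - (h t0 - f t0)) = b n *\<^sub>R u t0 - c *\<^sub>R (h t0 - f t0)"
      using c by (simp add: scaleR_right_diff_distrib)
    also have "norm \<dots> \<le> norm (Dh n - c *\<^sub>R h t0) + norm (\<alpha> *\<^sub>R convolution (p n) u t0) + norm (k n *\<^sub>R x) + norm (c *\<^sub>R f t0)"
      unfolding cu by (intro order.trans[OF norm_triangle_ineq] add_mono order.refl)
    also have "norm (\<alpha> *\<^sub>R convolution (p n) u t0) \<le> ?P"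
      using a(1) norm_convolution_le[of "p n" u t0] p0 by simp
    finally have 1: "b n * norm (u t0) \<le> norm (Dh n - c *\<^sub>R h t0) + ?P + k n * norm x + c * norm (f t0)"
      using c by (simp add: k_def)
    have "convolution (p n) (\<lambda>s. norm (u s)) t0 \<le> convolution (p n) (\<lambda>s. (m + norm x) + F s) t0"
    proof (intro convolution_mono p p0 continuous_intros uc Fc)
      fix s assume "0 \<le> s" "s \<le> t0"
      then show "norm (u s) \<le> m + norm x + F s" using max[of s] t0 by (simp add: m_def \<psi>_def)
    qed
    also have "\<dots> = (LINT s:{0..t0}|lborel. p n s) * (m + norm x) + convolution (p n) F t0"
      by (subst convolution_add[OF p _ Fc]) (simp_all add: convolution_const[OF p])
    finally have "?P \<le> \<alpha> * ((LINT s:{0..t0}|lborel. p n s) * (m + norm x) + convolution (p n) F t0)"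
      using a(1) by (intro mult_left_mono) auto
    then have 2: "?P \<le> (b n - k n) * (m + norm x) + \<alpha> * convolution (p n) F t0"
      unfolding pk[symmetric] by (simp add: algebra_simps)
    have "norm (u t0) = m + norm x + F t0" by (simp add: m_def \<psi>_def)
    then show ?thesis using 1 2 by (simp add: DF_def algebra_simps)
  qed
  \<comment> \<open>While b tends to infinity, k tends to t0^(-\<alpha>) > 0. The contributions of f
    cancel in the limit, which leaves t0^(-\<alpha>) m \<le> 0.\<close>
  have "(\<lambda>n. k n * m + DF n) \<longlonglongrightarrow> (t0 + 0) powr (- \<alpha>) * m + c *\<^sub>R norm (f t0)"
    unfolding k_def using t0' by (intro tendsto_intros DF e0) auto
  moreover have "(\<lambda>n. norm (Dh n - c *\<^sub>R h t0) + c * norm (f t0)) \<longlonglongrightarrow> norm (c *\<^sub>R h t0 - c *\<^sub>R h t0) + c * norm (f t0)"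
    by (intro tendsto_intros Dh)
  ultimately have "(t0 + 0) powr (- \<alpha>) * m + c *\<^sub>R norm (f t0) \<le> norm (c *\<^sub>R h t0 - c *\<^sub>R h t0) + c * norm (f t0)"
    by (rule LIMSEQ_le) (use main in blast)
  moreover have "0 < t0 powr (- \<alpha>) * m" using m t0' by simp
  ultimately show False by simp
qed

section \<open>The a priori bound\<close>

text \<open>Hoelder's inequality, integrated from Young's pointwise one. Only the second factor is
  normalised, so the constant is the integral of g_\<alpha>^p over p, plus 1/q, in place of the
  sharp L^p norm. \<open>W\<close> may be any positive bound, which lets the shifted primitive of
  the Osgood argument be inserted directly.\<close>

lemma convolution_Hoelder:
  assumes \<alpha>: "0 < \<alpha>" and pq: "1 < p" "1 < q" "1 / p + 1 / q = 1"
    and ap: "loc_integrable (\<lambda>s. g_kernel \<alpha> s powr p)"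
    and g: "continuous_on {0..} g" and g0: "\<And>s. 0 \<le> s \<Longrightarrow> 0 \<le> g s"
    and W: "0 < W" "convolution (\<lambda>_. 1) (\<lambda>s. g s powr q) t \<le> W"
  shows "convolution (g_kernel \<alpha>) g t \<le> ((LINT s:{0..t}|lborel. g_kernel \<alpha> s powr p) / p + 1 / q) * W powr (1 / q)"
proof -
  let ?a = "g_kernel \<alpha>"
  \<comment> \<open>scaling for which both terms of Young's inequality integrate to multiples of \<open>W powr (1/q)\<close>\<close>
  define \<theta> where "\<theta> = W powr (1 / (p * q))"
  have \<theta>: "0 < \<theta>" using W by (simp add: \<theta>_def)
  have \<theta>p: "\<theta> powr p = W powr (1 / q)" using pq by (simp add: \<theta>_def powr_powr)
  have "W powr (1 / p) * W powr (1 / q) = W"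
    using W pq(3) by (simp flip: powr_add)
  moreover have \<theta>q: "\<theta> powr q = W powr (1 / p)" using pq by (simp add: \<theta>_def powr_powr)
  ultimately have W\<theta>: "W / \<theta> powr q = W powr (1 / q)" using W by (simp add: field_simps)
  have gq: "continuous_on {0..} (\<lambda>s. g s powr q)"
    using g g0 pq by (intro continuous_on_powr' continuous_intros) auto
  have i1: "set_integrable lborel {0..t} (\<lambda>s. (\<theta> powr p / p) *\<^sub>R (?a (t - s) powr p *\<^sub>R (1 :: real)))"
    by (intro set_integrable_scaleR_right impI
        convolution_integrable[OF ap continuous_on_const[of "{0..}" "1 :: real"]])
  have i2: "set_integrable lborel {0..t} (\<lambda>s. (1 / (\<theta> powr q * q)) *\<^sub>R (1 *\<^sub>R (g s powr q)))"
    by (intro set_integrable_scaleR_right convolution_integrable[OF loc_integrable_one gq] impI)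
  have "convolution ?a g t \<le> (LINT s:{0..t}|lborel. (\<theta> powr p / p) *\<^sub>R (?a (t - s) powr p *\<^sub>R (1 :: real))
      + (1 / (\<theta> powr q * q)) *\<^sub>R (1 *\<^sub>R (g s powr q)))"
    unfolding convolution_def
  proof (intro set_integral_mono convolution_integrable loc_integrable_g_kernel \<alpha> g set_integral_add(1)[OF i1 i2])
    fix s assume s: "s \<in> {0..t}"
    have "?a (t - s) *\<^sub>R g s = (\<theta> * ?a (t - s)) * (g s / \<theta>)" using \<theta> by simp
    also have "\<dots> \<le> (\<theta> * ?a (t - s)) powr p / p + (g s / \<theta>) powr q / q"
      using s \<theta> g0[of s] g_kernel_nonneg[OF \<alpha>] by (intro Youngs_inequality pq) auto
    also have "\<dots> = (\<theta> powr p / p) *\<^sub>R (?a (t - s) powr p *\<^sub>R (1 :: real)) + (1 / (\<theta> powr q * q)) *\<^sub>R (1 *\<^sub>R (g s powr q))"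
      using s \<theta> g0[of s] g_kernel_nonneg[OF \<alpha>] by (simp add: powr_mult powr_divide)
    finally show "?a (t - s) *\<^sub>R g s \<le> \<dots>" .
  qed
  also have "\<dots> = (\<theta> powr p / p) *\<^sub>R convolution (\<lambda>s. ?a s powr p) (\<lambda>_. 1) t
      + (1 / (\<theta> powr q * q)) *\<^sub>R convolution (\<lambda>_. 1) (\<lambda>s. g s powr q) t"
    unfolding set_integral_add(2)[OF i1 i2] set_integral_scaleR_right by (simp add: convolution_def)
  also have "\<dots> \<le> (\<theta> powr p / p) * (LINT s:{0..t}|lborel. ?a s powr p) + (1 / (\<theta> powr q * q)) * W"
    using W pq by (auto simp: convolution_const[OF ap] intro!: divide_right_mono mult_right_mono)
  also have "\<dots> = ((LINT s:{0..t}|lborel. ?a s powr p) / p + 1 / q) * W powr (1 / q)"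
  proof -
    have "1 / (\<theta> powr q * q) * W = W powr (1 / q) / q" unfolding W\<theta>[symmetric] by simp
    then show ?thesis unfolding \<theta>p by (simp add: algebra_simps)
  qed
  finally show ?thesis .
qed

lemma loc_integrable_g_kernel_powr:
  assumes \<alpha>: "0 < \<alpha>" and p: "0 < p" "- 1 < (\<alpha> - 1) * p"
  shows "loc_integrable (\<lambda>s. g_kernel \<alpha> s powr p)"
  unfolding loc_integrable_def
proof (intro conjI allI)
  show "(\<lambda>s. g_kernel \<alpha> s powr p) \<in> borel_measurable borel" by measurable
  fix t :: real
  show "set_integrable lborel {0..t} (\<lambda>s. g_kernel \<alpha> s powr p)"
  proof (cases "0 \<le> t")
    case True
    have "set_integrable lborel {0..t} (\<lambda>s. s powr ((\<alpha> - 1) * p) / Gamma \<alpha> powr p)"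
      using p True by (intro set_integrable_divide impI lborel_set_integral_of_has_integral(1)[OF _ _ has_integral_powr_from_0]) auto
    moreover have "set_integrable lborel {0..t} (\<lambda>s. s powr ((\<alpha> - 1) * p) / Gamma \<alpha> powr p)
        = set_integrable lborel {0..t} (\<lambda>s. g_kernel \<alpha> s powr p)"
      using \<alpha> by (intro set_integrable_cong) (auto simp: g_kernel_def powr_divide powr_powr Gamma_real_pos less_imp_le)
    ultimately show ?thesis by blast
  qed (simp add: set_integrable_def)
qed

text \<open>If the increasing primitives stayed bounded, they would converge to their supremum. The
  improper integral would then exist, and for a nonnegative integrand it equals the Lebesgue
  integral.\<close>

lemma integral_unbounded_of_nn_integral_infinite:
  fixes \<gamma> :: "real \<Rightarrow> real"
  assumes c: "continuous_on {a..} \<gamma>" and n: "\<And>s. a \<le> s \<Longrightarrow> 0 \<le> \<gamma> s"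
    and inf: "(\<integral>\<^sup>+s\<in>{a..}. ennreal (\<gamma> s) \<partial>lborel) = \<infinity>"
  shows "\<exists>M\<ge>a. N < integral {a..M} \<gamma>"
proof (rule ccontr)
  assume "\<not> ?thesis"
  then have le: "integral {a..M} \<gamma> \<le> N" if "a \<le> M" for M using that by force
  have int: "\<gamma> integrable_on {a..M}" for M
    by (intro integrable_continuous_interval continuous_on_subset[OF c]) auto
  have mono: "integral {a..x} \<gamma> \<le> integral {a..y} \<gamma>" if "x \<le> y" for x y
    using that by (intro integral_subset_le int) (auto intro: n)
  define l where "l = (SUP y\<in>{a..}. integral {a..y} \<gamma>)"
  have bdd: "bdd_above ((\<lambda>y. integral {a..y} \<gamma>) ` {a..})" using le by (intro bdd_aboveI2) auto
  have "((\<lambda>y. integral {a..y} \<gamma>) \<longlongrightarrow> l) at_top"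
  proof (rule increasing_tendsto)
    show "\<forall>\<^sub>F y in at_top. integral {a..y} \<gamma> \<le> l"
      unfolding l_def using bdd by (auto intro!: eventually_at_top_linorderI[of a] cSUP_upper)
    fix x assume "x < l"
    then obtain y where y: "a \<le> y" "x < integral {a..y} \<gamma>"
      unfolding l_def using less_cSUP_iff[OF _ bdd, of x] by auto
    then show "\<forall>\<^sub>F y in at_top. x < integral {a..y} \<gamma>"
      using mono by (intro eventually_at_top_linorderI[of y]) (auto intro: less_le_trans)
  qed
  then have "(\<gamma> has_integral l) {a..}"
    using int n by (intro has_integral_to_inf) auto
  then have "(\<integral>\<^sup>+s\<in>{a..}. ennreal (\<gamma> s) \<partial>lborel) = ennreal l"
    using n by (intro nn_integral_has_integral_lebesgue') auto
  then show False using inf by simp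
qed

text \<open>\<open>M\<close> is chosen before \<phi>, since it later serves to define the truncation
  that produces \<phi>. Hoelder gives \<phi> \<le> z = Q W^(1/q), where W' = w(\<phi>)^q, and the
  powers are matched so that z^(q-1) z' = (Q^q/q) w(\<phi>)^q. As w is nondecreasing, w(\<phi>)
  \<le> w(z). Hence G(z) grows at most at the rate c = Q^q/q, where G has the derivative
  \<sigma>^(q-1)/w(\<sigma>)^q, and the divergence of G bounds z.\<close>

lemma osgood_bound:
  assumes \<alpha>: "0 < \<alpha>" "\<alpha> < 1" and w: "w \<in> C_infty \<alpha>" and K: "0 \<le> K" and C: "0 \<le> C"
  obtains M where "0 \<le> M" "\<And>\<phi> t. continuous_on {0..} \<phi> \<Longrightarrow> (\<And>s. 0 \<le> s \<Longrightarrow> 0 \<le> \<phi> s) \<Longrightarrow>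
      (\<And>s. 0 \<le> s \<Longrightarrow> \<phi> s \<le> K + C * convolution (g_kernel \<alpha>) (\<lambda>r. w (\<phi> r)) s) \<Longrightarrow>
      0 \<le> t \<Longrightarrow> t \<le> T \<Longrightarrow> \<phi> t \<le> M"
proof -
  from w obtain \<epsilon> where wc: "continuous_on {0..} w" and wm: "mono_on {0..} w"
    and w0: "\<And>\<sigma>. 0 \<le> \<sigma> \<Longrightarrow> 0 \<le> w \<sigma>" and wn: "\<And>\<sigma>. 0 < \<sigma> \<Longrightarrow> w \<sigma> \<noteq> 0" and \<epsilon>: "0 < \<epsilon>"
    and inf: "(\<integral>\<^sup>+\<sigma>\<in>{1..}. ennreal (\<sigma> powr (1 / \<alpha> + \<epsilon> - 1) / w \<sigma> powr (1 / \<alpha> + \<epsilon>)) \<partial>lborel) = \<infinity>"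
    unfolding C_infty_def by auto
  define q where "q = 1 / \<alpha> + \<epsilon>"
  define p where "p = q / (q - 1)"
  have \<alpha>q: "1 < \<alpha> * q" using \<alpha> \<epsilon> by (simp add: q_def field_simps)
  then have q: "1 < q"
  proof -
    have "1 < 1 / \<alpha>" using \<alpha> by simp
    then show ?thesis using \<epsilon> by (simp add: q_def)
  qed
  have p: "1 < p" using q by (simp add: p_def)
  have pq: "1 / p + 1 / q = 1" using q by (simp add: p_def field_simps)
  \<comment> \<open>For conjugate exponents this is equivalent to \<alpha> q > 1, which is where
    \<epsilon> > 0 enters.\<close>
  have "- 1 < (\<alpha> - 1) * p" using \<alpha>q q by (simp add: p_def field_simps)
  then have ap: "loc_integrable (\<lambda>s. g_kernel \<alpha> s powr p)"
    using p \<alpha> by (intro loc_integrable_g_kernel_powr) auto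
  define \<gamma> where "\<gamma> \<sigma> = \<sigma> powr (q - 1) / w \<sigma> powr q" for \<sigma>
  have wpos: "0 < w \<sigma>" if "0 < \<sigma>" for \<sigma> using w0[of \<sigma>] wn[of \<sigma>] that by simp
  have \<gamma>c: "continuous_on {1..} \<gamma>"
  proof -
    have w1: "continuous_on {1..} w" using wc by (rule continuous_on_subset) auto
    have nz: "w \<sigma> \<noteq> 0" if "\<sigma> \<in> {1..}" for \<sigma> using wn[of \<sigma>] that by auto
    show ?thesis
      unfolding \<gamma>_def
      by (rule continuous_on_divide[OF continuous_on_powr[OF continuous_on_id continuous_on_const]
            continuous_on_powr[OF w1 continuous_on_const]]) (use nz in auto)
  qed
  have \<gamma>0: "0 \<le> \<gamma> \<sigma>" for \<sigma> by (simp add: \<gamma>_def)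
  define G where "G x = integral {1..x} \<gamma>" for x
  have G': "(G has_real_derivative \<gamma> x) (at x within {1..})" if "1 \<le> x" for x
  proof -
    have "(G has_real_derivative \<gamma> x) (at x within {1..x + 1})"
      unfolding G_def using that by (intro integral_has_real_derivative continuous_on_subset[OF \<gamma>c]) auto
    moreover have "at x within {1..x + 1} = at x within {1..}"
      by (rule at_within_nhd[where S = "{..<x + 1}"]) auto
    ultimately show ?thesis by simp
  qed
  have Gmono: "G x \<le> G y" if "x \<le> y" for x y
    unfolding G_def using that
    by (intro integral_subset_le integrable_continuous_interval continuous_on_subset[OF \<gamma>c]) (auto intro: \<gamma>0)
  define A where "A = (LINT s:{0..T}|lborel. g_kernel \<alpha> s powr p) / p + 1 / q"
  have A0: "0 \<le> A"
    unfolding A_def set_lebesgue_integral_def using p q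
    by (intro add_nonneg_nonneg divide_nonneg_nonneg integral_nonneg_AE AE_I2) auto
  \<comment> \<open>The summand 1 keeps z at or above 1, inside the range on which G is defined by
    integration from 1.\<close>
  define Q where "Q = K + C * A + 1"
  have Q: "1 \<le> Q" using K C A0 by (simp add: Q_def)
  define c where "c = Q powr q / q"
  have "\<exists>M\<ge>1. G Q + c * T < G M"
    unfolding G_def using \<gamma>c \<gamma>0 inf
    by (intro integral_unbounded_of_nn_integral_infinite) (auto simp: \<gamma>_def q_def)
  then obtain M where M: "1 \<le> M" "G Q + c * T < G M" by blast
  have "\<phi> t \<le> M" if \<phi>: "continuous_on {0..} \<phi>" and \<phi>0: "\<And>s. 0 \<le> s \<Longrightarrow> 0 \<le> \<phi> s"
    and le: "\<And>s. 0 \<le> s \<Longrightarrow> \<phi> s \<le> K + C * convolution (g_kernel \<alpha>) (\<lambda>r. w (\<phi> r)) s"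
    and t: "0 \<le> t" "t \<le> T" for \<phi> t
  proof -
    have w\<phi>: "continuous_on {0..} (\<lambda>s. w (\<phi> s))"
      by (rule continuous_on_compose2[OF wc \<phi>]) (use \<phi>0 in auto)
    have wq: "continuous_on {0..} (\<lambda>s. w (\<phi> s) powr q)"
      using w\<phi> w0 \<phi>0 q by (intro continuous_on_powr' continuous_intros) auto
    \<comment> \<open>Starting from 1 makes the powers of W differentiable at time 0 and allows
      \<open>K\<close> to be absorbed into K W^(1/q).\<close>
    define W where "W s = 1 + convolution (\<lambda>_. 1) (\<lambda>s. w (\<phi> s) powr q) s" for s
    have W1: "1 \<le> W s" for s
      unfolding W_def convolution_def set_lebesgue_integral_def by (simp add: integral_nonneg_AE)
    have W': "(W has_real_derivative w (\<phi> s) powr q) (at s within {0..})" if "0 \<le> s" for s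
      using convolution_one_has_vector_derivative[OF wq that]
      unfolding W_def has_real_derivative_iff_has_vector_derivative
      by (intro derivative_eq_intros) auto
    define z where "z s = Q * W s powr (1 / q)" for s
    have zQ: "Q \<le> z s" for s
    proof -
      have "1 \<le> W s powr (1 / q)" using W1[of s] q by (intro ge_one_powr_ge_zero) auto
      then show ?thesis unfolding z_def using Q by (simp add: mult_le_cancel_left1)
    qed
    have \<phi>z: "\<phi> s \<le> z s" if s: "0 \<le> s" "s \<le> T" for s
    proof -
      have W1q: "1 \<le> W s powr (1 / q)" using W1[of s] q by (intro ge_one_powr_ge_zero) auto
      have "convolution (g_kernel \<alpha>) (\<lambda>r. w (\<phi> r)) s
          \<le> ((LINT r:{0..s}|lborel. g_kernel \<alpha> r powr p) / p + 1 / q) * W s powr (1 / q)"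
        using W1[of s] by (intro convolution_Hoelder \<alpha> p q pq ap w\<phi>) (auto simp: W_def intro!: w0 \<phi>0)
      also have "\<dots> \<le> A * W s powr (1 / q)"
        unfolding A_def set_lebesgue_integral_def using p s loc_integrableD(2)[OF ap]
        by (intro mult_right_mono add_right_mono divide_right_mono integral_mono)
           (auto simp: set_integrable_def indicator_def)
      finally have "C * convolution (g_kernel \<alpha>) (\<lambda>r. w (\<phi> r)) s \<le> C * (A * W s powr (1 / q))"
        using C by (intro mult_left_mono)
      moreover have "K \<le> K * W s powr (1 / q)" using K W1q by (simp add: mult_le_cancel_left1)
      ultimately have "\<phi> s \<le> (K + C * A) * W s powr (1 / q)"
        using le[OF s(1)] by (simp add: algebra_simps)
      also have "\<dots> \<le> z s" unfolding z_def Q_def by (intro mult_right_mono) auto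
      finally show ?thesis .
    qed
    have z': "(z has_real_derivative Q / q * W s powr (1 / q - 1) * w (\<phi> s) powr q) (at s within {0..})" if "0 \<le> s" for s
      unfolding z_def using W'[OF that] W1[of s] q
      by (auto intro!: derivative_eq_intros simp: field_simps)
    define H where "H s = G (z s) - c * s" for s
    have H': "\<exists>D\<le>0. (H has_real_derivative D) (at s within {0..})" if s: "0 \<le> s" "s \<le> T" for s
    proof -
      have z1: "1 \<le> z s" for s using zQ[of s] Q by simp
      have "(G \<circ> z has_real_derivative \<gamma> (z s) * (Q / q * W s powr (1 / q - 1) * w (\<phi> s) powr q)) (at s within {0..})"
        by (rule DERIV_image_chain[OF DERIV_subset[OF G'[OF z1]] z'[OF s(1)]]) (use z1 in auto)
      then have d: "(H has_real_derivative \<gamma> (z s) * (Q / q * W s powr (1 / q - 1) * w (\<phi> s) powr q) - c) (at s within {0..})"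
        unfolding H_def by (auto intro!: derivative_eq_intros simp: o_def)
      have "z s powr (q - 1) * (Q / q * W s powr (1 / q - 1)) = c"
      proof -
        have "z s powr (q - 1) = Q powr (q - 1) * W s powr (1 / q * (q - 1))"
          unfolding z_def using Q W1[of s] by (simp add: powr_mult powr_powr)
        moreover have "W s powr (1 / q * (q - 1)) * W s powr (1 / q - 1) = 1"
        proof -
          have "1 / q * (q - 1) + (1 / q - 1) = 0" using q by (simp add: field_simps)
          then show ?thesis using W1[of s] by (simp flip: powr_add)
        qed
        moreover have "Q powr (q - 1) * Q = Q powr q"
          using Q powr_add[of Q "q - 1" 1] by simp
        ultimately show ?thesis by (simp add: c_def mult_ac)
      qed
      moreover have "w (\<phi> s) powr q / w (z s) powr q \<le> 1"
      proof -
        have "w (\<phi> s) \<le> w (z s)" using wm \<phi>z[OF s] \<phi>0[OF s(1)] by (auto simp: mono_on_def)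
        then have "w (\<phi> s) powr q \<le> w (z s) powr q" using w0 \<phi>0[OF s(1)] q by (intro powr_mono2) auto
        then show ?thesis using wpos[of "z s"] z1[of s] by (simp add: divide_le_eq_1)
      qed
      moreover have "0 \<le> c" using q by (simp add: c_def)
      ultimately have "z s powr (q - 1) * (Q / q * W s powr (1 / q - 1)) * (w (\<phi> s) powr q / w (z s) powr q) \<le> c"
        by (metis mult_left_le)
      then have "\<gamma> (z s) * (Q / q * W s powr (1 / q - 1) * w (\<phi> s) powr q) - c \<le> 0"
        by (simp add: \<gamma>_def mult_ac)
      then show ?thesis using d by blast
    qed
    have "H t \<le> H 0"
    proof (cases "t = 0")
      case False
      from H' obtain H1 where H1: "\<And>s. 0 \<le> s \<Longrightarrow> s \<le> T \<Longrightarrow> H1 s \<le> 0"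
        "\<And>s. 0 \<le> s \<Longrightarrow> s \<le> T \<Longrightarrow> (H has_real_derivative H1 s) (at s within {0..})" by metis
      have "\<exists>s\<in>{0<..<t}. H t - H 0 = (\<lambda>y. H1 s * y) (t - 0)"
      proof (rule mvt_simple)
        fix s assume "0 \<le> s" "s \<le> t"
        then have "(H has_real_derivative H1 s) (at s within {0..t})"
          using t by (intro DERIV_subset[OF H1(2)]) auto
        then show "(H has_derivative (\<lambda>y. H1 s * y)) (at s within {0..t})" by (simp add: has_field_derivative_def)
      qed (use False t in auto)
      then obtain s where s: "0 < s" "s < t" "H t - H 0 = H1 s * t" by auto
      have "H1 s * t \<le> 0" using s t by (intro mult_nonpos_nonneg H1) auto
      then show ?thesis using s by simp
    qed simp
    moreover have "z 0 = Q" by (simp add: z_def W_def)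
    ultimately have "G (z t) \<le> G Q + c * t" by (simp add: H_def)
    also have "\<dots> \<le> G Q + c * T" using t q by (simp add: c_def mult_left_mono divide_right_mono)
    also have "\<dots> < G M" by (rule M)
    finally have "z t < M" using Gmono[of M "z t"] by linarith
    then show ?thesis using \<phi>z[OF t] by linarith
  qed
  then show thesis using M(1) by (intro that[of M]) auto
qed

lemma continuous_majorant:
  fixes b :: "nat \<Rightarrow> real"
  assumes "\<And>n. 0 \<le> b n"
  obtains M :: "real \<Rightarrow> real" where "continuous_on {0..} M" "\<And>t. 0 < M t" "\<And>t. 0 \<le> t \<Longrightarrow> b (nat \<lceil>t\<rceil>) \<le> M t"
proof -
  \<comment> \<open>A ramp of height \<open>b n\<close>: it vanishes for t \<le> n - 2 and is full
    for t \<ge> n - 1. The index n = \<lceil>t\<rceil> satisfies n < t + 1, so its ramp is already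
    full at t, and all terms from \<lceil>t\<rceil> + 2 on vanish. On a bounded interval the sum is
    therefore a fixed finite one.\<close>
  define c where "c n t = b n * max 0 (min 1 (t + 2 - real n))" for n t
  define M where "M t = 1 + (\<Sum>n<nat \<lceil>t\<rceil> + 2. c n t)" for t
  have c0: "0 \<le> c n t" for n t by (simp add: c_def assms)
  have M: "M t = 1 + (\<Sum>n<N. c n t)" if "nat \<lceil>t\<rceil> + 2 \<le> N" for N t
  proof -
    have "c n t = 0" if "nat \<lceil>t\<rceil> + 2 \<le> n" for n
    proof -
      have "t \<le> real (nat \<lceil>t\<rceil>)" by (rule real_nat_ceiling_ge)
      then have "t + 2 - real n \<le> 0" using that by linarith
      then show ?thesis by (simp add: c_def)
    qed
    then have "(\<Sum>n<nat \<lceil>t\<rceil> + 2. c n t) = (\<Sum>n<N. c n t)" using that by (intro sum.mono_neutral_left) auto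
    then show ?thesis by (simp add: M_def)
  qed
  have "continuous_on {0..T} M" for T
  proof -
    have "continuous_on {0..T} (\<lambda>t. 1 + (\<Sum>n<nat \<lceil>T\<rceil> + 2. c n t))"
      unfolding c_def by (intro continuous_intros)
    moreover have "1 + (\<Sum>n<nat \<lceil>T\<rceil> + 2. c n t) = M t" if "t \<in> {0..T}" for t
      using that by (intro M[symmetric] add_right_mono nat_mono ceiling_mono) auto
    ultimately show ?thesis by (rule continuous_on_eq)
  qed
  moreover have "0 < M t" for t using sum_nonneg[of "{..<nat \<lceil>t\<rceil> + 2}" "\<lambda>n. c n t"] c0 by (simp add: M_def add_pos_nonneg)
  moreover have "b (nat \<lceil>t\<rceil>) \<le> M t" if "0 \<le> t" for t
  proof -
    have "real (nat \<lceil>t\<rceil>) < t + 1" using that by linarith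
    then have "b (nat \<lceil>t\<rceil>) = c (nat \<lceil>t\<rceil>) t" by (simp add: c_def)
    also have "\<dots> \<le> (\<Sum>n<nat \<lceil>t\<rceil> + 2. c n t)" using c0 by (intro member_le_sum) auto
    finally show ?thesis by (simp add: M_def)
  qed
  ultimately show thesis by (intro that[of M] continuous_on_atLeast_0I) auto
qed

section \<open>Selfadjoint operators\<close>

lemma cinner_add_left: "cinner (x + y) z = cinner x z + cinner y z"
  using cinner_add_right[of z x y] cinner_commute[of "x + y" z] cinner_commute[of x z] cinner_commute[of y z]
  by simp

lemma cinner_scaleC_left: "cinner (c *\<^sub>C x) y = cnj c * cinner x y"
  using cinner_scaleC_right[of y c x] cinner_commute[of "c *\<^sub>C x" y] cinner_commute[of x y] by simp

lemma scaleC_minus_one: "(-1) *\<^sub>C x = - x"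
  using scaleC_of_real[of "-1" x] by simp

lemma cinner_minus_right: "cinner x (- y) = - cinner x y"
  using cinner_scaleC_right[of x "-1" y] by (simp add: scaleC_minus_one)

lemma cinner_minus_left: "cinner (- x) y = - cinner x y"
  using cinner_scaleC_left[of "-1" x y] by (simp add: scaleC_minus_one)

lemma cinner_diff_left: "cinner (x - y) z = cinner x z - cinner y z"
  using cinner_add_left[of x "- y" z] by (simp add: cinner_minus_left)

lemma cinner_zero_left [simp]: "cinner 0 x = 0"
  using cinner_add_left[of 0 0 x] by simp

lemma norm_scaleC: "norm (c *\<^sub>C x) = cmod c * norm x"
proof -
  have "complex_of_real ((norm (c *\<^sub>C x))\<^sup>2) = complex_of_real ((cmod c * norm x)\<^sup>2)"
    unfolding cinner_self[symmetric] cinner_scaleC_left cinner_scaleC_right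
    by (simp only: cinner_self power_mult_distrib of_real_mult complex_norm_square mult_ac)
  then have "(norm (c *\<^sub>C x))\<^sup>2 = (cmod c * norm x)\<^sup>2" by (simp only: of_real_eq_iff)
  then show ?thesis by (simp add: power2_eq_iff_nonneg)
qed

lemma norm_add_square: "(norm (x + y))\<^sup>2 = (norm x)\<^sup>2 + 2 * Re (cinner x y) + (norm y)\<^sup>2"
proof -
  have "Re (cinner (x + y) (x + y)) = Re (cinner x x) + 2 * Re (cinner x y) + Re (cinner y y)"
    using cinner_commute[of y x] by (simp add: cinner_add_left cinner_add_right)
  then show ?thesis by (simp add: cinner_self)
qed

lemma norm_diff_square: "(norm (x - y))\<^sup>2 = (norm x)\<^sup>2 - 2 * Re (cinner x y) + (norm y)\<^sup>2"
  using norm_add_square[of x "- y"] by (simp add: cinner_minus_right)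

text \<open>A minimizing sequence for the distance is Cauchy by the parallelogram identity.\<close>

lemma closest_point_subspace:
  fixes M :: "'a::complex_hilbert set"
  assumes M: "closed M" "0 \<in> M" "\<And>x y. x \<in> M \<Longrightarrow> y \<in> M \<Longrightarrow> x + y \<in> M" "\<And>c x. x \<in> M \<Longrightarrow> c *\<^sub>C x \<in> M"
  obtains m where "m \<in> M" "\<And>x. x \<in> M \<Longrightarrow> norm (y - m) \<le> norm (y - x)"
proof -
  define d where "d = (INF x\<in>M. norm (y - x))"
  have bdd: "bdd_below ((\<lambda>x. norm (y - x)) ` M)" by (intro bdd_belowI2[where m = 0]) auto
  have dle: "d \<le> norm (y - x)" if "x \<in> M" for x
    unfolding d_def using bdd that by (rule cINF_lower)
  have d0: "0 \<le> d" unfolding d_def using M(2) by (intro cINF_greatest) auto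
  have "\<exists>x\<in>M. norm (y - x) < d + inverse (real (Suc n))" for n
    using cINF_less_iff[OF _ bdd, of "d + inverse (real (Suc n))"] M(2) unfolding d_def[symmetric] by auto
  then obtain x where xM: "\<And>n. x n \<in> M" and xd: "\<And>n. norm (y - x n) < d + inverse (real (Suc n))" by metis
  have dist: "(norm (x m - x n))\<^sup>2 \<le> 4 * (2 * d + 1) * inverse (real (Suc N))" if "N \<le> m" "N \<le> n" for m n N
  proof -
    let ?r = "inverse (real (Suc N))"
    have r: "0 < ?r" "?r \<le> 1" by (auto simp: inverse_le_1_iff)
    have near: "(norm (y - x k))\<^sup>2 \<le> d\<^sup>2 + (2 * d + 1) * ?r" if "N \<le> k" for k
    proof -
      have "inverse (real (Suc k)) \<le> ?r" using that by (intro le_imp_inverse_le) auto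
      then have "norm (y - x k) \<le> d + ?r" using xd[of k] by linarith
      then have "(norm (y - x k))\<^sup>2 \<le> (d + ?r)\<^sup>2" by (intro power_mono) auto
      also have "\<dots> = d\<^sup>2 + 2 * d * ?r + ?r * ?r" by (simp add: power2_eq_square algebra_simps)
      also have "\<dots> \<le> d\<^sup>2 + 2 * d * ?r + ?r * 1" using r by (intro add_left_mono mult_left_mono) auto
      finally show ?thesis by (simp add: algebra_simps)
    qed
    have mid: "(1 / 2) *\<^sub>R (x m + x n) \<in> M"
      using M(4)[OF M(3)[OF xM xM], of "complex_of_real (1/2)" m n] by (simp only: scaleC_of_real)
    have "(norm (x m - x n))\<^sup>2 = 2 * (norm (y - x m))\<^sup>2 + 2 * (norm (y - x n))\<^sup>2 - (norm ((y - x m) + (y - x n)))\<^sup>2"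
    proof -
      have "x m - x n = (y - x n) - (y - x m)" by simp
      then show ?thesis
        using norm_diff_square[of "y - x n" "y - x m"] norm_add_square[of "y - x m" "y - x n"]
          cinner_commute[of "y - x n" "y - x m"] by simp
    qed
    also have "(y - x m) + (y - x n) = 2 *\<^sub>R (y - (1 / 2) *\<^sub>R (x m + x n))"
      by (simp add: scaleR_2 algebra_simps)
    also have "(norm (2 *\<^sub>R (y - (1 / 2) *\<^sub>R (x m + x n))))\<^sup>2 = 4 * (norm (y - (1 / 2) *\<^sub>R (x m + x n)))\<^sup>2"
      by (simp add: power_mult_distrib)
    also have "2 * (norm (y - x m))\<^sup>2 + 2 * (norm (y - x n))\<^sup>2 - 4 * (norm (y - (1 / 2) *\<^sub>R (x m + x n)))\<^sup>2
        \<le> 2 * (d\<^sup>2 + (2 * d + 1) * ?r) + 2 * (d\<^sup>2 + (2 * d + 1) * ?r) - 4 * d\<^sup>2"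
    proof -
      have *: "2 * a + 2 * b - 4 * c \<le> 2 * u + 2 * u - 4 * v" if "a \<le> u" "b \<le> u" "v \<le> c" for a b c u v :: real
        using that by simp
      show ?thesis by (rule *[OF near[OF that(1)] near[OF that(2)] power_mono[OF dle[OF mid] d0]])
    qed
    finally show ?thesis by (simp add: algebra_simps)
  qed
  have "Cauchy x"
  proof (rule CauchyI)
    fix e :: real assume e: "0 < e"
    obtain N :: nat where N: "4 * (2 * d + 1) / e\<^sup>2 < real N" using reals_Archimedean2 by blast
    have "norm (x m - x n) < e" if "N \<le> m" "N \<le> n" for m n
    proof -
      have "4 * (2 * d + 1) / e\<^sup>2 < real (Suc N)" using N by simp
      then have "4 * (2 * d + 1) * inverse (real (Suc N)) < e\<^sup>2"
        using e by (simp add: field_simps)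
      then have "(norm (x m - x n))\<^sup>2 < e\<^sup>2" using dist[OF that] by linarith
      then show ?thesis using e by (simp add: power_less_imp_less_base)
    qed
    then show "\<exists>M. \<forall>m\<ge>M. \<forall>n\<ge>M. norm (x m - x n) < e" by blast
  qed
  then obtain m where m: "x \<longlonglongrightarrow> m" using Cauchy_convergent convergent_def by blast
  have mM: "m \<in> M" by (rule closed_sequentially[OF M(1) _ m]) (simp add: xM)
  have "norm (y - m) \<le> d"
  proof (rule LIMSEQ_le)
    show "(\<lambda>n. norm (y - x n)) \<longlonglongrightarrow> norm (y - m)" by (intro tendsto_intros m)
    show "(\<lambda>n. d + inverse (real (Suc n))) \<longlonglongrightarrow> d"
      using tendsto_add[OF tendsto_const LIMSEQ_inverse_real_of_nat, of d] by simp
  qed (use xd in \<open>auto intro!: exI[of _ 0] less_imp_le\<close>)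
  then show thesis using mM dle by (intro that[of m]) (auto intro: order.trans)
qed

lemma closed_subspace_orthogonal:
  fixes M :: "'a::complex_hilbert set"
  assumes M: "closed M" "0 \<in> M" "\<And>x y. x \<in> M \<Longrightarrow> y \<in> M \<Longrightarrow> x + y \<in> M" "\<And>c x. x \<in> M \<Longrightarrow> c *\<^sub>C x \<in> M"
    and y: "y \<notin> M"
  obtains z where "z \<noteq> 0" "\<And>x. x \<in> M \<Longrightarrow> cinner x z = 0"
proof -
  obtain m where m: "m \<in> M" and min: "\<And>x. x \<in> M \<Longrightarrow> norm (y - m) \<le> norm (y - x)"
    using closest_point_subspace[OF M] by blast
  define z where "z = y - m"
  have "cinner x z = 0" if x: "x \<in> M" for x
  proof (rule ccontr)
    assume n: "cinner x z \<noteq> 0"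
    then have x0: "0 < (norm x)\<^sup>2" by auto
    \<comment> \<open>This multiple of x is the projection of z onto x; subtracting it lowers the
      squared norm of z by |<x,z>|^2 / |x|^2, against the minimality of z.\<close>
    define c where "c = cinner x z / complex_of_real ((norm x)\<^sup>2)"
    have "norm z \<le> norm (y - (m + c *\<^sub>C x))" unfolding z_def by (intro min M m x)
    also have "y - (m + c *\<^sub>C x) = z - c *\<^sub>C x" by (simp add: z_def)
    finally have "(norm z)\<^sup>2 \<le> (norm (z - c *\<^sub>C x))\<^sup>2" by (intro power_mono) auto
    also have "\<dots> = (norm z)\<^sup>2 - 2 * Re (c * cinner z x) + (cmod c)\<^sup>2 * (norm x)\<^sup>2"
      by (simp add: norm_diff_square cinner_scaleC_right norm_scaleC power_mult_distrib)
    also have "c * cinner z x = complex_of_real ((cmod (cinner x z))\<^sup>2 / (norm x)\<^sup>2)"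
      unfolding c_def using cinner_commute[of z x] by (simp add: complex_norm_square del: of_real_power)
    also have "(cmod c)\<^sup>2 * (norm x)\<^sup>2 = (cmod (cinner x z))\<^sup>2 / (norm x)\<^sup>2"
    proof -
      have "cmod c = cmod (cinner x z) / (norm x)\<^sup>2" by (simp add: c_def norm_divide norm_power)
      then show ?thesis using x0 by (simp add: power_divide power2_eq_square)
    qed
    finally have "(cmod (cinner x z))\<^sup>2 / (norm x)\<^sup>2 \<le> 0" by simp
    then show False using n x0 by (simp add: divide_le_0_iff)
  qed
  moreover have "z \<noteq> 0" using y m by (auto simp: z_def)
  ultimately show thesis by (rule that[rotated])
qed

text \<open>Symmetry makes <x, \<i> A x> purely imaginary, so that |\<kappa> x - \<i> A x|^2 =
  |\<kappa> x|^2 + |A x|^2. This lower bound and the closedness of A, inherited from the adjoint,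
  make the range closed. A vector z orthogonal to the range satisfies the adjoint equation, hence
  lies in D with A z = \<i> \<kappa> z. Then 2 \<kappa> z is itself in the range, which forces z =
  0.\<close>

lemma selfadjoint_resolvent:
  fixes D :: "'a::complex_hilbert set"
  assumes sa: "selfadjoint_operator D A" and k: "0 < \<kappa>"
  shows "x \<in> D \<Longrightarrow> \<kappa> * norm x \<le> norm (\<kappa> *\<^sub>R x - \<i> *\<^sub>C A x)"
    and "\<exists>x\<in>D. \<kappa> *\<^sub>R x - \<i> *\<^sub>C A x = y"
proof -
  have D0: "0 \<in> D" and Dadd: "\<And>x y. x \<in> D \<Longrightarrow> y \<in> D \<Longrightarrow> x + y \<in> D" and Dscale: "\<And>c x. x \<in> D \<Longrightarrow> c *\<^sub>C x \<in> D"
    and Aadd: "\<And>x y. x \<in> D \<Longrightarrow> y \<in> D \<Longrightarrow> A (x + y) = A x + A y" and Ascale: "\<And>c x. x \<in> D \<Longrightarrow> A (c *\<^sub>C x) = c *\<^sub>C A x"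
    and adj: "adjoint_graph D A = operator_graph D A" and dense: "closure D = UNIV"
    using sa by (auto simp: selfadjoint_operator_def densely_defined_operator_def)
  have sym: "cinner (A x) y = cinner x (A y)" if "x \<in> D" "y \<in> D" for x y
  proof -
    have "(y, A y) \<in> adjoint_graph D A" unfolding adj using that by (auto simp: operator_graph_def)
    then show ?thesis using that by (auto simp: adjoint_graph_def)
  qed
  have adjI: "y \<in> D \<and> A y = z" if "\<And>x. x \<in> D \<Longrightarrow> cinner (A x) y = cinner x z" for y z
  proof -
    have "(y, z) \<in> adjoint_graph D A" using that by (auto simp: adjoint_graph_def)
    then show ?thesis unfolding adj by (auto simp: operator_graph_def)
  qed
  define T where "T x = \<kappa> *\<^sub>R x - \<i> *\<^sub>C A x" for x
  have bound: "\<kappa> * norm x \<le> norm (T x)" if x: "x \<in> D" for x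
  proof -
    have "cnj (cinner x (A x)) = cinner x (A x)" using sym[OF x x] cinner_commute[of "A x" x] by simp
    then have im: "Im (cinner x (A x)) = 0" by (auto simp: complex_eq_iff)
    have "Re (cinner (\<kappa> *\<^sub>R x) (\<i> *\<^sub>C A x)) = 0"
      using im by (simp add: scaleC_of_real[symmetric] cinner_scaleC_left cinner_scaleC_right)
    then have "(norm (T x))\<^sup>2 = (norm (\<kappa> *\<^sub>R x))\<^sup>2 + (norm (\<i> *\<^sub>C A x))\<^sup>2"
      unfolding T_def by (simp only: norm_diff_square)
    then have "(norm (\<kappa> *\<^sub>R x))\<^sup>2 \<le> (norm (T x))\<^sup>2" by simp
    then have "norm (\<kappa> *\<^sub>R x) \<le> norm (T x)" by (rule power2_le_imp_le) simp
    then show ?thesis using k by simp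
  qed
  then show "x \<in> D \<Longrightarrow> \<kappa> * norm x \<le> norm (\<kappa> *\<^sub>R x - \<i> *\<^sub>C A x)" by (simp add: T_def)
  have Dscaler: "r *\<^sub>R x \<in> D" if "x \<in> D" for r x using Dscale[OF that, of "complex_of_real r"] by (simp add: scaleC_of_real)
  have Ddiff: "x - y \<in> D" if "x \<in> D" "y \<in> D" for x y
    using Dadd[OF that(1) Dscale[OF that(2), of "-1"]] by (simp add: scaleC_minus_one)
  have Adiff: "A (x - y) = A x - A y" if "x \<in> D" "y \<in> D" for x y
    using Aadd[OF that(1) Dscale[OF that(2), of "-1"]] Ascale[OF that(2), of "-1"] by (simp add: scaleC_minus_one)
  have scaleC_minus: "c *\<^sub>C (- x) = - (c *\<^sub>C x)" for c and x :: 'a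
    using scaleC_scaleC[of c "-1" x] scaleC_scaleC[of "-1" c x] by (simp add: scaleC_minus_one)
  have scaleC_diff: "c *\<^sub>C (x - y) = c *\<^sub>C x - c *\<^sub>C y" for c and x y :: 'a
    using scaleC_add_right[of c x "- y"] by (simp add: scaleC_minus)
  have scaleC_R: "c *\<^sub>C (r *\<^sub>R x) = r *\<^sub>R (c *\<^sub>C x)" for c r and x :: 'a
    by (simp add: scaleC_of_real[symmetric] scaleC_scaleC mult.commute)
  have Tadd: "T (x + y) = T x + T y" if "x \<in> D" "y \<in> D" for x y
    by (simp add: T_def Aadd that scaleC_add_right scaleR_right_distrib)
  have Tdiff: "T (x - y) = T x - T y" if "x \<in> D" "y \<in> D" for x y
    by (simp add: T_def Adiff that scaleC_diff scaleR_right_diff_distrib)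
  have Tscale: "T (c *\<^sub>C x) = c *\<^sub>C T x" if "x \<in> D" for x c
    by (simp add: T_def Ascale that scaleC_diff scaleC_R scaleC_scaleC mult.commute)
  have scaleC_0: "c *\<^sub>C 0 = (0 :: 'a)" for c using scaleC_add_right[of c 0 0] by simp
  have T0: "T 0 = 0" using Tdiff[OF D0 D0] by simp
  have cl: "closed (T ` D)"
    unfolding closed_sequential_limits
  proof (intro allI impI)
    fix f and l assume f: "(\<forall>n. f n \<in> T ` D) \<and> f \<longlonglongrightarrow> l"
    then have "\<forall>n. \<exists>x. x \<in> D \<and> T x = f n" by (auto simp: image_iff) (metis)
    then obtain x where xD: "\<And>n. x n \<in> D" and Tx: "\<And>n. T (x n) = f n" by metis
    have "Cauchy x"
    proof (rule CauchyI)
      fix e :: real assume e: "0 < e"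
      have "Cauchy f" using f LIMSEQ_imp_Cauchy by blast
      then obtain M where M: "\<And>m n. M \<le> m \<Longrightarrow> M \<le> n \<Longrightarrow> norm (f m - f n) < \<kappa> * e"
        using CauchyD[of f "\<kappa> * e"] k e by (metis mult_pos_pos)
      have "norm (x m - x n) < e" if "M \<le> m" "M \<le> n" for m n
      proof -
        have "\<kappa> * norm (x m - x n) \<le> norm (T (x m - x n))" by (intro bound Ddiff xD)
        also have "\<dots> < \<kappa> * e" using M[OF that] by (simp add: Tdiff xD Tx)
        finally show ?thesis using k by simp
      qed
      then show "\<exists>M. \<forall>m\<ge>M. \<forall>n\<ge>M. norm (x m - x n) < e" by blast
    qed
    then obtain z where z: "x \<longlonglongrightarrow> z" using Cauchy_convergent convergent_def by blast
    have sclim: "(\<lambda>n. c *\<^sub>C g n) \<longlonglongrightarrow> c *\<^sub>C a" if "g \<longlonglongrightarrow> a" for c g and a :: 'a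
    proof -
      have "(\<lambda>n. norm (c *\<^sub>C g n - c *\<^sub>C a)) \<longlonglongrightarrow> cmod c * 0"
        unfolding scaleC_diff[symmetric] norm_scaleC
        by (intro tendsto_intros) (use that in \<open>simp add: LIM_zero tendsto_norm_zero\<close>)
      then show ?thesis by (simp add: LIM_zero_cancel tendsto_norm_zero_iff)
    qed
    define a where "a = (- \<i>) *\<^sub>C (\<kappa> *\<^sub>R z - l)"
    have Ax: "A (x n) = (- \<i>) *\<^sub>C (\<kappa> *\<^sub>R x n - f n)" for n
    proof -
      have "\<kappa> *\<^sub>R x n - f n = \<i> *\<^sub>C A (x n)" by (simp add: T_def flip: Tx)
      then show ?thesis using scaleC_of_real[of 1 "A (x n)"] by (simp add: scaleC_scaleC)
    qed
    have Alim: "(\<lambda>n. A (x n)) \<longlonglongrightarrow> a"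
      unfolding Ax a_def using f z by (intro sclim tendsto_intros) auto
    have inlim: "(\<lambda>n. cinner v (g n)) \<longlonglongrightarrow> cinner v b" if g: "g \<longlonglongrightarrow> b" for v b and g :: "nat \<Rightarrow> 'a"
    proof -
      \<comment> \<open>Polarisation reduces the continuity of the inner product to that of the
        norm; the imaginary part is reached by multiplying the second argument by \<i>.\<close>
      have pol: "Re (cinner v u) = ((norm (v + u))\<^sup>2 - (norm (v - u))\<^sup>2) / 4" for u :: 'a
        by (simp add: norm_add_square norm_diff_square)
      have re: "(\<lambda>n. Re (cinner v (g n))) \<longlonglongrightarrow> Re (cinner v b)" if "g \<longlonglongrightarrow> b" for g b
        unfolding pol by (intro tendsto_intros that) simp
      have im: "Im (cinner v u) = - Re (cinner v (\<i> *\<^sub>C u))" for u by (simp add: cinner_scaleC_right)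
      show ?thesis
        unfolding tendsto_complex_iff im by (intro conjI tendsto_minus re sclim g)
    qed
    \<comment> \<open>Closedness of A: the identity that defines the adjoint passes to the limit,
      and the adjoint is A.\<close>
    have "z \<in> D \<and> A z = a"
    proof (rule adjI)
      fix y assume y: "y \<in> D"
      have "(\<lambda>n. cinner (A y) (x n)) \<longlonglongrightarrow> cinner (A y) z" by (rule inlim[OF z])
      moreover have "(\<lambda>n. cinner y (A (x n))) \<longlonglongrightarrow> cinner y a" by (rule inlim[OF Alim])
      ultimately show "cinner (A y) z = cinner y a"
        using LIMSEQ_unique by (simp add: sym[OF y xD])
    qed
    then have "z \<in> D" "T z = l"
      using scaleC_of_real[of 1 "\<kappa> *\<^sub>R z - l"] by (auto simp: T_def a_def scaleC_scaleC)
    then show "l \<in> T ` D" by auto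
  qed
  show "\<exists>x\<in>D. \<kappa> *\<^sub>R x - \<i> *\<^sub>C A x = y"
  proof (rule ccontr)
    assume "\<not> ?thesis"
    then have y: "y \<notin> T ` D" by (auto simp: T_def image_iff)
    obtain z where z: "z \<noteq> 0" "\<And>x. x \<in> T ` D \<Longrightarrow> cinner x z = 0"
    proof (rule closed_subspace_orthogonal[OF cl _ _ _ y])
      show "0 \<in> T ` D" using T0 D0 by force
      show "a + b \<in> T ` D" if "a \<in> T ` D" "b \<in> T ` D" for a b using that Tadd Dadd by (force simp flip: Tadd)
      show "c *\<^sub>C a \<in> T ` D" if "a \<in> T ` D" for a c using that Dscale by (force simp flip: Tscale)
    qed blast
    have "z \<in> D \<and> A z = (\<i> * complex_of_real \<kappa>) *\<^sub>C z"
    proof (rule adjI)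
      fix x assume x: "x \<in> D"
      have "cinner (T x) z = 0" using x z(2) by auto
      then have "complex_of_real \<kappa> * cinner x z + \<i> * cinner (A x) z = 0"
        by (simp add: T_def cinner_diff_left scaleC_of_real[symmetric] cinner_scaleC_left)
      then have "\<i> * (complex_of_real \<kappa> * cinner x z + \<i> * cinner (A x) z) = 0" by simp
      then have "cinner (A x) z = \<i> * complex_of_real \<kappa> * cinner x z" by (simp add: algebra_simps)
      then show "cinner (A x) z = cinner x ((\<i> * complex_of_real \<kappa>) *\<^sub>C z)"
        by (simp add: cinner_scaleC_right)
    qed
    then have "T z = \<kappa> *\<^sub>R z + \<kappa> *\<^sub>R z" "z \<in> D"
      using scaleC_of_real[of "- \<kappa>" z] by (auto simp: T_def scaleC_scaleC)
    then have "cinner (\<kappa> *\<^sub>R z + \<kappa> *\<^sub>R z) z = 0" using z(2) by force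
    then have "2 * complex_of_real \<kappa> * cinner z z = 0"
      by (simp add: cinner_add_left scaleC_of_real[symmetric] cinner_scaleC_left)
    then show False using z(1) k by (simp add: cinner_self)
  qed
qed

section \<open>Fractional evolution equations with m-dissipative operators\<close>

text \<open>With a common Lipschitz constant, smallness at the points of a finite net spreads to the
  whole compact set. It is applied to the errors of smoothing operators on the set formed by the
  initial value and the values of the forcing.\<close>

lemma tendsto_0_uniform_on_compact:
  fixes S :: "nat \<Rightarrow> 'a::real_normed_vector \<Rightarrow> 'b::real_normed_vector"
  assumes C: "compact C" and lip: "\<And>n y z. norm (S n y - S n z) \<le> L * norm (y - z)"
    and lim: "\<And>y. (\<lambda>n. S n y) \<longlonglongrightarrow> 0" and e: "0 < e"
  shows "\<forall>\<^sub>F n in sequentially. \<forall>y\<in>C. norm (S n y) < e"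
proof -
  define d where "d = e / (2 * (\<bar>L\<bar> + 1))"
  have d: "0 < d" and dL: "\<bar>L\<bar> * d < e / 2"
    using e by (auto simp: d_def field_simps intro!: divide_pos_pos)
  obtain N where N: "finite N" "C \<subseteq> (\<Union>y\<in>N. ball y d)"
    using compact_imp_seq_compact[OF C] seq_compact_imp_totally_bounded[of C] d by metis
  have "\<forall>\<^sub>F n in sequentially. norm (S n y) < e / 2" for y
    using order_tendstoD(2)[OF tendsto_norm_zero[OF lim], of "e / 2" y] e by simp
  then have "\<forall>\<^sub>F n in sequentially. \<forall>y\<in>N. norm (S n y) < e / 2"
    using N(1) by (simp add: eventually_ball_finite)
  then show ?thesis
  proof eventually_elim
    case (elim n)
    show ?case
    proof
      fix z assume "z \<in> C"
      then obtain y where y: "y \<in> N" "dist y z < d" using N(2) by auto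
      have "norm (S n z - S n y) \<le> \<bar>L\<bar> * norm (z - y)"
        using lip[of n z y] mult_right_mono[OF abs_ge_self norm_ge_zero, of L "z - y"] by linarith
      also have "\<dots> \<le> \<bar>L\<bar> * d"
        using y(2) by (intro mult_left_mono) (auto simp: dist_norm norm_minus_commute)
      finally have "norm (S n z - S n y) < e / 2" using dL by simp
      moreover have "norm (S n y) < e / 2" using elim y by auto
      ultimately show "norm (S n z) < e"
        using norm_triangle_ineq[of "S n z - S n y" "S n y"] by simp
    qed
  qed
qed

text \<open>Once the resolvent of \<i> A is known, complex scalars and the inner product disappear
  until the final theorem: a real Banach space carries the whole evolution theory.\<close>

locale m_dissipative =
  fixes D :: "'a::{banach, second_countable_topology} set" and B :: "'a \<Rightarrow> 'a" and \<alpha> :: real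
  assumes alpha: "0 < \<alpha>" "\<alpha> < 1"
    and subspace: "subspace D"
    and B_add: "x \<in> D \<Longrightarrow> y \<in> D \<Longrightarrow> B (x + y) = B x + B y"
    and B_scaleR: "x \<in> D \<Longrightarrow> B (c *\<^sub>R x) = c *\<^sub>R B x"
    and dissipative: "x \<in> D \<Longrightarrow> 0 < \<kappa> \<Longrightarrow> \<kappa> * norm x \<le> norm (\<kappa> *\<^sub>R x - B x)"
    and range: "0 < \<kappa> \<Longrightarrow> \<exists>x\<in>D. \<kappa> *\<^sub>R x - B x = y"
    and dense: "closure D = UNIV"
begin

abbreviation "I\<^sub>\<alpha> \<equiv> convolution (g_kernel \<alpha>)"

section \<open>Resolvents and Yosida approximations\<close>

lemma B_diff: "x \<in> D \<Longrightarrow> y \<in> D \<Longrightarrow> B (x - y) = B x - B y"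
  using B_add[of x "(-1) *\<^sub>R y"] B_scaleR[of y "-1"] subspace_scale[OF subspace, of y "-1"] by simp

lemma resolvent_unique:
  assumes "0 < l" "x \<in> D" "y \<in> D" "l *\<^sub>R x - B x = l *\<^sub>R y - B y"
  shows "x = y"
proof -
  have "l * norm (x - y) \<le> norm (l *\<^sub>R (x - y) - B (x - y))"
    using assms subspace_diff[OF subspace] by (intro dissipative) auto
  also have "l *\<^sub>R (x - y) - B (x - y) = (l *\<^sub>R x - B x) - (l *\<^sub>R y - B y)"
    by (simp add: B_diff[OF assms(2,3)] scaleR_right_diff_distrib)
  also have "\<dots> = 0" using assms(4) by simp
  finally show ?thesis using assms(1) by (simp add: mult_le_0_iff)
qed

text \<open>The resolvent \<open>(1 - B/l)\<^sup>-\<^sup>1\<close>, meaningful only for \<open>l > 0\<close>.\<close>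

definition J :: "real \<Rightarrow> 'a \<Rightarrow> 'a" where
  "J l y = (THE x. x \<in> D \<and> l *\<^sub>R x - B x = l *\<^sub>R y)"

text \<open>The Yosida approximation B J_l (see \<open>B_J\<close>), written without B so that its
  boundedness is evident.\<close>

definition yosida :: "real \<Rightarrow> 'a \<Rightarrow> 'a" where
  "yosida l y = l *\<^sub>R (J l y - y)"

context
  fixes l :: real
  assumes l: "0 < l"
begin

lemma J_props: "J l y \<in> D" "l *\<^sub>R J l y - B (J l y) = l *\<^sub>R y"
proof -
  have "\<exists>!x. x \<in> D \<and> l *\<^sub>R x - B x = l *\<^sub>R y"
    using range[OF l, of "l *\<^sub>R y"] resolvent_unique[OF l] by metis
  from theI'[OF this] show "J l y \<in> D" "l *\<^sub>R J l y - B (J l y) = l *\<^sub>R y"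
    by (auto simp: J_def)
qed

lemma J_eqI: "x \<in> D \<Longrightarrow> l *\<^sub>R x - B x = l *\<^sub>R y \<Longrightarrow> J l y = x"
  using J_props[of y] resolvent_unique[OF l] by metis

lemma B_J: "B (J l y) = yosida l y"
  using J_props(2)[of y] by (simp add: yosida_def algebra_simps)

lemma norm_J_le: "norm (J l y) \<le> norm y"
proof -
  have "l * norm (J l y) \<le> l * norm y"
    using dissipative[OF J_props(1) l, of y] l by (simp add: J_props)
  then show ?thesis using l by simp
qed

lemma bounded_linear_J: "bounded_linear (J l)"
proof (rule bounded_linear_intro[where K = 1])
  fix y z :: 'a and c :: real
  show "J l (y + z) = J l y + J l z"
    using J_props[of y] J_props[of z] subspace
    by (intro J_eqI) (auto simp: subspace_add B_add scaleR_right_distrib add_diff_add)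
  show "J l (c *\<^sub>R y) = c *\<^sub>R J l y"
  proof (rule J_eqI)
    have "l *\<^sub>R c *\<^sub>R J l y - B (c *\<^sub>R J l y) = c *\<^sub>R (l *\<^sub>R J l y - B (J l y))"
      by (simp add: B_scaleR J_props(1) scaleR_right_diff_distrib mult.commute)
    then show "l *\<^sub>R c *\<^sub>R J l y - B (c *\<^sub>R J l y) = l *\<^sub>R c *\<^sub>R y"
      by (simp add: J_props mult.commute)
  qed (use J_props subspace in \<open>auto simp: subspace_scale\<close>)
qed (simp add: norm_J_le)

lemma J_diff: "J l (y - z) = J l y - J l z" and J_scaleR: "J l (c *\<^sub>R y) = c *\<^sub>R J l y"
  using bounded_linear_J by (auto simp: linear_diff linear_scale bounded_linear.linear)

lemma J_B:
  assumes y: "y \<in> D" shows "J l (B y) = yosida l y"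
proof -
  have "J l (y - inverse l *\<^sub>R B y) = y"
    by (rule J_eqI[OF y]) (use l in \<open>simp add: scaleR_right_diff_distrib\<close>)
  then have "inverse l *\<^sub>R J l (B y) = J l y - y"
    by (simp add: J_diff J_scaleR algebra_simps)
  then have "l *\<^sub>R inverse l *\<^sub>R J l (B y) = l *\<^sub>R (J l y - y)" by simp
  then show ?thesis using l by (simp add: yosida_def)
qed

lemma bounded_linear_yosida: "bounded_linear (yosida l)"
  unfolding yosida_def[abs_def]
  by (intro bounded_linear_scaleR_right[THEN bounded_linear_compose] bounded_linear_sub
      bounded_linear_J bounded_linear_ident)

lemma yosida_diff: "yosida l (y - z) = yosida l y - yosida l z"
  using bounded_linear_yosida by (simp add: linear_diff bounded_linear.linear)

lemma norm_yosida_le: "norm (yosida l y) \<le> 2 * l * norm y"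
proof -
  have "norm (J l y - y) \<le> norm (J l y) + norm y" by (rule norm_triangle_ineq4)
  also have "\<dots> \<le> 2 * norm y" using norm_J_le[of y] by simp
  finally have "l * norm (J l y - y) \<le> l * (2 * norm y)" using l by (intro mult_left_mono) auto
  then show ?thesis using l by (simp add: yosida_def)
qed

text \<open>Adding l J_l y to \<kappa> y - B_l y gives (\<kappa> + l) y, and J_l is a contraction,
  so at most l |y| is lost.\<close>

lemma yosida_dissipative:
  assumes "0 < \<kappa>" shows "\<kappa> * norm y \<le> norm (\<kappa> *\<^sub>R y - yosida l y)"
proof -
  have "(\<kappa> + l) * norm y = norm ((\<kappa> *\<^sub>R y - yosida l y) + l *\<^sub>R J l y)"
    using assms l by (simp add: yosida_def algebra_simps flip: scaleR_left_distrib)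
  also have "\<dots> \<le> norm (\<kappa> *\<^sub>R y - yosida l y) + l * norm (J l y)"
    using norm_triangle_ineq[of "\<kappa> *\<^sub>R y - yosida l y" "l *\<^sub>R J l y"] l by simp
  also have "\<dots> \<le> norm (\<kappa> *\<^sub>R y - yosida l y) + l * norm y"
    using norm_J_le[of y] l by simp
  finally show ?thesis by (simp add: algebra_simps)
qed

lemma J_near: "y \<in> D \<Longrightarrow> norm (J l y - y) \<le> norm (B y) / l"
proof -
  assume y: "y \<in> D"
  have "l * norm (J l y - y) = norm (J l (B y))" using l by (simp add: J_B[OF y] yosida_def)
  also have "\<dots> \<le> norm (B y)" by (rule norm_J_le)
  finally show ?thesis using l by (simp add: field_simps)
qed

end

text \<open>On D the operators B and J_l commute, so applying J_l to (m - B) J_m y = m y shows that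
  J_l J_m y solves the equation characterising J_m J_l y.\<close>

lemma J_commute:
  assumes l: "0 < l" and m: "0 < m"
  shows "J l (J m y) = J m (J l y)"
proof -
  let ?x = "J m y"
  have "J l (m *\<^sub>R ?x - B ?x) = J l (m *\<^sub>R y)" using J_props[OF m] by simp
  then have "m *\<^sub>R J l ?x - B (J l ?x) = m *\<^sub>R J l y"
    by (simp add: J_diff[OF l] J_scaleR[OF l] J_B[OF l J_props(1)[OF m]] B_J[OF l])
  then show ?thesis by (intro J_eqI[OF m, symmetric] J_props(1)[OF l])
qed

lemma J_yosida: "0 < l \<Longrightarrow> 0 < m \<Longrightarrow> J l (yosida m y) = yosida m (J l y)"
  by (simp add: yosida_def J_scaleR J_diff J_commute[of l m])

text \<open>On D the error is at most |B y|/l; density and the contraction property of J_l extend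
  the convergence to all y.\<close>

lemma J_tendsto: "(\<lambda>n. J (real (Suc n)) y) \<longlonglongrightarrow> y"
proof (rule LIMSEQ_I)
  fix r :: real assume r: "0 < r"
  obtain z where z: "z \<in> D" "dist z y < r / 4"
    using dense closure_approachable[of y D] r by (metis UNIV_I divide_pos_pos zero_less_numeral)
  obtain N :: nat where N: "norm (B z) / (r / 4) < real N" using reals_Archimedean2 by blast
  have "norm (J (real (Suc n)) y - y) < r" if n: "n \<ge> N" for n
  proof -
    let ?l = "real (Suc n)"
    have l: "0 < ?l" by simp
    have "norm (B z) / (r / 4) < ?l" using N n by simp
    then have "norm (B z) / ?l < r / 4" using r by (simp add: field_simps)
    then have 1: "norm (J ?l z - z) < r / 4" using J_near[OF l z(1)] by linarith
    have 2: "norm (J ?l (y - z)) \<le> norm (y - z)" by (rule norm_J_le[OF l])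
    have 3: "norm (y - z) < r / 4" using z(2) by (simp add: dist_norm norm_minus_commute)
    have "J ?l y - y = J ?l (y - z) + (J ?l z - z) - (y - z)"
      using J_diff[OF l, of y z] by (simp del: of_nat_Suc)
    also have "norm \<dots> \<le> norm (J ?l (y - z)) + norm (J ?l z - z) + norm (y - z)"
      by (intro order.trans[OF norm_triangle_ineq4] add_right_mono norm_triangle_ineq)
    finally show ?thesis using 1 2 3 r by linarith
  qed
  then show "\<exists>N. \<forall>n\<ge>N. norm (J (real (Suc n)) y - y) < r" by blast
qed

section \<open>The linear equation with B replaced by its Yosida approximations\<close>

definition yosida_solution :: "real \<Rightarrow> 'a \<Rightarrow> (real \<Rightarrow> 'a) \<Rightarrow> (real \<Rightarrow> 'a) \<Rightarrow> bool" where
  "yosida_solution l x f v \<longleftrightarrow> continuous_on {0..} v \<and>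
     (\<forall>t\<ge>0. v t = x + I\<^sub>\<alpha> (\<lambda>s. yosida l (v s) + f s) t)"

lemma yosida_continuous:
  "0 < l \<Longrightarrow> continuous_on S v \<Longrightarrow> continuous_on S (\<lambda>s. yosida l (v s))"
  by (rule bounded_linear.continuous_on[OF bounded_linear_yosida])

lemma J_continuous:
  "0 < l \<Longrightarrow> continuous_on S v \<Longrightarrow> continuous_on S (\<lambda>s. J l (v s))"
  by (rule bounded_linear.continuous_on[OF bounded_linear_J])

lemmas kernel_facts = loc_integrable_g_kernel[OF alpha(1)] g_kernel_nonneg[OF alpha(1)]

lemma yosida_solution_exists:
  assumes l: "0 < l" and f: "continuous_on {0..} f"
  obtains v where "yosida_solution l x f v"
proof -
  let ?\<Phi> = "\<lambda>v t. x + I\<^sub>\<alpha> (\<lambda>s. yosida l (v s) + f s) t"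
  have cont: "continuous_on {0..} (\<lambda>s. yosida l (v s) + f s)" if "continuous_on {0..} v" for v
    by (intro continuous_intros yosida_continuous l f that)
  obtain v where "continuous_on {0..} v" "\<And>t. 0 \<le> t \<Longrightarrow> ?\<Phi> v t = v t"
  proof (rule causal_picard[of \<alpha> UNIV x ?\<Phi> "\<lambda>_. 2 * l"])
    fix u v :: "real \<Rightarrow> 'a" and t T :: real
    assume u: "continuous_on {0..} u" and v: "continuous_on {0..} v"
    have "?\<Phi> u t - ?\<Phi> v t = I\<^sub>\<alpha> (\<lambda>s. yosida l (u s) + f s - (yosida l (v s) + f s)) t"
      by (subst convolution_diff[OF _ cont[OF u] cont[OF v]]) (simp_all add: kernel_facts)
    also have "\<dots> = I\<^sub>\<alpha> (\<lambda>s. yosida l (u s - v s)) t"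
      by (simp add: yosida_diff[OF l])
    also have "norm \<dots> \<le> I\<^sub>\<alpha> (\<lambda>s. norm (yosida l (u s - v s))) t"
      by (rule norm_convolution_le) (rule kernel_facts)
    also have "\<dots> \<le> I\<^sub>\<alpha> (\<lambda>s. (2 * l) *\<^sub>R norm (u s - v s)) t"
      using norm_yosida_le[OF l]
      by (intro convolution_mono kernel_facts continuous_intros yosida_continuous l u v) auto
    finally show "norm (?\<Phi> u t - ?\<Phi> v t) \<le> 2 * l * I\<^sub>\<alpha> (\<lambda>s. norm (u s - v s)) t"
      unfolding convolution_scaleR by simp
  next
    fix u :: "real \<Rightarrow> 'a" assume "continuous_on {0..} u"
    then show "continuous_on {0..} (?\<Phi> u)"
      by (intro continuous_intros convolution_continuous kernel_facts cont)
  qed (use l alpha in auto)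
  then show thesis by (intro that) (auto simp: yosida_solution_def)
qed

text \<open>The difference solves the equation for \<open>yosida l\<close> alone, with the
  discrepancy of the two approximations moved into the forcing. That discrepancy is evaluated on
  \<open>v\<close> only, so regularity of one of the two solutions is enough to make it
  small.\<close>

lemma yosida_solution_difference:
  assumes l: "0 < l" and m: "0 < m" and f: "continuous_on {0..} f" and g: "continuous_on {0..} g"
    and u: "yosida_solution l x f u" and v: "yosida_solution m y g v" and t: "0 \<le> t"
  shows "norm (u t - v t) \<le> norm (x - y) +
    I\<^sub>\<alpha> (\<lambda>s. norm (f s - g s + (yosida l (v s) - yosida m (v s)))) t"
proof -
  have uc: "continuous_on {0..} u" and vc: "continuous_on {0..} v"
    using u v by (auto simp: yosida_solution_def)
  show ?thesis
  proof (rule dissipative_estimate[OF alpha])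
    show "continuous_on {0..} (\<lambda>s. (yosida l (u s) + f s) - (yosida m (v s) + g s))"
      and "continuous_on {0..} (\<lambda>s. f s - g s + (yosida l (v s) - yosida m (v s)))"
      by (intro continuous_intros yosida_continuous uc vc f g l m)+
    show "u t - v t = (x - y) + I\<^sub>\<alpha> (\<lambda>s. (yosida l (u s) + f s) - (yosida m (v s) + g s)) t"
      if "0 \<le> t" for t
      using that u v
      by (subst convolution_diff)
        (auto simp: yosida_solution_def intro!: kernel_facts continuous_intros yosida_continuous uc vc f g l m)
    show "\<kappa> * norm (u t - v t) \<le> norm (\<kappa> *\<^sub>R (u t - v t) - (yosida l (u t) + f t - (yosida m (v t) + g t)
          - (f t - g t + (yosida l (v t) - yosida m (v t)))))" if "0 < \<kappa>" for t \<kappa>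
      using yosida_dissipative[OF l that, of "u t - v t"] by (simp add: yosida_diff[OF l] algebra_simps)
  qed (rule t)
qed

lemma yosida_solution_estimate:
  assumes l: "0 < l" and f: "continuous_on {0..} f" and u: "yosida_solution l x f u" and t: "0 \<le> t"
  shows "norm (u t) \<le> norm x + I\<^sub>\<alpha> (\<lambda>s. norm (f s)) t"
proof -
  have "yosida l 0 = 0" using yosida_diff[OF l, of 0 0] by simp
  moreover from this have "yosida_solution l 0 (\<lambda>_. 0) (\<lambda>_. 0)"
    by (simp add: yosida_solution_def convolution_def)
  ultimately show ?thesis using yosida_solution_difference[OF l l f _ u _ t, of "\<lambda>_. 0" 0 "\<lambda>_. 0"] by simp
qed

lemma yosida_solution_map:
  assumes l: "0 < l" and f: "continuous_on {0..} f" and u: "yosida_solution l x f u"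
    and S: "bounded_linear S" "\<And>y. S (yosida l y) = yosida l (S y)"
  shows "yosida_solution l (S x) (\<lambda>s. S (f s)) (\<lambda>s. S (u s))"
proof -
  interpret S: bounded_linear S by fact
  have uc: "continuous_on {0..} u" using u by (auto simp: yosida_solution_def)
  have "S (I\<^sub>\<alpha> (\<lambda>s. yosida l (u s) + f s) t)
      = I\<^sub>\<alpha> (\<lambda>s. yosida l (S (u s)) + S (f s)) t" for t
    by (subst convolution_bounded_linear[OF S(1)])
       (auto simp: S.add S(2) intro!: kernel_facts continuous_intros yosida_continuous l uc f)
  then show ?thesis
    using u S.continuous_on[OF uc] by (auto simp: yosida_solution_def S.add)
qed

text \<open>Put z = B J_k J_k y = J_k B_k y, which lies in D. Then B_l J_k J_k y = J_l z, whose
  distance from z is at most |B z|/l. Since B z = B_k B_k y and B_k has norm at most 2 k, the factor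
  4 k^2 results.\<close>

lemma yosida_JJ_Cauchy:
  assumes k: "0 < k" and l: "0 < l" and m: "0 < m"
  shows "norm (yosida l (J k (J k y)) - yosida m (J k (J k y))) \<le> 4 * k\<^sup>2 * (1 / l + 1 / m) * norm y"
proof -
  let ?z = "J k (yosida k y)"
  have Bz: "norm (B ?z) \<le> 4 * k\<^sup>2 * norm y"
  proof -
    have "norm (B ?z) \<le> 2 * k * norm (yosida k y)" by (simp add: B_J[OF k] norm_yosida_le[OF k])
    also have "\<dots> \<le> 2 * k * (2 * k * norm y)" using k norm_yosida_le[OF k, of y] by (intro mult_left_mono) auto
    finally show ?thesis by (simp add: power2_eq_square)
  qed
  have eq: "yosida l (J k (J k y)) = J l ?z" if "0 < l" for l
    using J_B[OF that J_props(1)[OF k], of "J k y"] by (simp add: B_J[OF k] J_yosida[OF k k])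
  have near: "norm (J l ?z - ?z) \<le> 4 * k\<^sup>2 * norm y / l" if "0 < l" for l
    using J_near[OF that J_props(1)[OF k], of "yosida k y"] divide_right_mono[OF Bz, of l] that by linarith
  have "norm (J l ?z - J m ?z) \<le> norm (J l ?z - ?z) + norm (J m ?z - ?z)"
    using norm_triangle_ineq4[of "J l ?z - ?z" "J m ?z - ?z"] by simp
  also have "\<dots> \<le> 4 * k\<^sup>2 * norm y / l + 4 * k\<^sup>2 * norm y / m"
    by (intro add_mono near l m)
  finally show ?thesis by (simp add: eq[OF l] eq[OF m] field_simps)
qed

lemma convolution_const_le:
  assumes "\<And>s. 0 \<le> s \<Longrightarrow> s \<le> t \<Longrightarrow> f s \<le> c" "continuous_on {0..} f" "0 \<le> c" "t \<le> T"
  shows "I\<^sub>\<alpha> f t \<le> (LINT s:{0..T}|lborel. g_kernel \<alpha> s) * c"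
proof -
  have "I\<^sub>\<alpha> f t \<le> I\<^sub>\<alpha> (\<lambda>_. c) t"
    using assms by (intro convolution_mono kernel_facts) auto
  also have "\<dots> = (LINT s:{0..t}|lborel. g_kernel \<alpha> s) * c"
    by (simp add: convolution_const kernel_facts)
  also have "\<dots> \<le> (LINT s:{0..T}|lborel. g_kernel \<alpha> s) * c"
  proof (intro mult_right_mono assms(3))
    show "(LINT s:{0..t}|lborel. g_kernel \<alpha> s) \<le> (LINT s:{0..T}|lborel. g_kernel \<alpha> s)"
      unfolding set_lebesgue_integral_def
      using loc_integrableD(2)[OF kernel_facts(1)] assms(4)
      by (intro integral_mono) (auto simp: set_integrable_def indicator_def kernel_facts)
  qed
  finally show ?thesis .
qed

lemma kernel_mass_nonneg: "0 \<le> (LINT s:{0..T}|lborel. g_kernel \<alpha> s)"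
  unfolding set_lebesgue_integral_def by (intro integral_nonneg_AE AE_I2) (auto simp: kernel_facts)

text \<open>The initial value is an arbitrary vector, so the Yosida approximations need not converge
  along the solutions. The remedy is to smooth by K_k = J_k J_k, which commutes with all of them,
  and to split v_m - v_n into K_k (v_m - v_n) and the two smoothing errors K_k v - v. Each error
  solves its own Yosida equation with data K_k x - x and K_k f - f, which are small on a compact
  set; hence one k serves all n. With k fixed, the smoothed solutions are Cauchy by
  \<open>yosida_JJ_Cauchy\<close>.\<close>

lemma yosida_solutions_converge:
  assumes f: "continuous_on {0..} f" and v: "\<And>n. yosida_solution (real (Suc n)) x f (v n)"
  shows "uniformly_convergent_on {0..T} v"
proof (rule Cauchy_uniformly_convergent, unfold uniformly_Cauchy_on_def, intro allI impI)
  fix e :: real assume e: "0 < e"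
  let ?l = "\<lambda>n. real (Suc n)"
  have l: "0 < ?l n" for n by simp
  define A where "A = (LINT s:{0..T}|lborel. g_kernel \<alpha> s)"
  have A: "0 \<le> A" using kernel_mass_nonneg by (simp add: A_def)
  \<comment> \<open>The range of \<open>K n\<close> lies in \<open>D(B\<^sup>2)\<close>, where \<open>yosida l\<close> converges at the rate \<open>1/l\<close>.\<close>
  define K where "K n y = J (?l n) (J (?l n) y)" for n y
  have Kbl: "bounded_linear (K n)" for n
    unfolding K_def[abs_def] by (intro bounded_linear_compose[OF bounded_linear_J] bounded_linear_J l)
  have Kdiff: "K n (y - z) = K n y - K n z" for n y z
    using Kbl[of n] by (simp add: linear_diff bounded_linear.linear)
  have Knorm: "norm (K n y) \<le> norm y" for n y
    unfolding K_def using norm_J_le[OF l, of n] order.trans by blast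
  have Kyos: "K n (yosida (?l m) y) = yosida (?l m) (K n y)" for n m y
    unfolding K_def by (simp add: J_yosida[OF l l] del: of_nat_Suc)
  have Kcont: "continuous_on S (\<lambda>s. K n (g s))" if "continuous_on S g" for n S and g :: "real \<Rightarrow> 'a"
    by (rule bounded_linear.continuous_on[OF Kbl that])
  have Klim: "(\<lambda>n. K n y - y) \<longlonglongrightarrow> 0" for y
  proof (rule Lim_null_comparison)
    show "\<forall>\<^sub>F n in sequentially. norm (K n y - y) \<le> norm (J (?l n) y - y) + norm (J (?l n) y - y)"
    proof (rule always_eventually, rule allI)
      fix n
      have "K n y - y = J (?l n) (J (?l n) y - y) + (J (?l n) y - y)"
        by (simp add: K_def J_diff[OF l] del: of_nat_Suc)
      also have "norm \<dots> \<le> norm (J (?l n) (J (?l n) y - y)) + norm (J (?l n) y - y)"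
        by (rule norm_triangle_ineq)
      finally show "norm (K n y - y) \<le> norm (J (?l n) y - y) + norm (J (?l n) y - y)"
        using norm_J_le[OF l, of n "J (?l n) y - y"] by linarith
    qed
    have "(\<lambda>n. norm (J (?l n) y - y) + norm (J (?l n) y - y)) \<longlonglongrightarrow> norm (y - y) + norm (y - y)"
      by (intro tendsto_intros J_tendsto)
    then show "(\<lambda>n. norm (J (?l n) y - y) + norm (J (?l n) y - y)) \<longlonglongrightarrow> 0" by simp
  qed
  have Klip: "norm ((K n y - y) - (K n z - z)) \<le> 2 * norm (y - z)" for n y z
  proof -
    have "(K n y - y) - (K n z - z) = K n (y - z) - (y - z)" by (simp add: Kdiff)
    also have "norm \<dots> \<le> norm (K n (y - z)) + norm (y - z)" by (rule norm_triangle_ineq4)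
    finally show ?thesis using Knorm[of n "y - z"] by simp
  qed
  have vc: "continuous_on {0..} (v n)" for n using v by (auto simp: yosida_solution_def)
  \<comment> \<open>Initial value and forcing together contribute (1 + A) d, which is made equal to
    e/4.\<close>
  define d where "d = e / 4 / (1 + A)"
  have d: "0 < d" using e A by (simp add: d_def)
  have "compact (insert x (f ` {0..T}))"
    by (intro compact_insert compact_continuous_image continuous_on_subset[OF f]) auto
  from tendsto_0_uniform_on_compact[OF this Klip Klim d]
  obtain k where k: "norm (K k x - x) < d" "\<And>s. 0 \<le> s \<Longrightarrow> s \<le> T \<Longrightarrow> norm (K k (f s) - f s) < d"
    by (auto simp: eventually_sequentially)
  have near: "norm (K k (v n t) - v n t) \<le> e / 4" if t: "0 \<le> t" "t \<le> T" for n t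
  proof -
    have "norm (K k (v n t) - v n t) \<le> norm (K k x - x)
      + I\<^sub>\<alpha> (\<lambda>s. norm (K k (f s) - f s + (yosida (?l n) (v n s) - yosida (?l n) (v n s)))) t"
      by (intro yosida_solution_difference[OF l l _ f _ v t(1)] yosida_solution_map[OF l f v Kbl Kyos] Kcont f)
    also have "\<dots> \<le> d + A * d"
      unfolding A_def using t k d
      by (intro add_mono convolution_const_le) (auto intro!: continuous_intros Kcont f less_imp_le)
    also have "\<dots> = (1 + A) * d" by (simp add: algebra_simps)
    also have "\<dots> = e / 4"
    proof -
      have "1 + A \<noteq> 0" using A by simp
      then have "d * (1 + A) = e / 4" using nonzero_eq_divide_eq d_def by blast
      then show ?thesis by (simp only: mult.commute)
    qed
    finally show ?thesis .
  qed
  have "continuous_on {0..T} f" using f by (rule continuous_on_subset) auto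
  then obtain M0 where M0: "0 \<le> M0" "\<And>s. 0 \<le> s \<Longrightarrow> s \<le> T \<Longrightarrow> norm (f s) \<le> M0"
    using continuous_on_interval_bound by blast
  define M where "M = norm x + A * M0"
  have M: "0 \<le> M" using A M0 by (simp add: M_def)
  have vM: "norm (v n t) \<le> M" if t: "0 \<le> t" "t \<le> T" for n t
  proof -
    have "norm (v n t) \<le> norm x + I\<^sub>\<alpha> (\<lambda>s. norm (f s)) t"
      by (rule yosida_solution_estimate[OF l f v t(1)])
    also have "\<dots> \<le> M"
      unfolding M_def A_def using M0 t by (intro add_left_mono convolution_const_le continuous_intros f) auto
    finally show ?thesis .
  qed
  define q where "q n m = 4 * (?l k)\<^sup>2 * (1 / ?l n + 1 / ?l m) * M" for n m
  have q0: "0 \<le> q n m" for n m using M by (simp add: q_def)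
  have reg: "norm (K k (v n t) - K k (v m t)) \<le> A * q n m" if t: "0 \<le> t" "t \<le> T" for n m t
  proof -
    have "norm (K k (v n t) - K k (v m t)) \<le> norm (K k x - K k x) +
      I\<^sub>\<alpha> (\<lambda>s. norm (K k (f s) - K k (f s) + (yosida (?l n) (K k (v m s)) - yosida (?l m) (K k (v m s))))) t"
      by (intro yosida_solution_difference[OF l l _ _ _ _ t(1)] yosida_solution_map[OF l f v Kbl Kyos] Kcont f)
    also have "\<dots> = I\<^sub>\<alpha> (\<lambda>s. norm (yosida (?l n) (K k (v m s)) - yosida (?l m) (K k (v m s)))) t"
      by simp
    also have "\<dots> \<le> A * q n m"
      unfolding A_def
    proof (intro convolution_const_le t(2) q0 continuous_intros yosida_continuous Kcont vc l)
      fix s assume s: "0 \<le> s" "s \<le> t"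
      have "norm (yosida (?l n) (K k (v m s)) - yosida (?l m) (K k (v m s)))
          \<le> 4 * (?l k)\<^sup>2 * (1 / ?l n + 1 / ?l m) * norm (v m s)"
        unfolding K_def by (rule yosida_JJ_Cauchy[OF l l l])
      also have "\<dots> \<le> q n m"
        unfolding q_def using vM[of s m] s t by (intro mult_left_mono) auto
      finally show "norm (yosida (?l n) (K k (v m s)) - yosida (?l m) (K k (v m s))) \<le> q n m" .
    qed
    finally show ?thesis .
  qed
  obtain N :: nat where N: "A * (4 * (?l k)\<^sup>2 * 2 * M) / (e / 4) < real N" using reals_Archimedean2 by blast
  show "\<exists>N. \<forall>t\<in>{0..T}. \<forall>m\<ge>N. \<forall>n\<ge>N. dist (v m t) (v n t) < e"
  proof (intro exI[of _ N] ballI allI impI)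
    fix t m n assume t: "t \<in> {0..T}" and mn: "N \<le> m" "N \<le> n"
    have "1 / ?l m \<le> 1 / ?l N" "1 / ?l n \<le> 1 / ?l N" using mn by (auto intro!: divide_left_mono)
    then have "1 / ?l m + 1 / ?l n \<le> 2 / ?l N" by simp
    then have "A * q m n \<le> A * (4 * (?l k)\<^sup>2 * (2 / ?l N) * M)"
      unfolding q_def using A M by (intro mult_left_mono mult_right_mono) auto
    also have "\<dots> = A * (4 * (?l k)\<^sup>2 * 2 * M) / ?l N" by simp
    also have "\<dots> < e / 4"
    proof -
      have "A * (4 * (?l k)\<^sup>2 * 2 * M) < real N * (e / 4)" using N e by (simp only: pos_divide_less_eq)
      also have "\<dots> \<le> ?l N * (e / 4)" using e by (intro mult_right_mono) auto
      finally show ?thesis using e by (simp add: pos_divide_less_eq mult.commute del: of_nat_Suc)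
    qed
    finally have "norm (K k (v m t) - K k (v n t)) < e / 4" using reg[of t m n] t by simp
    moreover have "norm (K k (v m t) - v m t) \<le> e / 4" "norm (K k (v n t) - v n t) \<le> e / 4"
      using near[of t] t by auto
    moreover have "norm (v m t - v n t) \<le> norm (K k (v m t) - K k (v n t))
        + norm (K k (v m t) - v m t) + norm (K k (v n t) - v n t)"
    proof -
      have "v m t - v n t = ((K k (v m t) - K k (v n t)) - (K k (v m t) - v m t)) + (K k (v n t) - v n t)" by simp
      then show ?thesis
        by (metis (no_types, lifting) add_right_mono norm_triangle_ineq norm_triangle_ineq4 order.trans)
    qed
    ultimately show "dist (v m t) (v n t) < e" using e by (simp add: dist_norm)
  qed
qed

text \<open>The problem is solved for the formal unknown v = (1 - B) u, with data (1 - B) x and (1 -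
  B) f that are merely in the space, and u = J_1 V is recovered from the limit V. Thus u takes
  values in D, and B u = u - V is continuous.\<close>

theorem linear_solution:
  assumes x: "x \<in> D" and fD: "\<And>s. 0 \<le> s \<Longrightarrow> f s \<in> D"
    and f: "continuous_on {0..} f" and Bf: "continuous_on {0..} (\<lambda>s. B (f s))"
  obtains u where "continuous_on {0..} u" "\<And>t. 0 \<le> t \<Longrightarrow> u t \<in> D" "continuous_on {0..} (\<lambda>t. B (u t))"
    "\<And>t. 0 \<le> t \<Longrightarrow> u t = x + I\<^sub>\<alpha> (\<lambda>s. B (u s) + f s) t"
proof -
  let ?l = "\<lambda>n. real (Suc n)"
  have l: "0 < ?l n" for n by simp
  define y where "y = x - B x"
  define g where "g s = f s - B (f s)" for s
  have g: "continuous_on {0..} g" unfolding g_def by (intro continuous_intros f Bf)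
  have "\<exists>v. yosida_solution (?l n) y g v" for n
    using yosida_solution_exists[OF l g] by blast
  then obtain v where v: "\<And>n. yosida_solution (?l n) y g (v n)" by metis
  have vc: "continuous_on {0..} (v n)" for n using v by (auto simp: yosida_solution_def)
  define V where "V t = lim (\<lambda>n. v n t)" for t
  have ul: "uniform_limit {0..T} v V sequentially" for T
    using yosida_solutions_converge[OF g v, of T] unfolding V_def[abs_def] uniformly_convergent_uniform_limit_iff by simp
  have Vc: "continuous_on {0..} V"
    by (rule continuous_on_atLeast_0I, rule uniform_limit_theorem[OF _ ul])
       (auto intro!: always_eventually continuous_on_subset[OF vc])
  have lim: "(\<lambda>n. v n t) \<longlonglongrightarrow> V t" if "0 \<le> t" for t
    using tendsto_uniform_limitI[OF ul[of t], of t] that by simp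
  have one: "(0::real) < 1" by simp
  define u where "u t = J 1 (V t)" for t
  have uc: "continuous_on {0..} u" unfolding u_def by (intro J_continuous one Vc)
  have uD: "u t \<in> D" for t unfolding u_def by (rule J_props[OF one])
  have Bu: "B (u t) = u t - V t" for t unfolding u_def by (simp add: B_J[OF one] yosida_def)
  have Buc: "continuous_on {0..} (\<lambda>t. B (u t))" unfolding Bu by (intro continuous_intros uc Vc)
  have J1: "J 1 (z - B z) = z" if "z \<in> D" for z by (rule J_eqI[OF one that]) simp
  have sol: "u t = x + I\<^sub>\<alpha> (\<lambda>s. B (u s) + f s) t" if t: "0 \<le> t" for t
  proof -
    have "yosida_solution (?l n) (J 1 y) (\<lambda>s. J 1 (g s)) (\<lambda>s. J 1 (v n s))" for n
      by (rule yosida_solution_map[OF l g v bounded_linear_J[OF one] J_yosida[OF one l]])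
    then have A: "J 1 (v n t) = J 1 y + I\<^sub>\<alpha> (\<lambda>s. yosida (?l n) (J 1 (v n s)) + J 1 (g s)) t" for n
      using t by (auto simp: yosida_solution_def)
    have C: "I\<^sub>\<alpha> (\<lambda>s. yosida (?l n) (J 1 (v n s)) + J 1 (g s)) t
        = I\<^sub>\<alpha> (\<lambda>s. yosida (?l n) (J 1 (v n s)) + f s) t" for n
      by (intro convolution_cong) (simp add: g_def J1 fD)
    have y: "J 1 y = x" unfolding y_def by (rule J1[OF x])
    have eq: "J 1 (v n t) = x + I\<^sub>\<alpha> (\<lambda>s. yosida (?l n) (J 1 (v n s)) + f s) t" for n
      using A[of n] unfolding C y .
    have "continuous_on {0..t} g" using g by (rule continuous_on_subset) auto
    then obtain M0 where M0: "0 \<le> M0" "\<And>s. 0 \<le> s \<Longrightarrow> s \<le> t \<Longrightarrow> norm (g s) \<le> M0"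
      using continuous_on_interval_bound by blast
    have "continuous_on {0..t} f" using f by (rule continuous_on_subset) auto
    then obtain M1 where M1: "0 \<le> M1" "\<And>s. 0 \<le> s \<Longrightarrow> s \<le> t \<Longrightarrow> norm (f s) \<le> M1"
      using continuous_on_interval_bound by blast
    define M where "M = norm y + (LINT s:{0..t}|lborel. g_kernel \<alpha> s) * M0"
    have vM: "norm (v n s) \<le> M" if s: "0 \<le> s" "s \<le> t" for n s
    proof -
      have "norm (v n s) \<le> norm y + I\<^sub>\<alpha> (\<lambda>s. norm (g s)) s"
        by (rule yosida_solution_estimate[OF l g v s(1)])
      also have "\<dots> \<le> M"
        unfolding M_def using M0 s by (intro add_left_mono convolution_const_le continuous_intros g) auto
      finally show ?thesis .
    qed
    \<comment> \<open>While \<open>yosida l\<close> by itself is only bounded by 2 l, on the range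
      of J_1 it becomes J_l applied to a vector independent of l. This provides both the uniform
      bound and the limit under the convolution.\<close>
    have yJ: "yosida (?l n) (J 1 z) = J (?l n) (J 1 z - z)" for n z
      using J_B[OF l J_props(1)[OF one], of n z] by (simp add: B_J[OF one] yosida_def)
    have "(\<lambda>n. I\<^sub>\<alpha> (\<lambda>s. yosida (?l n) (J 1 (v n s)) + f s) t)
        \<longlonglongrightarrow> I\<^sub>\<alpha> (\<lambda>s. B (u s) + f s) t"
    proof (rule convolution_tendsto[where M = "2 * M + M1"])
      fix n s assume s: "0 \<le> s" "s \<le> t"
      have "norm (J 1 (v n s) - v n s) \<le> norm (J 1 (v n s)) + norm (v n s)" by (rule norm_triangle_ineq4)
      then have "norm (J (?l n) (J 1 (v n s) - v n s)) \<le> 2 * M"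
        using norm_J_le[OF l, of n "J 1 (v n s) - v n s"] norm_J_le[OF one, of "v n s"] vM[OF s, of n] by linarith
      then show "norm (yosida (?l n) (J 1 (v n s)) + f s) \<le> 2 * M + M1"
        unfolding yJ using M1(2)[OF s] norm_triangle_ineq[of "J (?l n) (J 1 (v n s) - v n s)" "f s"] by linarith
    next
      fix s assume s: "0 \<le> s" "s \<le> t"
      have z: "(\<lambda>n. J 1 (v n s) - v n s) \<longlonglongrightarrow> B (u s)"
        unfolding Bu unfolding u_def
        by (intro tendsto_intros lim s bounded_linear.tendsto[OF bounded_linear_J[OF one]])
      have "(\<lambda>n. J (?l n) (J 1 (v n s) - v n s - B (u s))) \<longlonglongrightarrow> 0"
      proof (rule Lim_null_comparison)
        show "\<forall>\<^sub>F n in sequentially. norm (J (?l n) (J 1 (v n s) - v n s - B (u s))) \<le> norm (J 1 (v n s) - v n s - B (u s))"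
          by (intro always_eventually allI norm_J_le l)
        show "(\<lambda>n. norm (J 1 (v n s) - v n s - B (u s))) \<longlonglongrightarrow> 0"
          using tendsto_norm[OF tendsto_diff[OF z tendsto_const, of "B (u s)"]] by simp
      qed
      from tendsto_add[OF tendsto_add[OF this J_tendsto[of "B (u s)"]] tendsto_const[of "f s"]]
      show "(\<lambda>n. yosida (?l n) (J 1 (v n s)) + f s) \<longlonglongrightarrow> B (u s) + f s"
        unfolding yJ by (simp add: J_diff[OF l] del: of_nat_Suc)
    next
      show "continuous_on {0..} (\<lambda>s. B (u s) + f s)" by (intro continuous_intros Buc f)
      show "continuous_on {0..} (\<lambda>s. yosida (?l n) (J 1 (v n s)) + f s)" for n
        by (intro continuous_on_add yosida_continuous J_continuous one l vc f)
    qed (rule kernel_facts)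
    then have "(\<lambda>n. J 1 (v n t)) \<longlonglongrightarrow> x + I\<^sub>\<alpha> (\<lambda>s. B (u s) + f s) t"
      unfolding eq by (intro tendsto_intros)
    moreover have "(\<lambda>n. J 1 (v n t)) \<longlonglongrightarrow> u t"
      unfolding u_def by (intro bounded_linear.tendsto[OF bounded_linear_J[OF one]] lim t)
    ultimately show ?thesis using LIMSEQ_unique by blast
  qed
  show thesis by (rule that[OF uc uD Buc sol])
qed

text \<open>The second bound is formally the first one applied to B u, but B u need not lie in D. It
  is proved for B_l u = J_l B u, which does lie in D and solves the equation with data B_l x and B_l
  f, both dominated by their images under B; then l tends to infinity.\<close>

lemma graph_estimate:
  assumes uD: "\<And>t. 0 \<le> t \<Longrightarrow> u t \<in> D" and u: "continuous_on {0..} u" and Bu: "continuous_on {0..} (\<lambda>t. B (u t))"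
    and fD: "\<And>t. 0 \<le> t \<Longrightarrow> f t \<in> D" and f: "continuous_on {0..} f" and Bf: "continuous_on {0..} (\<lambda>t. B (f t))"
    and x: "x \<in> D"
    and eq: "\<And>t. 0 \<le> t \<Longrightarrow> u t = x + I\<^sub>\<alpha> (\<lambda>s. B (u s) + f s) t"
    and t: "0 \<le> t"
  shows "norm (u t) \<le> norm x + I\<^sub>\<alpha> (\<lambda>s. norm (f s)) t"
    and "norm (B (u t)) \<le> norm (B x) + I\<^sub>\<alpha> (\<lambda>s. norm (B (f s))) t"
proof -
  show "norm (u t) \<le> norm x + I\<^sub>\<alpha> (\<lambda>s. norm (f s)) t"
    by (rule dissipative_estimate[OF alpha _ f eq _ t])
       (use uD in \<open>auto intro!: continuous_intros Bu f dissipative\<close>)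
  let ?l = "\<lambda>n. real (Suc n)"
  have l: "0 < ?l n" for n by simp
  have est: "norm (J (?l n) (B (u t))) \<le> norm (B x) + I\<^sub>\<alpha> (\<lambda>s. norm (B (f s))) t" for n
  proof -
    let ?S = "yosida (?l n)"
    have 1: "norm (?S (u t)) \<le> norm (?S x) + I\<^sub>\<alpha> (\<lambda>s. norm (?S (f s))) t"
    proof (rule dissipative_estimate[OF alpha _ _ _ _ t])
      show "continuous_on {0..} (\<lambda>s. ?S (B (u s) + f s))" "continuous_on {0..} (\<lambda>s. ?S (f s))"
        by (intro yosida_continuous l continuous_intros Bu f)+
      fix s :: real assume s: "0 \<le> s"
      show "?S (u s) = ?S x + I\<^sub>\<alpha> (\<lambda>s. ?S (B (u s) + f s)) s"
        by (subst eq[OF s])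
           (simp add: linear_add[OF bounded_linear.linear[OF bounded_linear_yosida[OF l]]]
              convolution_bounded_linear[OF bounded_linear_yosida[OF l]] kernel_facts continuous_on_add Bu f del: of_nat_Suc)
      have "?S (B (u s) + f s) - ?S (f s) = ?S (B (u s))"
        by (simp add: linear_add[OF bounded_linear.linear[OF bounded_linear_yosida[OF l]]] del: of_nat_Suc)
      also have "\<dots> = B (?S (u s))"
      proof -
        have "?S (B (u s)) = B (J (?l n) (B (u s)))" by (simp add: B_J[OF l] del: of_nat_Suc)
        then show ?thesis by (simp add: J_B[OF l uD[OF s]] del: of_nat_Suc)
      qed
      finally have "?S (B (u s) + f s) - ?S (f s) = B (?S (u s))" .
      moreover have "?S (u s) \<in> D"
        using J_props(1)[OF l, of n "B (u s)"] by (simp add: J_B[OF l uD[OF s]] del: of_nat_Suc)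
      ultimately show "\<kappa> * norm (?S (u s)) \<le> norm (\<kappa> *\<^sub>R ?S (u s) - (?S (B (u s) + f s) - ?S (f s)))" if "0 < \<kappa>" for \<kappa>
        using dissipative[OF _ that] by metis
    qed
    have S: "norm (?S z) \<le> norm (B z)" if "z \<in> D" for z
      using norm_J_le[OF l, of n "B z"] J_B[OF l that, of n] by simp
    have "I\<^sub>\<alpha> (\<lambda>s. norm (?S (f s))) t \<le> I\<^sub>\<alpha> (\<lambda>s. norm (B (f s))) t"
      by (intro convolution_mono kernel_facts continuous_intros yosida_continuous l f Bf S fD)
    then show ?thesis unfolding J_B[OF l uD[OF t]] using 1 S[OF x] by linarith
  qed
  show "norm (B (u t)) \<le> norm (B x) + I\<^sub>\<alpha> (\<lambda>s. norm (B (f s))) t"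
    by (rule Lim_bounded[OF tendsto_norm[OF J_tendsto]]) (use est in auto)
qed

section \<open>Solutions and estimates in the graph norm\<close>

lemma B_0: "B 0 = 0"
  using B_scaleR[OF subspace_0[OF subspace], of 0] by simp

lemma graph_norm_nonneg: "0 \<le> graph_norm B y"
  by (simp add: graph_norm_def)

lemma norm_le_graph_norm: "norm y \<le> graph_norm B y" "norm (B y) \<le> graph_norm B y"
  by (simp_all add: graph_norm_def)

lemma graph_norm_triangle:
  "y \<in> D \<Longrightarrow> z \<in> D \<Longrightarrow> graph_norm B (y + z) \<le> graph_norm B y + graph_norm B z"
  using norm_triangle_ineq[of y z] norm_triangle_ineq[of "B y" "B z"] by (simp add: graph_norm_def B_add)

lemma graph_norm_scaleR: "y \<in> D \<Longrightarrow> graph_norm B (c *\<^sub>R y) = \<bar>c\<bar> * graph_norm B y"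
  by (simp add: graph_norm_def B_scaleR distrib_left)

lemma graph_norm_minus_commute:
  "y \<in> D \<Longrightarrow> z \<in> D \<Longrightarrow> graph_norm B (y - z) = graph_norm B (z - y)"
  by (simp add: graph_norm_def B_diff norm_minus_commute)

lemma graph_norm_continuous:
  "continuous_on S u \<Longrightarrow> continuous_on S (\<lambda>s. B (u s)) \<Longrightarrow> continuous_on S (\<lambda>s. graph_norm B (u s))"
  unfolding graph_norm_def by (intro continuous_intros)

lemma B_diff_continuous:
  assumes "continuous_on {0..} (\<lambda>s. B (u s))" "continuous_on {0..} (\<lambda>s. B (v s))"
    and "\<And>s. 0 \<le> s \<Longrightarrow> u s \<in> D" "\<And>s. 0 \<le> s \<Longrightarrow> v s \<in> D"
  shows "continuous_on {0..} (\<lambda>s. B (u s - v s))"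
proof -
  have "continuous_on {0..} (\<lambda>s. B (u s) - B (v s))" by (intro continuous_intros assms)
  then show ?thesis by (rule continuous_on_eq) (simp add: B_diff assms)
qed

definition solves :: "'a \<Rightarrow> (real \<Rightarrow> 'a) \<Rightarrow> (real \<Rightarrow> 'a) \<Rightarrow> bool" where
  "solves x f u \<longleftrightarrow> continuous_on {0..} u \<and> continuous_on {0..} (\<lambda>t. B (u t)) \<and> (\<forall>t\<ge>0. u t \<in> D) \<and>
     (\<forall>t\<ge>0. u t = x + I\<^sub>\<alpha> (\<lambda>s. B (u s) + f s) t)"

definition graph_continuous :: "(real \<Rightarrow> 'a) \<Rightarrow> bool" where
  "graph_continuous f \<longleftrightarrow> continuous_on {0..} f \<and> continuous_on {0..} (\<lambda>t. B (f t)) \<and> (\<forall>t\<ge>0. f t \<in> D)"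

lemma solves_graph_continuous: "solves x f u \<Longrightarrow> graph_continuous u"
  unfolding solves_def graph_continuous_def by blast

lemma solves_in_domain: "solves x f u \<Longrightarrow> 0 \<le> t \<Longrightarrow> u t \<in> D"
  unfolding solves_def by blast

lemma graph_continuous_diff:
  "graph_continuous f \<Longrightarrow> graph_continuous g \<Longrightarrow> graph_continuous (\<lambda>s. f s - g s)"
  by (auto simp: graph_continuous_def intro!: continuous_intros B_diff_continuous subspace_diff[OF subspace])

lemma graph_norm_graph_continuous:
  "graph_continuous f \<Longrightarrow> continuous_on {0..} (\<lambda>s. graph_norm B (f s))"
  by (simp add: graph_continuous_def graph_norm_continuous)

lemma solves_exists:
  assumes "x \<in> D" "graph_continuous f"
  shows "\<exists>u. solves x f u"
  using linear_solution[OF assms(1), of f] assms(2) unfolding graph_continuous_def solves_def by metis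

lemma solvesD:
  assumes "solves x f u"
  shows "continuous_on {0..} u" "continuous_on {0..} (\<lambda>t. B (u t))"
    "0 \<le> t \<Longrightarrow> u t = x + I\<^sub>\<alpha> (\<lambda>s. B (u s) + f s) t"
  using assms unfolding solves_def by blast+

lemma solves_cong:
  assumes "solves x f u" "\<And>s. 0 \<le> s \<Longrightarrow> f s = g s"
  shows "solves x g u"
proof -
  have eq: "I\<^sub>\<alpha> (\<lambda>s. B (u s) + f s) t = I\<^sub>\<alpha> (\<lambda>s. B (u s) + g s) t" for t
    by (intro convolution_cong) (simp add: assms)
  show ?thesis using assms(1) unfolding solves_def eq .
qed

lemma solves_diff:
  assumes u: "solves x f u" and v: "solves y g v" and f: "continuous_on {0..} f" and g: "continuous_on {0..} g"
  shows "solves (x - y) (\<lambda>s. f s - g s) (\<lambda>s. u s - v s)"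
proof -
  have eq: "u t - v t = (x - y) + I\<^sub>\<alpha> (\<lambda>s. B (u s - v s) + (f s - g s)) t" if t: "0 \<le> t" for t
  proof -
    have "I\<^sub>\<alpha> (\<lambda>s. B (u s - v s) + (f s - g s)) t
        = I\<^sub>\<alpha> (\<lambda>s. (B (u s) + f s) - (B (v s) + g s)) t"
      by (intro convolution_cong) (simp add: B_diff solves_in_domain[OF u] solves_in_domain[OF v])
    also have "\<dots> = I\<^sub>\<alpha> (\<lambda>s. B (u s) + f s) t - I\<^sub>\<alpha> (\<lambda>s. B (v s) + g s) t"
      by (intro convolution_diff kernel_facts continuous_intros solvesD[OF u] solvesD[OF v] f g)
    finally show ?thesis using solvesD(3)[OF u t] solvesD(3)[OF v t] by simp
  qed
  have "graph_continuous (\<lambda>s. u s - v s)"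
    by (intro graph_continuous_diff solves_graph_continuous[OF u] solves_graph_continuous[OF v])
  then show ?thesis
    unfolding solves_def graph_continuous_def using eq by blast
qed

lemma solves_estimate:
  assumes u: "solves x f u" and f: "graph_continuous f" and x: "x \<in> D" and t: "0 \<le> t"
  shows "graph_norm B (u t) \<le> graph_norm B x + I\<^sub>\<alpha> (\<lambda>s. graph_norm B (f s)) t"
proof -
  have "norm (u t) \<le> norm x + I\<^sub>\<alpha> (\<lambda>s. norm (f s)) t"
    "norm (B (u t)) \<le> norm (B x) + I\<^sub>\<alpha> (\<lambda>s. norm (B (f s))) t"
    using u f x by (auto simp: solves_def graph_continuous_def intro!: graph_estimate[OF _ _ _ _ _ _ _ _ t])
  moreover have "I\<^sub>\<alpha> (\<lambda>s. graph_norm B (f s)) t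
      = I\<^sub>\<alpha> (\<lambda>s. norm (f s)) t + I\<^sub>\<alpha> (\<lambda>s. norm (B (f s))) t"
    unfolding graph_norm_def using f
    by (intro convolution_add kernel_facts continuous_intros) (auto simp: graph_continuous_def)
  ultimately show ?thesis by (simp add: graph_norm_def)
qed

text \<open>On D the identity y = J_1 (y - B y) holds, and J_1 is continuous: the limit of the pairs
  determines a point of D with the right image.\<close>

lemma closed_graph: "closed ((\<lambda>y. (y, B y)) ` D)"
  unfolding closed_sequential_limits
proof (intro allI impI)
  fix g l assume g: "(\<forall>n. g n \<in> (\<lambda>y. (y, B y)) ` D) \<and> g \<longlonglongrightarrow> l"
  then have gD: "fst (g n) \<in> D" and gB: "snd (g n) = B (fst (g n))" for n
    by (auto simp: image_iff dest!: spec[of _ n])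
  have one: "(0::real) < 1" by simp
  have lim: "(\<lambda>n. fst (g n)) \<longlonglongrightarrow> fst l" "(\<lambda>n. snd (g n)) \<longlonglongrightarrow> snd l"
    using g by (auto intro: tendsto_intros)
  have "(\<lambda>n. J 1 (fst (g n) - snd (g n))) \<longlonglongrightarrow> J 1 (fst l - snd l)"
    by (intro bounded_linear.tendsto[OF bounded_linear_J[OF one]] tendsto_intros lim)
  moreover have "J 1 (fst (g n) - snd (g n)) = fst (g n)" for n
    by (intro J_eqI one gD) (simp add: gB)
  ultimately have "(\<lambda>n. fst (g n)) \<longlonglongrightarrow> J 1 (fst l - snd l)" by simp
  then have eq: "fst l = J 1 (fst l - snd l)" using lim(1) LIMSEQ_unique by blast
  have "fst l \<in> D" by (subst eq) (rule J_props(1)[OF one])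
  moreover have "B (fst l) = snd l"
    using B_J[OF one, of "fst l - snd l"] unfolding eq[symmetric] yosida_def by simp
  ultimately show "l \<in> (\<lambda>y. (y, B y)) ` D" by (intro image_eqI[of _ _ "fst l"]) (simp_all add: prod_eq_iff)
qed

text \<open>Picard iteration takes place in the graph of \<open>B\<close>, a closed subspace of \<open>'a \<times> 'a\<close>.\<close>

lemma semilinear_lipschitz:
  fixes G :: "real \<Rightarrow> 'a \<Rightarrow> 'a" and L :: "real \<Rightarrow> real"
  assumes x: "x \<in> D"
    and G: "\<And>v. graph_continuous v \<Longrightarrow> graph_continuous (\<lambda>s. G s (v s))"
    and L: "\<And>T. 0 \<le> L T"
    and lip: "\<And>T t y z. 0 \<le> t \<Longrightarrow> t \<le> T \<Longrightarrow> y \<in> D \<Longrightarrow> z \<in> D \<Longrightarrow>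
      graph_norm B (G t y - G t z) \<le> L T * graph_norm B (y - z)"
  obtains u where "solves x (\<lambda>s. G s (u s)) u"
proof -
  define K where "K = (\<lambda>y. (y, B y)) ` D"
  \<comment> \<open>A solution of the linear problem with the nonlinearity frozen along v, selected
    by choice. Differences of solutions obey the linear estimate, which makes the selected map
    Lipschitz.\<close>
  define U where "U v = (SOME u. solves x (\<lambda>s. G s (fst (v s))) u)" for v :: "real \<Rightarrow> 'a \<times> 'a"
  define \<Phi> where "\<Phi> v t = (U v t, B (U v t))" for v t
  \<comment> \<open>The product norm is Euclidean while the graph norm is a sum; this comparison is
    the source of the factor 2 in the Lipschitz constant 2 L(T).\<close>
  have fst_snd: "norm (fst p) + norm (snd p) \<le> 2 * norm p" for p :: "'a \<times> 'a"
    using norm_fst_le[of "fst p" "snd p"] norm_snd_le[of "snd p" "fst p"] by simp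
  have gc: "graph_continuous (\<lambda>s. fst (v s))" if v: "continuous_on {0..} v" "\<And>t. 0 \<le> t \<Longrightarrow> v t \<in> K" for v
  proof -
    have "continuous_on {0..} (\<lambda>s. snd (v s))" by (intro continuous_intros v)
    then have "continuous_on {0..} (\<lambda>s. B (fst (v s)))"
      by (rule continuous_on_eq) (use v(2) in \<open>force simp: K_def\<close>)
    then show ?thesis using v by (force simp: graph_continuous_def K_def intro!: continuous_intros)
  qed
  have U: "solves x (\<lambda>s. G s (fst (v s))) (U v)" if v: "continuous_on {0..} v" "\<And>t. 0 \<le> t \<Longrightarrow> v t \<in> K" for v
    using someI_ex[OF solves_exists[OF x G[OF gc[OF v]]]] by (simp add: U_def)
  obtain v where v: "continuous_on {0..} v" "\<And>t. 0 \<le> t \<Longrightarrow> v t \<in> K" "\<And>t. 0 \<le> t \<Longrightarrow> \<Phi> v t = v t"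
  proof (rule causal_picard[of \<alpha> K "(x, B x)" \<Phi> "\<lambda>T. 2 * L T"])
    show "closed K" unfolding K_def by (rule closed_graph)
    show "(x, B x) \<in> K" using x by (simp add: K_def)
    fix v :: "real \<Rightarrow> 'a \<times> 'a" and t
    assume v: "continuous_on {0..} v" "\<And>t. 0 \<le> t \<Longrightarrow> v t \<in> K"
    have Uv: "solves x (\<lambda>s. G s (fst (v s))) (U v)" by (rule U[OF v(1)]) (rule v(2))
    show "continuous_on {0..} (\<Phi> v)"
      unfolding \<Phi>_def by (intro continuous_intros solvesD[OF Uv])
    show "\<Phi> v t \<in> K" if "0 \<le> t"
      unfolding \<Phi>_def K_def by (rule imageI) (rule solves_in_domain[OF Uv that])
  next
    fix T t :: real and v w :: "real \<Rightarrow> 'a \<times> 'a"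
    assume v: "continuous_on {0..} v" "\<And>t. 0 \<le> t \<Longrightarrow> v t \<in> K"
      and w: "continuous_on {0..} w" "\<And>t. 0 \<le> t \<Longrightarrow> w t \<in> K" and t: "0 \<le> t" "t \<le> T"
    have vg: "graph_continuous (\<lambda>s. fst (v s))" by (rule gc[OF v(1)]) (rule v(2))
    have wg: "graph_continuous (\<lambda>s. fst (w s))" by (rule gc[OF w(1)]) (rule w(2))
    have Uv: "solves x (\<lambda>s. G s (fst (v s))) (U v)" by (rule U[OF v(1)]) (rule v(2))
    have Uw: "solves x (\<lambda>s. G s (fst (w s))) (U w)" by (rule U[OF w(1)]) (rule w(2))
    have dg: "graph_continuous (\<lambda>s. G s (fst (v s)) - G s (fst (w s)))"
      by (intro graph_continuous_diff G vg wg)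
    have s: "solves (x - x) (\<lambda>s. G s (fst (v s)) - G s (fst (w s))) (\<lambda>s. U v s - U w s)"
      using G[OF vg] G[OF wg] by (intro solves_diff[OF Uv Uw]) (auto simp: graph_continuous_def)
    have UD: "U v t \<in> D" "U w t \<in> D"
      using solves_in_domain[OF Uv t(1)] solves_in_domain[OF Uw t(1)] by simp_all
    have "norm (\<Phi> v t - \<Phi> w t) \<le> graph_norm B (U v t - U w t)"
      using norm_Pair_le[of "U v t - U w t" "B (U v t) - B (U w t)"] by (simp add: \<Phi>_def graph_norm_def B_diff UD)
    also have "\<dots> \<le> graph_norm B (x - x) + I\<^sub>\<alpha> (\<lambda>s. graph_norm B (G s (fst (v s)) - G s (fst (w s)))) t"
      using x by (intro solves_estimate[OF s dg _ t(1)]) (simp add: subspace_0[OF subspace])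
    also have "graph_norm B (x - x) = 0" by (simp add: graph_norm_def B_0)
    also have "0 + I\<^sub>\<alpha> (\<lambda>s. graph_norm B (G s (fst (v s)) - G s (fst (w s)))) t
        \<le> I\<^sub>\<alpha> (\<lambda>s. (2 * L T) *\<^sub>R norm (v s - w s)) t"
      unfolding add_0
    proof (intro convolution_mono kernel_facts graph_norm_graph_continuous dg continuous_intros v(1) w(1))
      fix s assume s: "0 \<le> s" "s \<le> t"
      have D: "fst (v s) \<in> D" "fst (w s) \<in> D" "snd (v s) = B (fst (v s))" "snd (w s) = B (fst (w s))"
        using v(2)[OF s(1)] w(2)[OF s(1)] by (auto simp: K_def)
      have "graph_norm B (fst (v s) - fst (w s)) = norm (fst (v s - w s)) + norm (snd (v s - w s))"
        by (simp add: graph_norm_def B_diff D)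
      also have "\<dots> \<le> 2 * norm (v s - w s)"
        by (rule fst_snd)
      finally have "L T * graph_norm B (fst (v s) - fst (w s)) \<le> L T * (2 * norm (v s - w s))"
        by (intro mult_left_mono L)
      then show "graph_norm B (G s (fst (v s)) - G s (fst (w s))) \<le> (2 * L T) *\<^sub>R norm (v s - w s)"
        using lip[OF s(1) _ D(1,2), of T] s t by simp
    qed
    finally show "norm (\<Phi> v t - \<Phi> w t) \<le> 2 * L T * I\<^sub>\<alpha> (\<lambda>s. norm (v s - w s)) t"
      unfolding convolution_scaleR by simp
  qed (use L alpha in auto)
  have eq: "U v t = fst (v t)" if "0 \<le> t" for t using v(3)[OF that] by (metis \<Phi>_def fst_conv)
  have "solves x (\<lambda>s. G s (U v s)) (U v)"
  proof (rule solves_cong)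
    show "solves x (\<lambda>s. G s (fst (v s))) (U v)" by (rule U[OF v(1)]) (rule v(2))
  qed (simp add: eq)
  then show thesis by (rule that)
qed

section \<open>Retraction onto balls of the graph norm, and the nonlinear problem\<close>

definition radial_truncation :: "real \<Rightarrow> 'a \<Rightarrow> 'a" where
  "radial_truncation r y = (r / max r (graph_norm B y)) *\<^sub>R y"

lemma radial_truncation_in: "y \<in> D \<Longrightarrow> radial_truncation r y \<in> D"
  by (simp add: radial_truncation_def subspace_scale[OF subspace])

lemma radial_truncation_id: "0 < r \<Longrightarrow> graph_norm B y \<le> r \<Longrightarrow> radial_truncation r y = y"
  by (simp add: radial_truncation_def)

lemma graph_norm_radial_truncation:
  assumes "y \<in> D" "0 < r"
  shows "graph_norm B (radial_truncation r y) \<le> r" "graph_norm B (radial_truncation r y) \<le> graph_norm B y"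
proof -
  let ?n = "graph_norm B y"
  have n: "0 \<le> ?n" by (rule graph_norm_nonneg)
  have eq: "graph_norm B (radial_truncation r y) = r * ?n / max r ?n"
    using assms by (simp add: radial_truncation_def graph_norm_scaleR abs_div_pos max_def)
  show "graph_norm B (radial_truncation r y) \<le> r" "graph_norm B (radial_truncation r y) \<le> ?n"
    unfolding eq using assms(2) n by (auto simp: max_def divide_le_eq mult_left_mono mult_right_mono)
qed

text \<open>The difference is (r/p) (y - z) + (r/p - r/q) z. The first coefficient is at most 1; in
  the second term the factor 1/q absorbs the norm of z, and |q - p| is at most the distance of y and
  z. Each term costs one such distance.\<close>

lemma radial_truncation_lipschitz:
  assumes y: "y \<in> D" and z: "z \<in> D" and r: "0 < r"
  shows "graph_norm B (radial_truncation r y - radial_truncation r z) \<le> 2 * graph_norm B (y - z)"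
proof -
  define p where "p = max r (graph_norm B y)"
  define q where "q = max r (graph_norm B z)"
  have p: "r \<le> p" "0 < p" and q: "0 < q" "graph_norm B z \<le> q" using r by (auto simp: p_def q_def)
  have yz: "y - z \<in> D" by (rule subspace_diff[OF subspace y z])
  have "\<bar>graph_norm B z - graph_norm B y\<bar> \<le> graph_norm B (y - z)"
    using graph_norm_triangle[OF yz z] graph_norm_triangle[OF subspace_diff[OF subspace z y] y]
      graph_norm_minus_commute[OF y z] by simp
  then have qp: "\<bar>q - p\<bar> \<le> graph_norm B (y - z)" by (auto simp: p_def q_def max_def)
  have "r / p - r / q = r * (q - p) / (p * q)" using p q by (simp add: field_simps)
  moreover have "radial_truncation r y - radial_truncation r z = (r / p) *\<^sub>R (y - z) + (r / p - r / q) *\<^sub>R z"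
    by (simp add: radial_truncation_def p_def q_def algebra_simps)
  ultimately have "graph_norm B (radial_truncation r y - radial_truncation r z)
      \<le> graph_norm B ((r / p) *\<^sub>R (y - z)) + graph_norm B ((r * (q - p) / (p * q)) *\<^sub>R z)"
    using graph_norm_triangle[of "(r / p) *\<^sub>R (y - z)" "(r * (q - p) / (p * q)) *\<^sub>R z"] yz z
    by (simp add: subspace_scale[OF subspace])
  also have "graph_norm B ((r / p) *\<^sub>R (y - z)) = (r / p) * graph_norm B (y - z)"
    using p r by (simp add: graph_norm_scaleR[OF yz])
  also have "graph_norm B ((r * (q - p) / (p * q)) *\<^sub>R z) = (r / p) * (graph_norm B z / q) * \<bar>q - p\<bar>"
    using p q r by (simp add: graph_norm_scaleR[OF z] abs_mult)
  also have "(r / p) * graph_norm B (y - z) \<le> 1 * graph_norm B (y - z)"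
    using p graph_norm_nonneg by (intro mult_right_mono) auto
  also have "(r / p) * (graph_norm B z / q) * \<bar>q - p\<bar> \<le> (1 * 1) * graph_norm B (y - z)"
    using p q r graph_norm_nonneg by (intro mult_mono qp mult_nonneg_nonneg divide_nonneg_nonneg) auto
  finally show ?thesis by simp
qed

lemma radial_truncation_graph_continuous:
  assumes v: "graph_continuous v" and R: "continuous_on {0..} R" "\<And>t. 0 < R t"
  shows "graph_continuous (\<lambda>s. radial_truncation (R s) (v s))"
proof -
  have nz: "max (R s) (graph_norm B (v s)) \<noteq> 0" for s using R(2)[of s] by (auto simp: max_def)
  have "continuous_on {0..} (\<lambda>s. (R s / max (R s) (graph_norm B (v s))) *\<^sub>R v s)"
    and Bc: "continuous_on {0..} (\<lambda>s. (R s / max (R s) (graph_norm B (v s))) *\<^sub>R B (v s))"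
    using v nz by (auto simp: graph_continuous_def intro!: continuous_intros R graph_norm_continuous)
  moreover have "continuous_on {0..} (\<lambda>s. B (radial_truncation (R s) (v s)))"
    by (rule continuous_on_eq[OF Bc]) (use v in \<open>auto simp: radial_truncation_def B_scaleR graph_continuous_def\<close>)
  ultimately show ?thesis
    using v by (auto simp: graph_continuous_def radial_truncation_in) (simp add: radial_truncation_def)
qed

definition locally_lipschitz_on_graph :: "('a \<Rightarrow> 'a) \<Rightarrow> bool" where
  "locally_lipschitz_on_graph F \<longleftrightarrow> F ` D \<subseteq> D \<and> (\<forall>R. \<exists>L\<ge>0. \<forall>y\<in>D. \<forall>z\<in>D. graph_norm B y \<le> R \<longrightarrow> graph_norm B z \<le> R \<longrightarrow>
      graph_norm B (F y - F z) \<le> L * graph_norm B (y - z))"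

lemma locally_lipschitz_graph_continuous:
  assumes F: "locally_lipschitz_on_graph F" and v: "graph_continuous v"
  shows "graph_continuous (\<lambda>s. F (v s))"
proof -
  have FD: "F y \<in> D" if "y \<in> D" for y using F that by (auto simp: locally_lipschitz_on_graph_def)
  have vD: "v t \<in> D" if "0 \<le> t" for t using v that by (simp add: graph_continuous_def)
  have "continuous_on {0..T} (\<lambda>s. F (v s)) \<and> continuous_on {0..T} (\<lambda>s. B (F (v s)))" for T
  proof -
    have "continuous_on {0..T} (\<lambda>s. graph_norm B (v s))"
      by (rule continuous_on_subset[OF graph_norm_graph_continuous[OF v]]) auto
    then obtain R where R: "\<And>s. 0 \<le> s \<Longrightarrow> s \<le> T \<Longrightarrow> norm (graph_norm B (v s)) \<le> R"
      using continuous_on_interval_bound by blast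
    obtain L where L: "0 \<le> L" "\<And>y z. y \<in> D \<Longrightarrow> z \<in> D \<Longrightarrow> graph_norm B y \<le> R \<Longrightarrow> graph_norm B z \<le> R \<Longrightarrow>
        graph_norm B (F y - F z) \<le> L * graph_norm B (y - z)"
      using F unfolding locally_lipschitz_on_graph_def by meson
    have lim: "((\<lambda>s. graph_norm B (F (v s) - F (v t))) \<longlongrightarrow> 0) (at t within {0..T})" if t: "t \<in> {0..T}" for t
    proof (rule Lim_null_comparison)
      show "\<forall>\<^sub>F s in at t within {0..T}. norm (graph_norm B (F (v s) - F (v t))) \<le> L * (norm (v s - v t) + norm (B (v s) - B (v t)))"
      proof (rule eventually_at_filter[THEN iffD2], rule always_eventually, intro allI impI)
        fix s assume s: "s \<in> {0..T}"
        have "graph_norm B (F (v s) - F (v t)) \<le> L * graph_norm B (v s - v t)"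
          using s t R[of s] R[of t] by (intro L vD) auto
        then show "norm (graph_norm B (F (v s) - F (v t))) \<le> L * (norm (v s - v t) + norm (B (v s) - B (v t)))"
          using graph_norm_nonneg[of "F (v s) - F (v t)"] s t vD by (simp add: graph_norm_def[of B "v s - v t"] B_diff)
      qed
      have "(v \<longlongrightarrow> v t) (at t within {0..T})" "((\<lambda>s. B (v s)) \<longlongrightarrow> B (v t)) (at t within {0..T})"
        using v t continuous_on_subset[of "{0..}" v "{0..T}"] continuous_on_subset[of "{0..}" "\<lambda>s. B (v s)" "{0..T}"]
        by (auto simp: graph_continuous_def continuous_on)
      then have "((\<lambda>s. L * (norm (v s - v t) + norm (B (v s) - B (v t)))) \<longlongrightarrow> L * (norm (v t - v t) + norm (B (v t) - B (v t)))) (at t within {0..T})"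
        by (intro tendsto_intros)
      then show "((\<lambda>s. L * (norm (v s - v t) + norm (B (v s) - B (v t)))) \<longlongrightarrow> 0) (at t within {0..T})" by simp
    qed
    have "((\<lambda>s. F (v s) - F (v t)) \<longlongrightarrow> 0) (at t within {0..T})" if t: "t \<in> {0..T}" for t
      by (rule Lim_null_comparison[OF always_eventually lim[OF t]]) (simp add: norm_le_graph_norm)
    moreover have "((\<lambda>s. B (F (v s)) - B (F (v t))) \<longlongrightarrow> 0) (at t within {0..T})" if t: "t \<in> {0..T}" for t
    proof (rule Lim_null_comparison[OF _ lim[OF t]])
      show "\<forall>\<^sub>F s in at t within {0..T}. norm (B (F (v s)) - B (F (v t))) \<le> graph_norm B (F (v s) - F (v t))"
        using t norm_le_graph_norm(2) by (auto simp: eventually_at_filter B_diff[symmetric] FD vD)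
    qed
    ultimately show ?thesis by (auto simp: continuous_on_def intro: LIM_zero_cancel)
  qed
  then show ?thesis
    using FD vD by (auto simp: graph_continuous_def intro: continuous_on_atLeast_0I)
qed

theorem semilinear_exists:
  assumes x: "x \<in> D" and F: "locally_lipschitz_on_graph F" and w: "w \<in> C_infty \<alpha>" and C: "0 \<le> C"
    and growth: "\<And>y. y \<in> D \<Longrightarrow> graph_norm B (F y) \<le> C * w (graph_norm B y)"
  obtains u where "solves x (\<lambda>s. F (u s)) u"
proof -
  have FD: "F y \<in> D" if "y \<in> D" for y using F that by (auto simp: locally_lipschitz_on_graph_def)
  have wc: "continuous_on {0..} w" and wm: "mono_on {0..} w" using w by (auto simp: C_infty_def)
  define X where "X = graph_norm B x"
  \<comment> \<open>These bounds involve only the initial value, \<open>C\<close>, \<open>w\<close>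
    and the horizon n, so the truncation radius can be built from them before the truncated problem
    is posed.\<close>
  have "\<exists>M\<ge>0. \<forall>\<phi> t. continuous_on {0..} \<phi> \<longrightarrow> (\<forall>s\<ge>0. 0 \<le> \<phi> s) \<longrightarrow>
      (\<forall>s\<ge>0. \<phi> s \<le> X + C * I\<^sub>\<alpha> (\<lambda>r. w (\<phi> r)) s) \<longrightarrow>
      0 \<le> t \<longrightarrow> t \<le> real n \<longrightarrow> \<phi> t \<le> M" for n
    using osgood_bound[OF alpha w graph_norm_nonneg[of x] C, of "real n"] unfolding X_def by metis
  then obtain b where b0: "\<And>n. 0 \<le> b n" and b: "\<And>n \<phi> t. continuous_on {0..} \<phi> \<Longrightarrow> (\<forall>s\<ge>0. 0 \<le> \<phi> s) \<Longrightarrow>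
      (\<forall>s\<ge>0. \<phi> s \<le> X + C * I\<^sub>\<alpha> (\<lambda>r. w (\<phi> r)) s) \<Longrightarrow>
      0 \<le> t \<Longrightarrow> t \<le> real n \<Longrightarrow> \<phi> t \<le> b n" by metis
  obtain M :: "real \<Rightarrow> real" where Mc: "continuous_on {0..} M" and M0: "\<And>t. 0 < M t" and M: "\<And>t. 0 \<le> t \<Longrightarrow> b (nat \<lceil>t\<rceil>) \<le> M t"
    by (rule continuous_majorant[of b, OF b0]) blast
  define G where "G t y = F (radial_truncation (M t) y)" for t y
  have G: "graph_continuous (\<lambda>s. G s (v s))" if "graph_continuous v" for v
    unfolding G_def
    by (rule locally_lipschitz_graph_continuous[OF F radial_truncation_graph_continuous[OF that Mc M0]])
  have "\<exists>L\<ge>0. \<forall>t y z. 0 \<le> t \<longrightarrow> t \<le> T \<longrightarrow> y \<in> D \<longrightarrow> z \<in> D \<longrightarrow>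
      graph_norm B (G t y - G t z) \<le> L * graph_norm B (y - z)" for T
  proof -
    have "continuous_on {0..T} M" using Mc by (rule continuous_on_subset) auto
    then obtain R where R: "\<And>s. 0 \<le> s \<Longrightarrow> s \<le> T \<Longrightarrow> norm (M s) \<le> R"
      using continuous_on_interval_bound by blast
    obtain L where L: "0 \<le> L" "\<And>y z. y \<in> D \<Longrightarrow> z \<in> D \<Longrightarrow> graph_norm B y \<le> R \<Longrightarrow> graph_norm B z \<le> R \<Longrightarrow>
        graph_norm B (F y - F z) \<le> L * graph_norm B (y - z)"
      using F unfolding locally_lipschitz_on_graph_def by meson
    show ?thesis
    proof (intro exI[of _ "L * 2"] conjI allI impI)
      fix t y z assume t: "0 \<le> t" "t \<le> T" and y: "y \<in> D" and z: "z \<in> D"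
      have "graph_norm B (radial_truncation (M t) v) \<le> R" if "v \<in> D" for v
        using graph_norm_radial_truncation(1)[OF that M0, of t] R[OF t] by simp
      note rR = this
      have "graph_norm B (G t y - G t z) \<le> L * graph_norm B (radial_truncation (M t) y - radial_truncation (M t) z)"
        unfolding G_def by (intro L radial_truncation_in rR y z)
      also have "\<dots> \<le> L * (2 * graph_norm B (y - z))"
        by (intro mult_left_mono radial_truncation_lipschitz y z M0 L)
      finally show "graph_norm B (G t y - G t z) \<le> L * 2 * graph_norm B (y - z)" by simp
    qed (use L in simp)
  qed
  then obtain L where "\<And>T. 0 \<le> L T" "\<And>T t y z. 0 \<le> t \<Longrightarrow> t \<le> T \<Longrightarrow> y \<in> D \<Longrightarrow> z \<in> D \<Longrightarrow>
      graph_norm B (G t y - G t z) \<le> L T * graph_norm B (y - z)" by metis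
  then obtain u where u: "solves x (\<lambda>s. G s (u s)) u"
    using semilinear_lipschitz[where G = G and L = L, OF x G] by blast
  have ug: "graph_continuous u" by (rule solves_graph_continuous[OF u])
  have uD: "u t \<in> D" if "0 \<le> t" for t using ug that by (simp add: graph_continuous_def)
  define \<phi> where "\<phi> s = graph_norm B (u s)" for s
  have \<phi>c: "continuous_on {0..} \<phi>" unfolding \<phi>_def by (rule graph_norm_graph_continuous[OF ug])
  have \<phi>0: "0 \<le> \<phi> s" for s by (simp add: \<phi>_def graph_norm_nonneg)
  have w\<phi>: "continuous_on {0..} (\<lambda>s. w (\<phi> s))"
    by (rule continuous_on_compose2[OF wc \<phi>c]) (use \<phi>0 in auto)
  have "\<phi> t \<le> X + C * I\<^sub>\<alpha> (\<lambda>r. w (\<phi> r)) t" if t: "0 \<le> t" for t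
  proof -
    have "\<phi> t \<le> X + I\<^sub>\<alpha> (\<lambda>s. graph_norm B (G s (u s))) t"
      unfolding \<phi>_def X_def by (rule solves_estimate[OF u G[OF ug] x t])
    also have "I\<^sub>\<alpha> (\<lambda>s. graph_norm B (G s (u s))) t \<le> I\<^sub>\<alpha> (\<lambda>s. C *\<^sub>R w (\<phi> s)) t"
    proof (intro convolution_mono kernel_facts graph_norm_graph_continuous G ug continuous_intros w\<phi>)
      fix s assume s: "0 \<le> s" "s \<le> t"
      let ?y = "radial_truncation (M s) (u s)"
      \<comment> \<open>Truncation does not increase the graph norm and w is nondecreasing, so the
        truncated nonlinearity obeys the growth bound with the same \<open>C\<close> and
        \<open>w\<close>, whatever the radius.\<close>
      have "w (graph_norm B ?y) \<le> w (\<phi> s)"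
        using wm graph_norm_radial_truncation(2)[OF uD[OF s(1)] M0, of s] graph_norm_nonneg \<phi>0
        by (auto simp: mono_on_def \<phi>_def)
      then have "C * w (graph_norm B ?y) \<le> C * w (\<phi> s)" using C by (rule mult_left_mono)
      then show "graph_norm B (G s (u s)) \<le> C *\<^sub>R w (\<phi> s)"
        using growth[OF radial_truncation_in[OF uD[OF s(1)]], of "M s"] by (simp add: G_def)
    qed
    finally show ?thesis unfolding convolution_scaleR by simp
  qed
  then have "\<phi> t \<le> M t" if "0 \<le> t" for t
    using b[OF \<phi>c, of t "nat \<lceil>t\<rceil>"] \<phi>0 M[OF that] that real_nat_ceiling_ge[of t] by fastforce
  then have "G s (u s) = F (u s)" if "0 \<le> s" for s
    using that M0 by (simp add: G_def \<phi>_def radial_truncation_id)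
  then have "solves x (\<lambda>s. F (u s)) u" by (intro solves_cong[OF u]) auto
  then show thesis by (rule that)
qed

theorem semilinear_unique:
  assumes F: "locally_lipschitz_on_graph F"
    and u: "solves x (\<lambda>s. F (u s)) u" and v: "solves x (\<lambda>s. F (v s)) v" and t: "0 \<le> t"
  shows "u t = v t"
proof -
  note ug = solves_graph_continuous[OF u] and vg = solves_graph_continuous[OF v]
  have Fu: "graph_continuous (\<lambda>s. F (u s))" and Fv: "graph_continuous (\<lambda>s. F (v s))"
    using locally_lipschitz_graph_continuous[OF F] ug vg by auto
  have D: "u s \<in> D" "v s \<in> D" if "0 \<le> s" for s using ug vg that by (auto simp: graph_continuous_def)
  have s: "solves (x - x) (\<lambda>s. F (u s) - F (v s)) (\<lambda>s. u s - v s)"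
    using Fu Fv by (intro solves_diff[OF u v]) (auto simp: graph_continuous_def)
  define \<phi> where "\<phi> s = graph_norm B (u s - v s)" for s
  have \<phi>c: "continuous_on {0..} \<phi>"
    unfolding \<phi>_def by (intro graph_norm_graph_continuous graph_continuous_diff ug vg)
  \<comment> \<open>On a bounded time interval both solutions stay in one ball, so a single
    Lipschitz constant is available for the Gronwall inequality.\<close>
  have "continuous_on {0..t} (\<lambda>s. max (graph_norm B (u s)) (graph_norm B (v s)))"
    by (rule continuous_on_subset[of "{0..}"]) (auto intro!: continuous_intros graph_norm_graph_continuous ug vg)
  then obtain R where R: "\<And>s. 0 \<le> s \<Longrightarrow> s \<le> t \<Longrightarrow> norm (max (graph_norm B (u s)) (graph_norm B (v s))) \<le> R"
    using continuous_on_interval_bound by blast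
  obtain L where L: "0 \<le> L" "\<And>y z. y \<in> D \<Longrightarrow> z \<in> D \<Longrightarrow> graph_norm B y \<le> R \<Longrightarrow> graph_norm B z \<le> R \<Longrightarrow>
      graph_norm B (F y - F z) \<le> L * graph_norm B (y - z)"
    using F unfolding locally_lipschitz_on_graph_def by meson
  have "\<phi> t \<le> 0"
  proof (rule weakly_singular_gronwall[OF alpha(1) L(1) \<phi>c _ t order.refl])
    fix r assume r: "0 \<le> r" "r \<le> t"
    have "\<phi> r \<le> graph_norm B (x - x) + I\<^sub>\<alpha> (\<lambda>s. graph_norm B (F (u s) - F (v s))) r"
      unfolding \<phi>_def by (rule solves_estimate[OF s graph_continuous_diff[OF Fu Fv] _ r(1)]) (simp add: subspace_0[OF subspace])
    also have "graph_norm B (x - x) = 0" by (simp add: graph_norm_def B_0)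
    also have "0 + I\<^sub>\<alpha> (\<lambda>s. graph_norm B (F (u s) - F (v s))) r \<le> I\<^sub>\<alpha> (\<lambda>s. L *\<^sub>R \<phi> s) r"
      unfolding add_0
    proof (intro convolution_mono kernel_facts graph_norm_graph_continuous graph_continuous_diff Fu Fv continuous_intros \<phi>c)
      fix s assume s: "0 \<le> s" "s \<le> r"
      then show "graph_norm B (F (u s) - F (v s)) \<le> L *\<^sub>R \<phi> s"
        using L(2)[OF D[OF s(1)]] R[of s] r by (simp add: \<phi>_def)
    qed
    finally show "\<phi> r \<le> L * I\<^sub>\<alpha> \<phi> r" unfolding convolution_scaleR by simp
  qed
  then have "norm (u t - v t) \<le> 0" unfolding \<phi>_def using norm_le_graph_norm(1)[of "u t - v t"] by linarith
  then show ?thesis by simp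
qed

end

section \<open>The theorem\<close>

lemma AE_interval_const:
  assumes "a < b" "AE t in lborel. t \<in> {a..b::real} \<longrightarrow> P"
  shows "P"
proof (rule ccontr)
  assume "\<not> P"
  then have "AE t in lborel. t \<notin> {a..b}" using assms(2) by simp
  then have "emeasure lborel {a..b} = 0" by (subst AE_iff_measurable[symmetric, where P = "\<lambda>t. t \<notin> {a..b}"]) auto
  then show False using assms(1) by simp
qed

text \<open>Evaluating the assumptions at functions that jump from \<open>0\<close> at time \<open>0\<close> to a constant eliminates the
  norms of the initial data: every constant is the one belonging to \<open>\<rho> 0 = 0\<close>.\<close>

lemma assumption_A_locally_lipschitz:
  assumes A: "assumption_A D A F \<rho>" and \<rho>: "\<rho> 0 = 0" and D: "0 \<in> D"
  shows "\<exists>L\<ge>0. \<forall>y\<in>D. \<forall>z\<in>D. graph_norm A y \<le> R \<longrightarrow> graph_norm A z \<le> R \<longrightarrow>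
    graph_norm A (F y - F z) \<le> L * graph_norm A (y - z)"
proof -
  from A obtain C :: "ennreal \<Rightarrow> ennreal \<Rightarrow> real \<Rightarrow> real \<Rightarrow> real" where C: "\<And>(I :: real set) u v M N.
      is_interval I \<and> I \<subseteq> {0..} \<and> (\<forall>t\<ge>0. u t \<in> D) \<and> (\<forall>t\<ge>0. v t \<in> D) \<and>
      \<rho> (u 0) < \<infinity> \<and> \<rho> (v 0) < \<infinity> \<and>
      (AE t in lborel. t \<in> I \<longrightarrow> graph_norm A (u t) \<le> M) \<and>
      (AE t in lborel. t \<in> I \<longrightarrow> graph_norm A (v t) \<le> N) \<Longrightarrow>
      (AE t in lborel. t \<in> I \<longrightarrow>
         graph_norm A (F (u t) - F (v t)) \<le> C (\<rho> (u 0)) (\<rho> (v 0)) M N * graph_norm A (u t - v t))"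
    unfolding assumption_A_def by blast
  show ?thesis
  \<comment> \<open>Assumption (A) gives a real constant of unspecified sign, hence the
    \<open>max\<close>.\<close>
  proof (intro exI[of _ "max 0 (C 0 0 R R)"] conjI ballI impI)
    fix y z assume y: "y \<in> D" and z: "z \<in> D" and R: "graph_norm A y \<le> R" "graph_norm A z \<le> R"
    let ?u = "\<lambda>v t :: real. if t = 0 then 0 else v"
    \<comment> \<open>The interval lies beyond the jump and has positive measure, so an almost
      everywhere statement about constants holds outright.\<close>
    have "AE t in lborel. t \<in> {1..2} \<longrightarrow> graph_norm A (F (?u y t) - F (?u z t))
        \<le> C (\<rho> (?u y 0)) (\<rho> (?u z 0)) R R * graph_norm A (?u y t - ?u z t)"
      using y z R D \<rho> by (intro C) (auto intro!: AE_I2 simp: is_interval_cc)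
    then have "AE t in lborel. t \<in> {1..2::real} \<longrightarrow> graph_norm A (F y - F z) \<le> C 0 0 R R * graph_norm A (y - z)"
      by eventually_elim (auto simp: \<rho>)
    from AE_interval_const[OF _ this] have "graph_norm A (F y - F z) \<le> C 0 0 R R * graph_norm A (y - z)" by simp
    also have "\<dots> \<le> max 0 (C 0 0 R R) * graph_norm A (y - z)"
      by (intro mult_right_mono) (auto simp: graph_norm_def)
    finally show "graph_norm A (F y - F z) \<le> max 0 (C 0 0 R R) * graph_norm A (y - z)" .
  qed simp
qed

lemma assumption_B_growth:
  assumes B: "assumption_B \<alpha> D A F \<rho>" and \<rho>: "\<rho> 0 = 0" and D: "0 \<in> D"
  obtains w C where "w \<in> C_infty \<alpha>" "0 < C" "\<And>y. y \<in> D \<Longrightarrow> graph_norm A (F y) \<le> C * w (graph_norm A y)"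
proof -
  from B obtain w C where w: "w \<in> C_infty \<alpha>" and C0: "\<And>r. C r > 0" and C: "\<And>u. (\<forall>t\<ge>0. u t \<in> D) \<Longrightarrow> \<rho> (u 0) < \<infinity> \<Longrightarrow>
      (\<forall>t\<ge>(0::real). graph_norm A (F (u t)) \<le> C (\<rho> (u 0)) * w (graph_norm A (u t)))"
    unfolding assumption_B_def by blast
  have "graph_norm A (F y) \<le> C 0 * w (graph_norm A y)" if "y \<in> D" for y
    using C[of "\<lambda>t. if t = 0 then 0 else y", THEN spec, of 1] that D \<rho> by auto
  then show thesis using w C0 by (intro that)
qed

lemma m_dissipative_selfadjoint:
  fixes D :: "'a::{complex_hilbert, second_countable_topology} set"
  assumes \<alpha>: "0 < \<alpha>" "\<alpha> < 1" and sa: "selfadjoint_operator D A"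
  shows "m_dissipative D (\<lambda>y. \<i> *\<^sub>C A y) \<alpha>"
proof
  have D0: "0 \<in> D" and Dadd: "\<And>x y. x \<in> D \<Longrightarrow> y \<in> D \<Longrightarrow> x + y \<in> D" and Dscale: "\<And>c x. x \<in> D \<Longrightarrow> c *\<^sub>C x \<in> D"
    and Aadd: "\<And>x y. x \<in> D \<Longrightarrow> y \<in> D \<Longrightarrow> A (x + y) = A x + A y" and Ascale: "\<And>c x. x \<in> D \<Longrightarrow> A (c *\<^sub>C x) = c *\<^sub>C A x"
    and dense: "closure D = UNIV"
    using sa by (auto simp: selfadjoint_operator_def densely_defined_operator_def)
  have Dr: "r *\<^sub>R x \<in> D" if "x \<in> D" for r x using Dscale[OF that, of "complex_of_real r"] by (simp add: scaleC_of_real)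
  show "subspace D" using D0 Dadd Dr by (simp add: subspace_def)
  show "\<i> *\<^sub>C A (x + y) = \<i> *\<^sub>C A x + \<i> *\<^sub>C A y" if "x \<in> D" "y \<in> D" for x y
    by (simp add: Aadd that scaleC_add_right)
  show "\<i> *\<^sub>C A (c *\<^sub>R x) = c *\<^sub>R \<i> *\<^sub>C A x" if "x \<in> D" for c x
    using Ascale[OF that, of "complex_of_real c"] by (simp add: scaleC_of_real[symmetric] scaleC_scaleC mult.commute)
  show "closure D = UNIV" by (rule dense)
  show "\<kappa> * norm x \<le> norm (\<kappa> *\<^sub>R x - \<i> *\<^sub>C A x)" if "x \<in> D" "0 < \<kappa>" for x \<kappa>
    by (rule selfadjoint_resolvent(1)[OF sa that(2,1)])
  show "\<exists>x\<in>D. \<kappa> *\<^sub>R x - \<i> *\<^sub>C A x = y" if "0 < \<kappa>" for \<kappa> y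
    by (rule selfadjoint_resolvent(2)[OF sa that])
qed (fact \<alpha>)+

theorem theorem1p3:
  fixes \<alpha> :: real
    and D :: "'a::{complex_hilbert, second_countable_topology} set"
    and A F :: "'a \<Rightarrow> 'a"
    and \<rho> \<rho>' :: "'a \<Rightarrow> ennreal"
    and x :: 'a
  assumes "0 < \<alpha>" and "\<alpha> < 1"
    and "selfadjoint_operator D A"
    and "F ` D \<subseteq> D"
    and "extended_norm_on D \<rho>" and "extended_norm_on D \<rho>'"
    and "assumption_A D A F \<rho>"
    and "assumption_B \<alpha> D A F \<rho>'"
    and "x \<in> D"
    and "max (ennreal (graph_norm A x)) (max (\<rho> x) (\<rho>' x)) < \<infinity>"
  shows "\<exists>u. strict_solution \<alpha> D A F x u \<and>
           (\<forall>v. strict_solution \<alpha> D A F x v \<longrightarrow> (\<forall>t\<ge>0. v t = u t))"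
proof -
  define B where "B y = \<i> *\<^sub>C A y" for y
  define G where "G y = \<i> *\<^sub>C F y" for y
  interpret m_dissipative D B \<alpha>
    using m_dissipative_selfadjoint[OF assms(1-3)] by (simp add: B_def[abs_def])
  have D0: "0 \<in> D" and Dscale: "\<And>c y. y \<in> D \<Longrightarrow> c *\<^sub>C y \<in> D" and Ascale: "\<And>c y. y \<in> D \<Longrightarrow> A (c *\<^sub>C y) = c *\<^sub>C A y"
    using assms(3) by (auto simp: selfadjoint_operator_def densely_defined_operator_def)
  \<comment> \<open>Multiplication by \<i> is isometric: A and B have the same graph norm, and the
    Lipschitz and growth bounds of \<open>F\<close> hold verbatim for \<open>G\<close>.\<close>
  have gn: "graph_norm B y = graph_norm A y" for y by (simp add: graph_norm_def B_def norm_scaleC)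
  have FD: "F y \<in> D" if "y \<in> D" for y using assms(4) that by auto
  have GD: "G y \<in> D" if "y \<in> D" for y using FD[OF that] by (simp add: G_def Dscale)
  have ii: "\<i> *\<^sub>C \<i> *\<^sub>C y = - y" for y :: 'a by (simp add: scaleC_scaleC scaleC_minus_one)
  have scale_diff: "\<i> *\<^sub>C (y - z) = \<i> *\<^sub>C y - \<i> *\<^sub>C z" for y z :: 'a
    by (metis add_diff_cancel diff_add_cancel scaleC_add_right)
  have gni: "graph_norm A (\<i> *\<^sub>C y) = graph_norm A y" if "y \<in> D" for y
    by (simp add: graph_norm_def Ascale that norm_scaleC)
  have \<rho>0: "\<rho> 0 = 0" "\<rho>' 0 = 0" using assms(5,6) D0 by (auto simp: extended_norm_on_def)
  have FDdiff: "F y - F z \<in> D" if "y \<in> D" "z \<in> D" for y z by (intro subspace_diff[OF subspace] FD that)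
  have lip: "locally_lipschitz_on_graph G"
    unfolding locally_lipschitz_on_graph_def
  proof (intro conjI allI)
    show "G ` D \<subseteq> D" using GD by auto
    fix R
    have "graph_norm A (G y - G z) = graph_norm A (F y - F z)" if "y \<in> D" "z \<in> D" for y z
      using gni[OF FDdiff[OF that]] by (simp add: G_def scale_diff)
    then show "\<exists>L\<ge>0. \<forall>y\<in>D. \<forall>z\<in>D. graph_norm B y \<le> R \<longrightarrow> graph_norm B z \<le> R \<longrightarrow>
        graph_norm B (G y - G z) \<le> L * graph_norm B (y - z)"
      using assumption_A_locally_lipschitz[OF assms(7) \<rho>0(1) D0, of R] by (simp add: gn cong: ball_cong)
  qed
  obtain w C where w: "w \<in> C_infty \<alpha>" "0 < C" and growth: "\<And>y. y \<in> D \<Longrightarrow> graph_norm A (F y) \<le> C * w (graph_norm A y)"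
    using assumption_B_growth[OF assms(8) \<rho>0(2) D0] by blast
  obtain u where u: "solves x (\<lambda>s. G (u s)) u"
    using semilinear_exists[OF assms(9) lip w(1) less_imp_le[OF w(2)]] growth
    by (auto simp: gn G_def gni FD)
  have RL: "vector_derivative f (at t within {0..}) = d" if "(f has_vector_derivative d) (at t within {0..})" "0 \<le> t"
    for f :: "real \<Rightarrow> 'a" and d t
    using vector_derivative_within[OF at_within_atLeast_0_neq_bot[OF that(2)] that(1)] .
  have strict: "strict_solution \<alpha> D A F x u"
  proof -
    have uc: "continuous_on {0..} u" and Buc: "continuous_on {0..} (\<lambda>t. B (u t))" using solvesD[OF u] by auto
    have ug: "graph_continuous u" by (rule solves_graph_continuous[OF u])
    have Gg: "graph_continuous (\<lambda>s. G (u s))" by (rule locally_lipschitz_graph_continuous[OF lip ug])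
    define h where "h s = B (u s) + G (u s)" for s
    have h: "continuous_on {0..} h"
      unfolding h_def using Gg by (intro continuous_intros Buc) (simp add: graph_continuous_def)
    have u0: "u 0 = x" using solvesD(3)[OF u, of 0] by simp
    have der: "(convolution (g_kernel (1 - \<alpha>)) (\<lambda>s. u s - u 0) has_vector_derivative h t) (at t within {0..})" if "0 \<le> t" for t
      by (rule RL_of_integral_equation[OF alpha h that]) (use solvesD(3)[OF u] u0 in \<open>simp add: h_def[abs_def]\<close>)
    have RLh: "RL_deriv \<alpha> (\<lambda>s. u s - u 0) t = h t" if "0 \<le> t" for t
      unfolding RL_deriv_def by (rule RL[OF der[OF that] that])
    have cont: "continuous_into_domain D A u"
      unfolding continuous_into_domain_def
    proof (intro allI impI conjI)
      fix t :: real assume t: "0 \<le> t"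
      show "u t \<in> D" by (rule solves_in_domain[OF u t])
      have "((\<lambda>s. norm (u s - u t) + norm (B (u s) - B (u t))) \<longlongrightarrow> norm (u t - u t) + norm (B (u t) - B (u t))) (at t within {0..})"
        using uc Buc t by (intro tendsto_intros) (auto simp: continuous_on)
      then have "((\<lambda>s. norm (u s - u t) + norm (B (u s) - B (u t))) \<longlongrightarrow> 0) (at t within {0..})" by simp
      moreover have "\<forall>\<^sub>F s in at t within {0..}. norm (u s - u t) + norm (B (u s) - B (u t)) = graph_norm A (u s - u t)"
        using t gn
        by (auto simp: eventually_at_filter graph_norm_def[of B] B_diff solves_in_domain[OF u] simp flip: gn)
      ultimately show "((\<lambda>s. graph_norm A (u s - u t)) \<longlongrightarrow> 0) (at t within {0..})"
        by (rule Lim_transform_eventually)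
    qed
    show ?thesis
      unfolding strict_solution_def
    proof (intro conjI allI impI cont u0)
      show "RL_differentiable \<alpha> (\<lambda>s. u s - u 0) t" if "0 \<le> t" for t
        unfolding RL_differentiable_def using der[OF that] by (rule differentiableI_vector)
      show "continuous_on {0..} (RL_deriv \<alpha> (\<lambda>s. u s - u 0))"
        by (rule continuous_on_eq[OF h]) (simp add: RLh)
      show "\<i> *\<^sub>C caputo_deriv \<alpha> u t + A (u t) + F (u t) = 0" if "0 < t" for t
        using RLh[of t] that by (simp add: caputo_deriv_def h_def B_def G_def scaleC_add_right ii)
    qed
  qed
  moreover have "v t = u t" if v: "strict_solution \<alpha> D A F x v" and t: "0 \<le> t" for v t
  proof -
    have vD: "v s \<in> D" and vl: "((\<lambda>r. graph_norm A (v r - v s)) \<longlongrightarrow> 0) (at s within {0..})" if "0 \<le> s" for s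
      using v that by (auto simp: strict_solution_def continuous_into_domain_def)
    have v0: "v 0 = x" using v by (simp add: strict_solution_def)
    have vc: "continuous_on {0..} v"
      unfolding continuous_on
    proof
      fix s :: real assume s: "s \<in> {0..}"
      have "((\<lambda>r. v r - v s) \<longlongrightarrow> 0) (at s within {0..})"
        using s by (intro Lim_null_comparison[OF always_eventually vl]) (auto simp: graph_norm_def)
      then show "(v \<longlongrightarrow> v s) (at s within {0..})" by (rule LIM_zero_cancel)
    qed
    have Bvc: "continuous_on {0..} (\<lambda>t. B (v t))"
      unfolding continuous_on
    proof
      fix s :: real assume s: "s \<in> {0..}"
      have "((\<lambda>r. B (v r) - B (v s)) \<longlongrightarrow> 0) (at s within {0..})"
      proof (rule Lim_null_comparison[OF _ vl])
        show "\<forall>\<^sub>F r in at s within {0..}. norm (B (v r) - B (v s)) \<le> graph_norm A (v r - v s)"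
          unfolding gn[symmetric] using s norm_le_graph_norm(2)
          by (auto simp: eventually_at_filter B_diff[symmetric] vD)
      qed (use s in simp)
      then show "((\<lambda>r. B (v r)) \<longlongrightarrow> B (v s)) (at s within {0..})" by (rule LIM_zero_cancel)
    qed
    have vg: "graph_continuous v" using vc Bvc vD by (simp add: graph_continuous_def)
    have Gg: "graph_continuous (\<lambda>s. G (v s))" by (rule locally_lipschitz_graph_continuous[OF lip vg])
    define h where "h s = B (v s) + G (v s)" for s
    have h: "continuous_on {0..} h"
      unfolding h_def using Gg by (intro continuous_intros Bvc) (simp add: graph_continuous_def)
    let ?H = "RL_deriv \<alpha> (\<lambda>s. v s - v 0)"
    have H: "continuous_on {0..} ?H" using v unfolding strict_solution_def by blast
    have Hh: "?H s = h s" if "0 < s" for s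
    proof -
      have "\<i> *\<^sub>C ?H s + A (v s) + F (v s) = 0"
        using v that unfolding strict_solution_def caputo_deriv_def by blast
      then have "\<i> *\<^sub>C (\<i> *\<^sub>C ?H s + A (v s) + F (v s)) = \<i> *\<^sub>C (0 :: 'a)" by simp
      moreover have "\<i> *\<^sub>C (0 :: 'a) = 0" using scale_diff[of 0 0] by simp
      ultimately show ?thesis by (simp add: scaleC_add_right ii h_def B_def G_def add.assoc add_eq_0_iff2 algebra_simps)
    qed
    \<comment> \<open>The equation is imposed only for t > 0. Both sides are continuous up to 0, so
      it extends there, as the integrated equation requires.\<close>
    have H0: "?H 0 = h 0"
    proof -
      have "((\<lambda>s. ?H s - h s) \<longlongrightarrow> ?H 0 - h 0) (at 0 within {0..})"
        using H h by (intro tendsto_intros) (auto simp: continuous_on)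
      moreover have "\<forall>\<^sub>F s in at 0 within {0..}. ?H s - h s = 0"
        by (auto simp: eventually_at_filter Hh)
      ultimately have "((\<lambda>s :: real. 0 :: 'a) \<longlongrightarrow> ?H 0 - h 0) (at 0 within {0..})"
        by (rule Lim_transform_eventually)
      then have "?H 0 - h 0 = 0"
        using tendsto_unique[OF at_within_atLeast_0_neq_bot[OF order.refl] _ tendsto_const] by metis
      then show ?thesis by simp
    qed
    have der: "(convolution (g_kernel (1 - \<alpha>)) (\<lambda>s. v s - v 0) has_vector_derivative h s) (at s within {0..})" if "0 \<le> s" for s
    proof -
      have "RL_differentiable \<alpha> (\<lambda>s. v s - v 0) s"
        using v that unfolding strict_solution_def by blast
      then have "(convolution (g_kernel (1 - \<alpha>)) (\<lambda>s. v s - v 0) has_vector_derivative ?H s) (at s within {0..})"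
        unfolding RL_differentiable_def RL_deriv_def by (simp only: vector_derivative_works)
      moreover have "?H s = h s" using Hh[of s] H0 that by (cases "s = 0") auto
      ultimately show ?thesis by simp
    qed
    have eq: "v s = x + convolution (g_kernel \<alpha>) (\<lambda>s. B (v s) + G (v s)) s" if "0 \<le> s" for s
      using integral_equation_of_RL[OF alpha h _ der that] vc by (simp add: h_def[abs_def] v0 continuous_on_diff algebra_simps)
    have "solves x (\<lambda>s. G (v s)) v"
      unfolding solves_def using vc Bvc vD eq by blast
    then show ?thesis by (rule semilinear_unique[OF lip _ u t])
  qed
  ultimately show ?thesis by blast
qed

end
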